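(* Let $\varepsilon\in(0,1)$ be any constant. There exists a constant $\beta_0>0$ such that any $\varepsilon$-identity testing algorithm for $\mathcal{M}^-_{\textsc{Ising}}(n,n,\beta_0,0)$ with $\mathrm{poly}(n)$ sample complexity and running time yields (using it as a subroutine) a $\mathrm{poly}(N)$-time algorithm for the decision $r$-approximate counting problem for $\hat{\mathcal{M}}^-_{\textsc{Ising}}(N,3,-0.6,0)$, where $N=\Theta(\sqrt n)$ and $r=\mathrm{poly}(N)$.
   Context: An Ising model $(G,\beta_G,h_G)$ on $G=(V,E)$ with spins $\{1,2\}$ has Gibbs distribution $\mu(\sigma)\propto w(\sigma)=\exp\big(\sum_{\{u,v\}\in E}\beta_G(\{u,v\})\mathbb{1}(\sigma(u)=\sigma(v))+\sum_vh_G(v,\sigma(v))\big)$ and partition function $Z=\sum_\sigma w(\sigma)$; it is antiferromagnetic if $\beta_G(e)<0$ for all edges. $\mathcal{M}^-_{\textsc{Ising}}(n,d,\beta,h)$ is the family of antiferromagnetic Ising models on $n$-vertex graphs of maximum degree at most $d$ with $|\beta_G(e)|\le\beta$ and $|h_G(v,i)|\le h$. $\hat{\mathcal{M}}^-_{\textsc{Ising}}(N,3,-0.6,0)$ is the family of antiferromagnetic Ising models on $N$-vertex graphs of maximum degree at most 3 with every edge weight exactly $-0.6$ and no external field. The $\varepsilon$-identity testing problem for a family $\mathcal{M}$: given explicit $M\in\mathcal{M}$ and sample access to $\mu_{M^*}$, $M^*\in\mathcal{M}$ unknown, distinguish with probability at least $3/4$ between $\mu_M=\mu_{M^*}$ and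 $\|\mu_M-\mu_{M^*}\|_{\mathrm{TV}}\ge1-\varepsilon$. Decision $r$-approximate counting: given a model with partition function $Z$, $r>1$ and $\hat Z$, distinguish with probability at least $5/8$ between $Z\le\hat Z/r$ and $Z\ge r\hat Z$. *)

theory Defs
  imports "HOL-Probability.Probability" "HOL-Computational_Algebra.Polynomial"
    "HOL-Library.Landau_Symbols" "HOL-Library.Log_Nat"
begin

section \<open>Ising models\<close>

text \<open>The vertex set of an \<open>n\<close>-vertex graph is \<open>{..<n}\<close>. An edge is a two-element set of
  vertices; the values of \<open>coupling\<close> off the edge set, and of \<open>ext_field\<close> off the vertices and spins,
  are irrelevant.\<close>

record ising =
  nverts :: nat
  edges :: "nat set set"
  coupling :: "nat set \<Rightarrow> real"
  ext_field :: "nat \<Rightarrow> nat \<Rightarrow> real"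

definition simple_graph :: "ising \<Rightarrow> bool" where
  "simple_graph M \<longleftrightarrow> edges M \<subseteq> {{u, v} | u v. u < nverts M \<and> v < nverts M \<and> u \<noteq> v}"

definition max_degree_le :: "ising \<Rightarrow> nat \<Rightarrow> bool" where
  "max_degree_le M d \<longleftrightarrow> (\<forall>v<nverts M. card {e \<in> edges M. v \<in> e} \<le> d)"

definition configs :: "nat \<Rightarrow> (nat \<Rightarrow> nat) set" where
  "configs n = {..<n} \<rightarrow>\<^sub>E {1, 2}"

definition weight :: "ising \<Rightarrow> (nat \<Rightarrow> nat) \<Rightarrow> real" where
  "weight M \<sigma> = exp ((\<Sum>e\<in>edges M. coupling M e * of_bool (\<forall>u\<in>e. \<forall>v\<in>e. \<sigma> u = \<sigma> v))
                      + (\<Sum>v<nverts M. ext_field M v (\<sigma> v)))"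

definition partition_function :: "ising \<Rightarrow> real" where
  "partition_function M = (\<Sum>\<sigma>\<in>configs (nverts M). weight M \<sigma>)"

definition gibbs :: "ising \<Rightarrow> (nat \<Rightarrow> nat) pmf" where
  "gibbs M = embed_pmf (\<lambda>\<sigma>. if \<sigma> \<in> configs (nverts M) then weight M \<sigma> / partition_function M else 0)"

definition antiferromagnetic :: "ising \<Rightarrow> bool" where
  "antiferromagnetic M \<longleftrightarrow> (\<forall>e\<in>edges M. coupling M e < 0)"

definition ising_minus :: "nat \<Rightarrow> nat \<Rightarrow> real \<Rightarrow> real \<Rightarrow> ising set" where
  "ising_minus n d \<beta> h = {M. simple_graph M \<and> nverts M = n \<and> max_degree_le M d \<and> antiferromagnetic M \<and>
     (\<forall>e\<in>edges M. \<bar>coupling M e\<bar> \<le> \<beta>) \<and> (\<forall>v<n. \<forall>i\<in>{1, 2}. \<bar>ext_field M v i\<bar> \<le> h)}"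

definition ising_minus_hat :: "nat \<Rightarrow> nat \<Rightarrow> real \<Rightarrow> ising set" where
  "ising_minus_hat n d b = {M. simple_graph M \<and> nverts M = n \<and> max_degree_le M d \<and> antiferromagnetic M \<and>
     (\<forall>e\<in>edges M. coupling M e = b) \<and> (\<forall>v<n. \<forall>i\<in>{1, 2}. ext_field M v i = 0)}"

definition tv_dist :: "'a pmf \<Rightarrow> 'a pmf \<Rightarrow> real" where
  "tv_dist p q = (SUP A. \<bar>measure_pmf.prob p A - measure_pmf.prob q A\<bar>)"

lemma finite_configs: "finite (configs n)"
  by (simp add: configs_def finite_PiE)

lemma partition_function_pos: "partition_function M > 0"
proof -
  have "configs (nverts M) \<noteq> {}"
    by (simp add: configs_def PiE_eq_empty_iff)
  then show ?thesis
    unfolding partition_function_def by (intro sum_pos) (auto simp: finite_configs weight_def)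
qed

lemma pmf_gibbs:
  "pmf (gibbs M) \<sigma> = (if \<sigma> \<in> configs (nverts M) then weight M \<sigma> / partition_function M else 0)"
  unfolding gibbs_def
proof (rule pmf_embed_pmf)
  let ?C = "configs (nverts M)" and ?Z = "partition_function M"
  let ?f = "\<lambda>\<sigma>. if \<sigma> \<in> ?C then weight M \<sigma> / ?Z else 0"
  have nn: "weight M \<sigma> / ?Z \<ge> 0" for \<sigma>
    using partition_function_pos[of M] by (simp add: weight_def)
  then show "0 \<le> ?f x" for x by simp
  have "(\<integral>\<^sup>+x. ennreal (?f x) \<partial>count_space UNIV) = (\<integral>\<^sup>+x. ennreal (?f x) \<partial>count_space ?C)"
    by (rule nn_integral_count_space_eq) auto
  also have "\<dots> = (\<Sum>x\<in>?C. ennreal (?f x))"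
    by (simp add: nn_integral_count_space_finite finite_configs)
  also have "\<dots> = ennreal (\<Sum>x\<in>?C. weight M x / ?Z)"
    using nn by (subst sum_ennreal[symmetric]) auto
  also have "(\<Sum>x\<in>?C. weight M x / ?Z) = 1"
    using partition_function_pos[of M]
    by (simp add: sum_divide_distrib[symmetric] partition_function_def)
  finally show "(\<integral>\<^sup>+x. ennreal (?f x) \<partial>count_space UNIV) = 1" by simp
qed

lemma set_pmf_gibbs: "set_pmf (gibbs M) = configs (nverts M)"
  using partition_function_pos[of M] by (auto simp: set_pmf_iff pmf_gibbs weight_def split: if_splits)


section \<open>Randomized algorithms\<close>

text \<open>Algorithms are while programs over binary trees with natural numbers at the leaves. Every
  operation costs one unit of time, except that arithmetic additionally pays for the bit lengths of
  its operands (logarithmic cost); trees are thought of as pointer structures, so copying a value or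
  forming a cell costs one unit. Up to a polynomial this agrees with Turing machine time: in
  time \<open>t\<close> only \<open>t\<close> new cells and only numbers of \<open>O(t)\<close> bits in total can be produced.\<close>

datatype val = Atom nat | Cell val val

primrec vsize :: "val \<Rightarrow> nat" where
  "vsize (Atom n) = 1 + floorlog 2 n"
| "vsize (Cell a b) = 1 + vsize a + vsize b"

primrec nat_of_val :: "val \<Rightarrow> nat" where
  "nat_of_val (Atom n) = n"
| "nat_of_val (Cell a b) = 0"

primrec left_val :: "val \<Rightarrow> val" where
  "left_val (Atom n) = Atom 0"
| "left_val (Cell a b) = a"

primrec right_val :: "val \<Rightarrow> val" where
  "right_val (Atom n) = Atom 0"
| "right_val (Cell a b) = b"

primrec is_cell :: "val \<Rightarrow> bool" where
  "is_cell (Atom n) = False"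
| "is_cell (Cell a b) = True"

datatype arith_op = Add | Sub | Mul | Div | Less

primrec arith_val :: "arith_op \<Rightarrow> nat \<Rightarrow> nat \<Rightarrow> nat" where
  "arith_val Add a b = a + b"
| "arith_val Sub a b = a - b"
| "arith_val Mul a b = a * b"
| "arith_val Div a b = a div b"
| "arith_val Less a b = of_bool (a < b)"

datatype expr =
    Lit val | Reg nat | MkCell expr expr | Left expr | Right expr | IsCell expr
  | Arith arith_op expr expr

type_synonym store = "nat \<Rightarrow> val"

primrec expr_val :: "expr \<Rightarrow> store \<Rightarrow> val" where
  "expr_val (Lit v) s = v"
| "expr_val (Reg x) s = s x"
| "expr_val (MkCell a b) s = Cell (expr_val a s) (expr_val b s)"
| "expr_val (Left a) s = left_val (expr_val a s)"
| "expr_val (Right a) s = right_val (expr_val a s)"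
| "expr_val (IsCell a) s = Atom (of_bool (is_cell (expr_val a s)))"
| "expr_val (Arith f a b) s = Atom (arith_val f (nat_of_val (expr_val a s)) (nat_of_val (expr_val b s)))"

primrec expr_cost :: "expr \<Rightarrow> store \<Rightarrow> nat" where
  "expr_cost (Lit v) s = 1"
| "expr_cost (Reg x) s = 1"
| "expr_cost (MkCell a b) s = 1 + expr_cost a s + expr_cost b s"
| "expr_cost (Left a) s = 1 + expr_cost a s"
| "expr_cost (Right a) s = 1 + expr_cost a s"
| "expr_cost (IsCell a) s = 1 + expr_cost a s"
| "expr_cost (Arith f a b) s = 1 + expr_cost a s + expr_cost b s +
     floorlog 2 (nat_of_val (expr_val a s)) + floorlog 2 (nat_of_val (expr_val b s))"

definition truthy :: "val \<Rightarrow> bool" where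
  "truthy v \<longleftrightarrow> v \<noteq> Atom 0"

text \<open>\<open>Flip x\<close> stores a fair random bit and \<open>Sample x\<close> a fresh sample in register \<open>x\<close>.
  \<open>Call x c y\<close> runs the subroutine on the content of \<open>x\<close> and stores its answer in \<open>y\<close>; whenever
  the subroutine asks for a sample, \<open>c\<close> is executed (with fresh random bits) on the store of the
  caller and the resulting content of register \<open>0\<close> is handed over.\<close>

datatype com =
    Skip | Assign nat expr | Seq com com | If expr com com | While expr com
  | Flip nat | Sample nat | Call nat com nat

partial_function (spmf) while_spmf :: "('a \<Rightarrow> bool) \<Rightarrow> ('a \<Rightarrow> 'a spmf) \<Rightarrow> 'a \<Rightarrow> 'a spmf" where
  "while_spmf b f x = (if b x then bind_spmf (f x) (\<lambda>y. while_spmf b f y) else return_spmf x)"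

text \<open>A \<^emph>\<open>source\<close> produces a value together with the time spent on producing it. A \<^emph>\<open>subroutine\<close> maps
  an input and a source of samples to an answer together with the time spent, the time
  spent by the source included.\<close>

type_synonym source = "(val \<times> nat) spmf"
type_synonym subroutine = "val \<Rightarrow> source \<Rightarrow> (val \<times> nat) spmf"

text \<open>States consist of the store, the time spent and the number of samples drawn so far. The missing
  mass of a sub-probability distribution accounts for divergence and for illegal operations.\<close>

primrec exec :: "source \<Rightarrow> subroutine \<Rightarrow> com \<Rightarrow> store \<times> nat \<times> nat \<Rightarrow> (store \<times> nat \<times> nat) spmf" where
  "exec smp sub Skip = return_spmf"
| "exec smp sub (Assign x e) = (\<lambda>(s, t, k). return_spmf (s(x := expr_val e s), t + 1 + expr_cost e s, k))"
| "exec smp sub (Seq c d) = (\<lambda>z. bind_spmf (exec smp sub c z) (exec smp sub d))"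
| "exec smp sub (If e c d) = (\<lambda>(s, t, k).
     (if truthy (expr_val e s) then exec smp sub c else exec smp sub d) (s, t + 1 + expr_cost e s, k))"
| "exec smp sub (While e c) = (\<lambda>z.
     map_spmf (\<lambda>(s, t, k). (s, t + 1 + expr_cost e s, k))
       (while_spmf (\<lambda>(s, t, k). truthy (expr_val e s))
          (\<lambda>(s, t, k). exec smp sub c (s, t + 1 + expr_cost e s, k)) z))"
| "exec smp sub (Flip x) = (\<lambda>(s, t, k).
     map_spmf (\<lambda>b. (s(x := Atom (of_bool b)), t + 1, k)) coin_spmf)"
| "exec smp sub (Sample x) = (\<lambda>(s, t, k).
     map_spmf (\<lambda>(v, t'). (s(x := v), t + 1 + t', k + 1)) smp)"
| "exec smp sub (Call x c y) = (\<lambda>(s, t, k).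
     map_spmf (\<lambda>(v, t'). (s(y := v), t + 1 + t', k))
       (sub (s x) (map_spmf (\<lambda>(s', t', k'). (s' 0, t')) (exec smp sub c (s, 0, 0)))))"

text \<open>Input and output are passed in register \<open>0\<close>; the result lists output, time and number of
  samples.\<close>

definition run :: "source \<Rightarrow> subroutine \<Rightarrow> com \<Rightarrow> val \<Rightarrow> (val \<times> nat \<times> nat) spmf" where
  "run smp sub c v = map_spmf (\<lambda>(s, t, k). (s 0, t, k)) (exec smp sub c ((\<lambda>_. Atom 0)(0 := v), 0, 0))"

definition no_samples :: source where
  "no_samples = return_pmf None"

definition no_subroutine :: subroutine where
  "no_subroutine = (\<lambda>_ _. return_pmf None)"

text \<open>The program \<open>A\<close> as a subroutine, callable on inputs from \<open>Q\<close> only.\<close>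

definition subroutine_on :: "val set \<Rightarrow> com \<Rightarrow> subroutine" where
  "subroutine_on Q A = (\<lambda>v smp. if v \<in> Q
     then map_spmf (\<lambda>(a, t, k). (a, t)) (run smp no_subroutine A v) else return_pmf None)"


section \<open>Encodings\<close>

definition enc_list :: "val list \<Rightarrow> val" where
  "enc_list vs = foldr Cell vs (Atom 0)"

definition enc_rat :: "rat \<Rightarrow> val" where
  "enc_rat q = (case quotient_of q of (a, b) \<Rightarrow>
     Cell (Cell (Atom (of_bool (a < 0))) (Atom (nat \<bar>a\<bar>))) (Atom (nat b)))"

definition enc_real :: "real \<Rightarrow> val" where
  "enc_real x = enc_rat (THE q. of_rat q = x)"

definition rational_model :: "ising \<Rightarrow> bool" where
  "rational_model M \<longleftrightarrow> (\<forall>e\<in>edges M. coupling M e \<in> \<rat>) \<and> (\<forall>v<nverts M. \<forall>i\<in>{1, 2}. ext_field M v i \<in> \<rat>)"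

text \<open>A model with rational parameters is written down as the number of vertices, the weighted
  adjacency matrix (with \<open>Atom 0\<close> for a non-edge, which is not the code of a rational) and the
  list of external fields.\<close>

definition enc_model :: "ising \<Rightarrow> val" where
  "enc_model M = (let n = nverts M in
     Cell (Atom n)
       (Cell (enc_list (map (\<lambda>u. enc_list (map (\<lambda>v.
                if {u, v} \<in> edges M then enc_real (coupling M {u, v}) else Atom 0) [0..<n])) [0..<n]))
             (enc_list (map (\<lambda>v. Cell (enc_real (ext_field M v 1)) (enc_real (ext_field M v 2))) [0..<n]))))"

definition enc_config :: "nat \<Rightarrow> (nat \<Rightarrow> nat) \<Rightarrow> val" where
  "enc_config n \<sigma> = enc_list (map (\<lambda>v. Atom (\<sigma> v)) [0..<n])"

definition sample_access :: "ising \<Rightarrow> source" where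
  "sample_access M = spmf_of_pmf (map_pmf (\<lambda>\<sigma>. (enc_config (nverts M) \<sigma>, 0)) (gibbs M))"


section \<open>Identity testing and decision approximate counting\<close>

definition prob_accept :: "(val \<times> nat \<times> nat) spmf \<Rightarrow> real" where
  "prob_accept p = measure (measure_spmf p) {(v, t, k). v = Atom 1}"

definition prob_reject :: "(val \<times> nat \<times> nat) spmf \<Rightarrow> real" where
  "prob_reject p = measure (measure_spmf p) {(v, t, k). v = Atom 0}"

text \<open>The program \<open>A\<close> is an \<open>\<epsilon>\<close>-identity testing algorithm for the families \<open>\<M> n\<close>, drawing at most
  \<open>ps(n)\<close> samples and running in time polynomial (bounded by \<open>pt\<close>) in the size of its input, the
  explicit model. Both bounds hold for all outcomes of the coin flips and of the samples. The
  explicit model needs rational parameters, the hidden one does not.\<close>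

definition identity_tester ::
    "(nat \<Rightarrow> ising set) \<Rightarrow> real \<Rightarrow> nat poly \<Rightarrow> nat poly \<Rightarrow> com \<Rightarrow> bool" where
  "identity_tester \<M> \<epsilon> ps pt A \<longleftrightarrow>
     (\<forall>n. \<forall>M\<in>\<M> n. \<forall>M'\<in>\<M> n. rational_model M \<longrightarrow>
        (let res = run (sample_access M') no_subroutine A (enc_model M) in
           lossless_spmf res \<and>
           (\<forall>(v, t, k)\<in>set_spmf res. t \<le> poly pt (vsize (enc_model M)) \<and> k \<le> poly ps n) \<and>
           (gibbs M = gibbs M' \<longrightarrow> prob_accept res \<ge> 3/4) \<and>
           (tv_dist (gibbs M) (gibbs M') \<ge> 1 - \<epsilon> \<longrightarrow> prob_reject res \<ge> 3/4)))"

text \<open>The program \<open>R\<close>, using the subroutine \<open>sub N\<close> on instances with \<open>N\<close> vertices, solves the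
  decision \<open>r(N)\<close>-approximate counting problem for the families \<open>\<M> N\<close>. Its running time, which
  includes the time spent in the subroutine, is polynomial in \<open>N\<close> and the bit length of the
  number \<open>Zhat\<close>.\<close>

definition decision_counter ::
    "(nat \<Rightarrow> ising set) \<Rightarrow> (nat \<Rightarrow> nat) \<Rightarrow> nat poly \<Rightarrow> (nat \<Rightarrow> subroutine) \<Rightarrow> com \<Rightarrow> bool" where
  "decision_counter \<M> r p sub R \<longleftrightarrow>
     (\<forall>N. \<forall>M\<in>\<M> N. \<forall>Zhat::rat. Zhat > 0 \<longrightarrow>
        (let res = run no_samples (sub N) R
                     (Cell (enc_model M) (Cell (Atom (r N)) (enc_rat Zhat))) in
           lossless_spmf res \<and>
           (\<forall>(v, t, k)\<in>set_spmf res. t \<le> poly p (N + vsize (enc_rat Zhat))) \<and>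
           (partition_function M \<le> of_rat Zhat / real (r N) \<longrightarrow> prob_reject res \<ge> 5/8) \<and>
           (partition_function M \<ge> real (r N) * of_rat Zhat \<longrightarrow> prob_accept res \<ge> 5/8)))"

end

theory Submission
  imports Defs
begin

text \<open>Given a cubic graph \<open>G\<close> on \<open>N\<close> vertices and \<open>Zhat\<close>, add four blocks \<open>S\<close>, \<open>T\<close>, \<open>A\<close>, \<open>B\<close> of
  \<open>m = \<Theta>(N\<^sup>2)\<close> vertices. Strong antiferromagnetic complete bipartite graphs on \<open>S, T\<close> and on
  \<open>A, B\<close> leave two phases: if \<open>S\<close> and \<open>A\<close> agree, their couplings to \<open>G\<close> add up and freeze \<open>G\<close>, so that only
  two complementary configurations matter; if they disagree, the couplings cancel and \<open>G\<close> contributes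
  its full partition function \<open>Z\<close>. The coupling between \<open>S\<close> and \<open>A\<close> is tuned such that the frozen phase has about
  the weight that the free phase would have for \<open>Z = Zhat\<close>. Feed the tester this gadget together with
  samples that are uniform on the two frozen configurations. If \<open>Z\<close> is much smaller than \<open>Zhat\<close>, these are
  nearly samples of the gadget. If \<open>Z\<close> is much larger, they are nearly samples of a complete bipartite
  model, which is almost singular to the gadget. So the negated answer of the tester decides the
  counting problem. Samples are compared by domination: the sampling distribution is at most \<open>\<rho>\<close>
  times the Gibbs measure with \<open>\<rho>\<close> close to 1, hence every event of a run with at most \<open>K\<close> samples
  has probability at most \<open>\<rho>\<^sup>K\<close> times its probability under the Gibbs measure.\<close>

section \<open>Domination of runs\<close>

type_synonym state = "store \<times> nat \<times> nat"

definition elapsed :: "state \<Rightarrow> nat" where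
  "elapsed z = fst (snd z)"

definition samples :: "state \<Rightarrow> nat" where
  "samples z = snd (snd z)"

definition delay :: "nat \<Rightarrow> state \<Rightarrow> state" where
  "delay d = (\<lambda>(s, t, k). (s, t + d * k, k))"

lemma state_simps [simp]:
  "elapsed (s, t, k) = t"
  "samples (s, t, k) = k"
  "delay d (s, t, k) = (s, t + d * k, k)"
  by (simp_all add: elapsed_def samples_def delay_def)

lemma set_spmf_bindI: "x \<in> set_spmf p \<Longrightarrow> y \<in> set_spmf (f x) \<Longrightarrow> y \<in> set_spmf (bind_spmf p f)"
  by (auto simp: set_bind_spmf)

lemma nn_integral_bind_spmf:
  "(\<integral>\<^sup>+ y. g y \<partial>measure_spmf (bind_spmf p f)) = (\<integral>\<^sup>+ x. (\<integral>\<^sup>+ y. g y \<partial>measure_spmf (f x)) \<partial>measure_spmf p)"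
  unfolding measure_spmf_bind
  by (subst nn_integral_bind[where B = "count_space UNIV"]) auto

lemma lossless_spmf_nonempty:
  assumes "lossless_spmf p"
  obtains x where "x \<in> set_spmf p"
proof -
  obtain y where "y \<in> set_pmf p"
    using set_pmf_not_empty[of p] by blast
  with assms that show ?thesis
    by (cases y) (auto simp: lossless_iff_set_pmf_None in_set_spmf)
qed

lemma while_spmf_invariant:
  assumes step: "\<And>x y z. b x \<Longrightarrow> y \<in> set_spmf (f x) \<Longrightarrow> P y z \<Longrightarrow> P x z"
    and stop: "\<And>x. \<not> b x \<Longrightarrow> P x x"
    and "z \<in> set_spmf (while_spmf b f x)"
  shows "P x z"
proof -
  have "\<forall>x. set_spmf (while_spmf b f x) \<subseteq> {z. P x z}"
  proof (induction rule: while_spmf.fixp_induct)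
    case (3 W)
    then show ?case
      using step stop by (auto simp: set_bind_spmf bind_UNION) blast
  qed simp_all
  then show ?thesis
    using assms(3) by blast
qed

lemma while_spmf_elapsed_mono:
  assumes "\<And>x y. y \<in> set_spmf (f x) \<Longrightarrow> elapsed x \<le> elapsed y"
    and "z \<in> set_spmf (while_spmf b f x)"
  shows "elapsed x \<le> elapsed z"
  using assms(2) by (rule while_spmf_invariant[rotated 2]) (auto intro: order_trans assms(1))

lemma exec_elapsed_mono:
  "w \<in> set_spmf (exec smp sub c z) \<Longrightarrow> elapsed z \<le> elapsed w"
proof (induction c arbitrary: z w)
  case (Seq c d)
  then obtain x where "x \<in> set_spmf (exec smp sub c z)" "w \<in> set_spmf (exec smp sub d x)"
    by (auto simp: set_bind_spmf)
  then show ?case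
    using Seq.IH order_trans by blast
next
  case (If e c d)
  obtain s t k where "z = (s, t, k)" by (cases z)
  then show ?case
    using If.prems If.IH[of w "(s, t + 1 + expr_cost e s, k)"] by (auto split: if_splits)
next
  case (While e c)
  let ?b = "\<lambda>(s, t, k). truthy (expr_val e s)" and ?f = "\<lambda>(s, t, k). exec smp sub c (s, t + 1 + expr_cost e s, k)"
  obtain s t k where loop: "w = (s, t + 1 + expr_cost e s, k)" "(s, t, k) \<in> set_spmf (while_spmf ?b ?f z)"
    using While.prems by auto
  have "elapsed x \<le> elapsed y" if "y \<in> set_spmf (?f x)" for x y
    using that While.IH by (cases x) fastforce
  then show ?case
    using while_spmf_elapsed_mono[OF _ loop(2)] by (fastforce simp: loop(1))
qed (auto simp: no_subroutine_def)

definition halts_within :: "nat \<Rightarrow> state spmf \<Rightarrow> bool" where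
  "halts_within T p \<longleftrightarrow> lossless_spmf p \<and> (\<forall>z\<in>set_spmf p. elapsed z \<le> T)"

lemma halts_within_bindD:
  assumes "halts_within T (bind_spmf p f)"
    and mono: "\<And>x y. y \<in> set_spmf (f x) \<Longrightarrow> elapsed x \<le> elapsed y"
  shows "halts_within T p" and "x \<in> set_spmf p \<Longrightarrow> halts_within T (f x)"
proof -
  have elapsed_le: "elapsed y \<le> T" if "x \<in> set_spmf p" "y \<in> set_spmf (f x)" for x y
    using assms(1) set_spmf_bindI[where f = f, OF that] unfolding halts_within_def by blast
  have lossless: "lossless_spmf p" "\<And>x. x \<in> set_spmf p \<Longrightarrow> lossless_spmf (f x)"
    using assms(1) by (simp_all add: halts_within_def)
  have "elapsed x \<le> T" if in_p: "x \<in> set_spmf p" for x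
  proof -
    obtain y where "y \<in> set_spmf (f x)"
      using lossless_spmf_nonempty[OF lossless(2)[OF in_p]] .
    with elapsed_le[OF in_p] mono order_trans show ?thesis by blast
  qed
  with lossless(1) show "halts_within T p"
    by (simp add: halts_within_def)
  show "halts_within T (f x)" if "x \<in> set_spmf p"
    using that lossless(2) elapsed_le by (simp add: halts_within_def)
qed

text \<open>An outcome reached with \<open>j\<close> samples in total is at most \<open>\<rho> ^ (j - k)\<close> times as likely under \<open>p\<close> as under \<open>q\<close>,
  and each sample takes \<open>d\<close> more units of time under \<open>p\<close>.\<close>

definition dominated :: "ennreal \<Rightarrow> nat \<Rightarrow> nat \<Rightarrow> state spmf \<Rightarrow> state spmf \<Rightarrow> bool" where
  "dominated \<rho> d k p q \<longleftrightarrow> lossless_spmf p \<and>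
     (\<forall>g. \<rho> ^ k * (\<integral>\<^sup>+ z. g z \<partial>measure_spmf p) \<le> (\<integral>\<^sup>+ z. g (delay d z) * \<rho> ^ samples z \<partial>measure_spmf q))"

lemma dominatedD:
  "dominated \<rho> d k p q \<Longrightarrow>
    \<rho> ^ k * (\<integral>\<^sup>+ z. g z \<partial>measure_spmf p) \<le> (\<integral>\<^sup>+ z. g (delay d z) * \<rho> ^ samples z \<partial>measure_spmf q)"
  by (simp add: dominated_def)

lemma dominated_map:
  assumes "lossless_spmf p"
    and source_le: "\<And>g. \<rho> ^ k * (\<integral>\<^sup>+ x. g x \<partial>measure_spmf p) \<le> \<rho> ^ j * (\<integral>\<^sup>+ y. g (\<phi> y) \<partial>measure_spmf q)"
    and commute: "\<And>y. h (\<phi> y) = delay d (h' y)" "\<And>y. samples (h' y) = j"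
  shows "dominated \<rho> d k (map_spmf h p) (map_spmf h' q)"
  unfolding dominated_def
proof (intro conjI allI)
  fix g :: "state \<Rightarrow> ennreal"
  have "\<rho> ^ k * (\<integral>\<^sup>+ x. g (h x) \<partial>measure_spmf p) \<le> \<rho> ^ j * (\<integral>\<^sup>+ y. g (h (\<phi> y)) \<partial>measure_spmf q)"
    by (rule source_le)
  also have "\<dots> = (\<integral>\<^sup>+ y. g (delay d (h' y)) * \<rho> ^ samples (h' y) \<partial>measure_spmf q)"
    unfolding commute by (subst nn_integral_multc) (simp_all add: mult.commute)
  finally show "\<rho> ^ k * (\<integral>\<^sup>+ z. g z \<partial>measure_spmf (map_spmf h p))
      \<le> (\<integral>\<^sup>+ z. g (delay d z) * \<rho> ^ samples z \<partial>measure_spmf (map_spmf h' q))"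
    by (simp add: o_def)
qed (use assms(1) in simp)

lemma dominated_return: "dominated \<rho> d (samples z) (return_spmf (delay d z)) (return_spmf z)"
  by (simp add: dominated_def measure_spmf_return_spmf nn_integral_return mult.commute)

lemma dominated_support:
  assumes "dominated \<rho> d k p q" "\<rho> \<noteq> 0" "z \<in> set_spmf p"
  obtains w where "w \<in> set_spmf q" "z = delay d w"
proof -
  have "z \<in> delay d ` set_spmf q"
  proof (rule ccontr)
    assume not_in: "z \<notin> delay d ` set_spmf q"
    have "\<rho> ^ k * (\<integral>\<^sup>+ x. indicator {z} x \<partial>measure_spmf p)
        \<le> (\<integral>\<^sup>+ x. indicator {z} (delay d x) * \<rho> ^ samples x \<partial>measure_spmf q)"
      using assms(1) by (rule dominatedD)
    also have "\<dots> = 0"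
      using not_in by (subst nn_integral_0_iff_AE) (auto simp: indicator_def)
    finally have "emeasure (measure_spmf p) {z} = 0"
      using assms(2) by simp
    then show False
      using assms(3) by (simp add: emeasure_spmf_single in_set_spmf_iff_spmf ennreal_eq_0_iff not_le less_le)
  qed
  then show ?thesis using that by blast
qed

lemma dominated_bind:
  assumes dom_p: "dominated \<rho> d k p q" and "\<rho> \<noteq> 0"
    and dom_f: "\<And>w. w \<in> set_spmf q \<Longrightarrow> dominated \<rho> d (samples w) (f (delay d w)) (f' w)"
  shows "dominated \<rho> d k (bind_spmf p f) (bind_spmf q f')"
  unfolding dominated_def
proof (intro conjI allI)
  have "lossless_spmf (f z)" if "z \<in> set_spmf p" for z
    using dominated_support[OF dom_p \<open>\<rho> \<noteq> 0\<close> that] dom_f by (metis dominated_def)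
  then show "lossless_spmf (bind_spmf p f)"
    using dom_p by (simp add: dominated_def)
  fix g :: "state \<Rightarrow> ennreal"
  have "\<rho> ^ k * (\<integral>\<^sup>+ z. g z \<partial>measure_spmf (bind_spmf p f))
      = \<rho> ^ k * (\<integral>\<^sup>+ x. (\<integral>\<^sup>+ z. g z \<partial>measure_spmf (f x)) \<partial>measure_spmf p)"
    by (simp add: nn_integral_bind_spmf)
  also have "\<dots> \<le> (\<integral>\<^sup>+ w. (\<integral>\<^sup>+ z. g z \<partial>measure_spmf (f (delay d w))) * \<rho> ^ samples w \<partial>measure_spmf q)"
    using dom_p by (rule dominatedD)
  also have "\<dots> \<le> (\<integral>\<^sup>+ w. (\<integral>\<^sup>+ z. g (delay d z) * \<rho> ^ samples z \<partial>measure_spmf (f' w)) \<partial>measure_spmf q)"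
  proof (rule nn_integral_mono_AE, rule AE_measure_spmf_iff[THEN iffD2], rule ballI)
    fix w assume "w \<in> set_spmf q"
    then show "(\<integral>\<^sup>+ z. g z \<partial>measure_spmf (f (delay d w))) * \<rho> ^ samples w
        \<le> (\<integral>\<^sup>+ z. g (delay d z) * \<rho> ^ samples z \<partial>measure_spmf (f' w))"
      by (subst mult.commute) (intro dominatedD dom_f)
  qed
  finally show "\<rho> ^ k * (\<integral>\<^sup>+ z. g z \<partial>measure_spmf (bind_spmf p f))
      \<le> (\<integral>\<^sup>+ z. g (delay d z) * \<rho> ^ samples z \<partial>measure_spmf (bind_spmf q f'))"
    by (simp add: nn_integral_bind_spmf)
qed

text \<open>Each iteration takes time, so the induction can be on the time that is left; this avoids a fixed point
  argument.\<close>

lemma dominated_while: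
  assumes "\<rho> \<noteq> 0" and guard: "\<And>z. b (delay d z) = b z"
    and progress: "\<And>z w. w \<in> set_spmf (f' z) \<Longrightarrow> elapsed z < elapsed w"
    and body: "\<And>z. halts_within T (f' z) \<Longrightarrow> dominated \<rho> d (samples z) (f (delay d z)) (f' z)"
    and "halts_within T (while_spmf b f' z)"
  shows "dominated \<rho> d (samples z) (while_spmf b f (delay d z)) (while_spmf b f' z)"
  using assms(5)
proof (induction "T - elapsed z" arbitrary: z rule: less_induct)
  case (less z)
  let ?W = "while_spmf b f" and ?W' = "while_spmf b f'"
  show ?case
  proof (cases "b z")
    case False
    then show ?thesis
      by (subst (1 2) while_spmf.simps) (simp add: guard dominated_return)
  next
    case True
    then have unfold: "?W (delay d z) = bind_spmf (f (delay d z)) ?W" "?W' z = bind_spmf (f' z) ?W'"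
      by (subst while_spmf.simps, simp add: guard)+
    have halts: "halts_within T (f' z)" "\<And>w. w \<in> set_spmf (f' z) \<Longrightarrow> halts_within T (?W' w)"
      using halts_within_bindD[OF less.prems[unfolded unfold(2)]] while_spmf_elapsed_mono[of f'] progress
      by (blast intro: less_imp_le)+
    have "dominated \<rho> d (samples w) (?W (delay d w)) (?W' w)" if in_body: "w \<in> set_spmf (f' z)" for w
    proof (rule less.hyps[OF _ halts(2)[OF in_body]])
      have "elapsed w \<le> T"
        using halts(1) in_body by (simp add: halts_within_def)
      then show "T - elapsed w < T - elapsed z"
        using progress[OF in_body] by linarith
    qed
    then show ?thesis
      unfolding unfold by (intro dominated_bind body halts(1) \<open>\<rho> \<noteq> 0\<close>)
  qed
qed

lemma exec_While_dominated:
  assumes "\<rho> \<noteq> 0"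
    and body: "\<And>z. halts_within T (exec smp' no_subroutine c z) \<Longrightarrow>
      dominated \<rho> d (samples z) (exec smp no_subroutine c (delay d z)) (exec smp' no_subroutine c z)"
    and "halts_within T (exec smp' no_subroutine (While e c) z)"
  shows "dominated \<rho> d (samples z) (exec smp no_subroutine (While e c) (delay d z)) (exec smp' no_subroutine (While e c) z)"
proof -
  let ?b = "\<lambda>(s, t, k). truthy (expr_val e s)" and ?tick = "\<lambda>(s, t, k). (s, t + 1 + expr_cost e s, k)"
  define f where "f sm = (\<lambda>(s, t, k). exec sm no_subroutine c (s, t + 1 + expr_cost e s, k))" for sm
  have f_tick: "f sm w = exec sm no_subroutine c (?tick w)" for sm w
    by (cases w) (simp add: f_def)
  have exec_While: "exec sm no_subroutine (While e c) z
      = bind_spmf (while_spmf ?b (f sm) z) (\<lambda>w. return_spmf (?tick w))" for sm z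
    by (simp add: f_def map_spmf_conv_bind_spmf)
  have tick: "?tick (delay d w) = delay d (?tick w)" "samples (?tick w) = samples w" "elapsed w < elapsed (?tick w)" for w
    by (cases w; simp)+
  have "halts_within T (while_spmf ?b (f smp') z)"
    using halts_within_bindD(1)[OF assms(3)[unfolded exec_While]] by fastforce
  then have loop: "dominated \<rho> d (samples z) (while_spmf ?b (f smp) (delay d z)) (while_spmf ?b (f smp') z)"
  proof (rule dominated_while[rotated 4])
    show "elapsed w < elapsed w'" if "w' \<in> set_spmf (f smp' w)" for w w'
      using exec_elapsed_mono[OF that[unfolded f_tick]] tick(3)[of w] by linarith
    show "dominated \<rho> d (samples w) (f smp (delay d w)) (f smp' w)" if "halts_within T (f smp' w)" for w
      using body[OF that[unfolded f_tick]] unfolding f_tick tick .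
  qed (use \<open>\<rho> \<noteq> 0\<close> in auto)
  have "dominated \<rho> d (samples w) (return_spmf (?tick (delay d w))) (return_spmf (?tick w))" for w
    using dominated_return[of \<rho> d "?tick w"] unfolding tick .
  then show ?thesis
    unfolding exec_While by (intro dominated_bind loop \<open>\<rho> \<noteq> 0\<close>)
qed

definition dominated_source :: "ennreal \<Rightarrow> nat \<Rightarrow> source \<Rightarrow> source \<Rightarrow> bool" where
  "dominated_source \<rho> d p q \<longleftrightarrow> lossless_spmf p \<and>
     (\<forall>g. (\<integral>\<^sup>+ x. g x \<partial>measure_spmf p) \<le> \<rho> * (\<integral>\<^sup>+ (v, t). g (v, t + d) \<partial>measure_spmf q))"

lemma exec_Sample_dominated:
  assumes src: "dominated_source \<rho> d smp smp'"
  shows "dominated \<rho> d (samples z) (exec smp no_subroutine (Sample x) (delay d z)) (exec smp' no_subroutine (Sample x) z)"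
proof -
  obtain s t k where z_eq: "z = (s, t, k)" by (cases z) auto
  have "\<rho> ^ k * (\<integral>\<^sup>+ v. g v \<partial>measure_spmf smp)
      \<le> \<rho> ^ Suc k * (\<integral>\<^sup>+ v. g (case v of (v, t) \<Rightarrow> (v, t + d)) \<partial>measure_spmf smp')" for g
    using src unfolding power_Suc2 mult.assoc
    by (intro mult_left_mono) (simp_all add: dominated_source_def case_prod_unfold)
  then show ?thesis
    using src unfolding z_eq exec.simps delay_def prod.case
    by (intro dominated_map[where \<phi> = "\<lambda>(v, t). (v, t + d)"]) (auto simp: dominated_source_def)
qed

lemma exec_dominated:
  assumes "\<rho> \<noteq> 0" and src: "dominated_source \<rho> d smp smp'"
    and "halts_within T (exec smp' no_subroutine c z)"
  shows "dominated \<rho> d (samples z) (exec smp no_subroutine c (delay d z)) (exec smp' no_subroutine c z)"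
  using assms(3)
proof (induction c arbitrary: z)
  case Skip
  then show ?case by (simp add: dominated_return)
next
  case (Assign x e)
  then show ?case
    using dominated_return[of \<rho> d "case z of (s, t, k) \<Rightarrow> (s(x := expr_val e s), t + 1 + expr_cost e s, k)"]
    by (cases z) (auto simp: ac_simps)
next
  case (Seq c1 c2)
  have "halts_within T (bind_spmf (exec smp' no_subroutine c1 z) (exec smp' no_subroutine c2))"
    using Seq.prems by simp
  from halts_within_bindD[OF this exec_elapsed_mono] show ?case
    unfolding exec.simps by (intro dominated_bind Seq.IH \<open>\<rho> \<noteq> 0\<close>)
next
  case (If e c1 c2)
  obtain s t k where z_eq: "z = (s, t, k)" by (cases z) auto
  show ?case
    using If.prems If.IH[of "(s, t + 1 + expr_cost e s, k)"] by (auto simp: z_eq ac_simps split: if_splits)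
next
  case (While e c)
  then show ?case
    by (intro exec_While_dominated[of _ T] \<open>\<rho> \<noteq> 0\<close>)
next
  case (Flip x)
  obtain s t k where "z = (s, t, k)" by (cases z) auto
  then show ?case
    by (auto intro!: dominated_map[where \<phi> = "\<lambda>b. b" and j = k])
next
  case (Sample x)
  show ?case by (rule exec_Sample_dominated[OF src])
next
  case (Call x c y)
  then show ?case
    by (cases z) (simp add: no_subroutine_def halts_within_def)
qed

context
  fixes \<rho> :: real and d T K :: nat and smp smp' :: source and c :: com and v :: val
  assumes rho_ge_1: "\<rho> \<ge> 1" and src: "dominated_source \<rho> d smp smp'"
    and lossless: "lossless_spmf (run smp' no_subroutine c v)"
    and bounds: "\<forall>(v, t, k) \<in> set_spmf (run smp' no_subroutine c v). t \<le> T \<and> k \<le> K"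
begin

private abbreviation (input) initial :: state where
  "initial \<equiv> ((\<lambda>_. Atom 0)(0 := v), 0, 0)"

private lemma exec_bounds:
  "w \<in> set_spmf (exec smp' no_subroutine c initial) \<Longrightarrow> elapsed w \<le> T \<and> samples w \<le> K"
  using bounds by (cases w) (force simp: run_def)

private lemma exec_initial_dominated:
  "dominated \<rho> d 0 (exec smp no_subroutine c initial) (exec smp' no_subroutine c initial)"
  using exec_dominated[OF _ src, of T c initial] rho_ge_1 lossless exec_bounds
  by (simp add: halts_within_def run_def)

lemma run_dominated_lossless: "lossless_spmf (run smp no_subroutine c v)"
  using exec_initial_dominated by (simp add: run_def dominated_def)

lemma run_dominated_time:
  assumes "(u, t, k) \<in> set_spmf (run smp no_subroutine c v)"
  shows "t \<le> T + d * K"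
proof -
  obtain s where "(s, t, k) \<in> set_spmf (exec smp no_subroutine c initial)"
    using assms by (auto simp: run_def)
  then obtain w where run: "w \<in> set_spmf (exec smp' no_subroutine c initial)" "(s, t, k) = delay d w"
    using rho_ge_1 by (elim dominated_support[OF exec_initial_dominated, rotated]) auto
  then have "t = elapsed w + d * samples w"
    by (cases w) simp
  also have "\<dots> \<le> T + d * K"
    using exec_bounds[OF run(1)] by (intro add_mono mult_left_mono) auto
  finally show ?thesis .
qed

lemma run_dominated_measure:
  "measure (measure_spmf (run smp no_subroutine c v)) {(v, t, k). v \<in> A}
    \<le> \<rho> ^ K * measure (measure_spmf (run smp' no_subroutine c v)) {(v, t, k). v \<in> A}"
proof -
  let ?g = "\<lambda>(s, t, k). indicator A (s 0 :: val) :: ennreal"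
  let ?E = "{(v, t, k). v \<in> A}"
  have event: "emeasure (measure_spmf (run sm no_subroutine c v)) ?E
      = (\<integral>\<^sup>+ z. ?g z \<partial>measure_spmf (exec sm no_subroutine c initial))" for sm
    by (subst nn_integral_indicator[symmetric])
      (auto simp: run_def o_def intro!: nn_integral_cong split: split_indicator)
  have "emeasure (measure_spmf (run smp no_subroutine c v)) ?E
      \<le> (\<integral>\<^sup>+ z. ?g (delay d z) * ennreal \<rho> ^ samples z \<partial>measure_spmf (exec smp' no_subroutine c initial))"
    using dominatedD[OF exec_initial_dominated, of ?g] unfolding event by simp
  also have "\<dots> \<le> (\<integral>\<^sup>+ z. ennreal (\<rho> ^ K) * ?g z \<partial>measure_spmf (exec smp' no_subroutine c initial))"
  proof (rule nn_integral_mono_AE, rule AE_measure_spmf_iff[THEN iffD2], rule ballI)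
    fix z assume "z \<in> set_spmf (exec smp' no_subroutine c initial)"
    with exec_bounds rho_ge_1 show "?g (delay d z) * ennreal \<rho> ^ samples z \<le> ennreal (\<rho> ^ K) * ?g z"
      by (cases z) (auto simp: ennreal_power indicator_def intro!: power_increasing dest!: exec_bounds)
  qed
  also have "\<dots> = ennreal (\<rho> ^ K) * emeasure (measure_spmf (run smp' no_subroutine c v)) ?E"
    unfolding event by (rule nn_integral_cmult) auto
  finally show ?thesis
    using rho_ge_1 by (simp add: measure_spmf.emeasure_eq_measure flip: ennreal_mult)
qed

end

section \<open>Ising models as pair interactions\<close>

definition interaction :: "(nat \<Rightarrow> nat \<Rightarrow> real) \<Rightarrow> bool" where
  "interaction W \<longleftrightarrow> (\<forall>u v. W u v = W v u) \<and> (\<forall>u. W u u = 0)"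

lemma interactionD:
  assumes "interaction W"
  shows "W u v = W v u" "W u u = 0"
  using assms by (auto simp: interaction_def)

definition pair_coupling :: "ising \<Rightarrow> nat \<Rightarrow> nat \<Rightarrow> real" where
  "pair_coupling M u v = (if {u, v} \<in> edges M then coupling M {u, v} else 0)"

definition pair_energy :: "nat \<Rightarrow> (nat \<Rightarrow> nat \<Rightarrow> real) \<Rightarrow> (nat \<Rightarrow> nat) \<Rightarrow> real" where
  "pair_energy n W \<sigma> = (\<Sum>u<n. \<Sum>v<n. W u v * of_bool (\<sigma> u = \<sigma> v)) / 2"

definition total_coupling :: "nat \<Rightarrow> (nat \<Rightarrow> nat \<Rightarrow> real) \<Rightarrow> real" where
  "total_coupling n W = (\<Sum>u<n. \<Sum>v<n. W u v) / 2"

lemma pair_energy_const: "pair_energy n W (\<lambda>_. c) = total_coupling n W"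
  by (simp add: pair_energy_def total_coupling_def)

lemma pair_energy_cong: "(\<And>i. i < n \<Longrightarrow> \<sigma> i = \<sigma>' i) \<Longrightarrow> pair_energy n W \<sigma> = pair_energy n W \<sigma>'"
  by (simp add: pair_energy_def)

lemma pair_energy_nonpos:
  assumes "\<And>u v. W u v \<le> 0"
  shows "pair_energy n W \<sigma> \<le> 0"
proof -
  have "(\<Sum>u<n. \<Sum>v<n. W u v * of_bool (\<sigma> u = \<sigma> v)) \<le> 0"
    by (intro sum_nonpos mult_nonpos_nonneg assms) simp
  then show ?thesis
    by (simp only: pair_energy_def divide_le_0_iff) simp
qed

lemma pair_energy_ge_total_coupling:
  assumes "\<And>u v. W u v \<le> 0"
  shows "pair_energy n W \<sigma> \<ge> total_coupling n W"
  unfolding pair_energy_def total_coupling_def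
proof (intro divide_right_mono sum_mono)
  show "W u v \<le> W u v * of_bool (\<sigma> u = \<sigma> v)" for u v
    using assms[of u v] by simp
qed simp

lemma simple_graph_no_loop: "simple_graph M \<Longrightarrow> {u} \<notin> edges M"
  by (auto simp: simple_graph_def doubleton_eq_iff)

lemma simple_graph_edgeE:
  assumes "simple_graph M" "e \<in> edges M"
  obtains u v where "e = {u, v}" "u < nverts M" "v < nverts M" "u \<noteq> v"
  using assms by (auto simp: simple_graph_def)

lemma finite_edges: "simple_graph M \<Longrightarrow> finite (edges M)"
  by (rule finite_subset[of _ "Pow {..<nverts M}"]) (auto simp: simple_graph_def)

lemma sum_pairs_eq_twice_sum_edges:
  fixes f :: "nat set \<Rightarrow> real"
  assumes simple: "simple_graph M"
  shows "(\<Sum>u<nverts M. \<Sum>v<nverts M. if {u, v} \<in> edges M then f {u, v} else 0) = 2 * (\<Sum>e\<in>edges M. f e)"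
proof -
  let ?n = "nverts M" and ?pair = "\<lambda>x. {fst x, snd x}"
  define P where "P = {x \<in> {..<?n} \<times> {..<?n}. ?pair x \<in> edges M}"
  have two_orientations: "card {x \<in> P. ?pair x = e} = 2" if edge: "e \<in> edges M" for e
  proof -
    obtain u v where endpoints: "e = {u, v}" "u < ?n" "v < ?n" "u \<noteq> v"
      using simple edge by (rule simple_graph_edgeE)
    moreover from this edge have "{v, u} \<in> edges M"
      by (simp only: insert_commute)
    ultimately have "{x \<in> P. ?pair x = e} = {(u, v), (v, u)}"
      using edge by (auto simp: P_def doubleton_eq_iff)
    then show ?thesis using endpoints(4) by simp
  qed
  have "(\<Sum>u<?n. \<Sum>v<?n. if {u, v} \<in> edges M then f {u, v} else 0) = (\<Sum>x\<in>P. f (?pair x))"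
    unfolding P_def sum.cartesian_product by (subst sum.inter_filter) (simp_all add: case_prod_unfold)
  also have "\<dots> = (\<Sum>e\<in>edges M. real (card {x \<in> P. ?pair x = e}) * f e)"
    by (rule sum_fun_comp) (auto simp: P_def finite_edges[OF simple])
  also have "\<dots> = (\<Sum>e\<in>edges M. 2 * f e)"
    by (intro sum.cong) (auto simp: two_orientations)
  finally show ?thesis by (simp add: sum_distrib_left)
qed

lemma sum_edges_eq_pair_energy:
  assumes "simple_graph M"
  shows "(\<Sum>e\<in>edges M. coupling M e * of_bool (\<forall>u\<in>e. \<forall>v\<in>e. \<sigma> u = \<sigma> v))
    = pair_energy (nverts M) (pair_coupling M) \<sigma>"
proof -
  let ?f = "\<lambda>e. coupling M e * of_bool (\<forall>u\<in>e. \<forall>v\<in>e. \<sigma> u = \<sigma> v) :: real"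
  have "pair_coupling M u v * of_bool (\<sigma> u = \<sigma> v) = (if {u, v} \<in> edges M then ?f {u, v} else 0)" for u v
  proof -
    have "(\<forall>a\<in>{u, v}. \<forall>b\<in>{u, v}. \<sigma> a = \<sigma> b) \<longleftrightarrow> \<sigma> u = \<sigma> v"
      by auto
    then show ?thesis
      by (simp only: pair_coupling_def if_distrib[of "\<lambda>x. x * _"] mult_zero_left cong: if_cong)
  qed
  then show ?thesis
    unfolding pair_energy_def by (simp only: sum_pairs_eq_twice_sum_edges[OF assms, of ?f])
qed

lemma configs_value: "\<sigma> \<in> configs n \<Longrightarrow> u < n \<Longrightarrow> \<sigma> u \<in> {1, 2}"
  unfolding configs_def PiE_iff by blast

lemma configs_eqI: "\<sigma> \<in> configs n \<Longrightarrow> \<tau> \<in> configs n \<Longrightarrow> (\<And>u. u < n \<Longrightarrow> \<sigma> u = \<tau> u) \<Longrightarrow> \<sigma> = \<tau>"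
  using PiE_ext[of \<sigma> "{..<n}" _ \<tau>] by (simp add: configs_def)

lemma card_configs: "card (configs n) = 2 ^ n"
  by (simp add: configs_def card_PiE numeral_2_eq_2)

lemma weight_pos: "weight M \<sigma> > 0"
  by (simp add: weight_def)

lemma weight_eq_exp_pair_energy:
  assumes "simple_graph M" and no_field: "\<forall>v<nverts M. \<forall>i\<in>{1, 2}. ext_field M v i = 0" and in_configs: "\<sigma> \<in> configs (nverts M)"
  shows "weight M \<sigma> = exp (pair_energy (nverts M) (pair_coupling M) \<sigma>)"
proof -
  have "ext_field M v (\<sigma> v) = 0" if "v < nverts M" for v
    using no_field configs_value[OF in_configs that] that by blast
  then show ?thesis
    using sum_edges_eq_pair_energy[OF assms(1)] by (simp add: weight_def)
qed

lemma interaction_pair_coupling: "simple_graph M \<Longrightarrow> interaction (pair_coupling M)"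
  unfolding interaction_def pair_coupling_def
  by (simp add: simple_graph_no_loop insert_commute)

definition model_of :: "nat \<Rightarrow> (nat \<Rightarrow> nat \<Rightarrow> real) \<Rightarrow> ising" where
  "model_of n W = \<lparr>nverts = n, edges = {{u, v} | u v. u < n \<and> v < n \<and> u \<noteq> v \<and> W u v \<noteq> 0},
     coupling = (\<lambda>e. W (Min e) (Max e)), ext_field = (\<lambda>_ _. 0)\<rparr>"

lemma model_of_simps [simp]:
  "nverts (model_of n W) = n"
  "ext_field (model_of n W) v i = 0"
  by (simp_all add: model_of_def)

lemma simple_graph_model_of: "simple_graph (model_of n W)"
  by (auto simp: simple_graph_def model_of_def)

lemma edges_model_of_iff:
  assumes "interaction W" "u < n" "v < n"
  shows "{u, v} \<in> edges (model_of n W) \<longleftrightarrow> W u v \<noteq> 0"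
proof -
  have "(\<exists>a b. {u, v} = {a, b} \<and> a < n \<and> b < n \<and> a \<noteq> b \<and> W a b \<noteq> 0) \<longleftrightarrow> u \<noteq> v \<and> W u v \<noteq> 0"
    using interactionD(1)[OF assms(1), of u v] assms(2,3) by (auto simp: doubleton_eq_iff)
  then have "{u, v} \<in> edges (model_of n W) \<longleftrightarrow> u \<noteq> v \<and> W u v \<noteq> 0"
    by (simp add: model_of_def)
  then show ?thesis
    using interactionD(2)[OF assms(1)] by blast
qed

lemma coupling_model_of: "interaction W \<Longrightarrow> coupling (model_of n W) {u, v} = W u v"
  using interactionD(1)[of W u v] by (cases u v rule: linorder_cases) (simp_all add: model_of_def min_def max_def)

lemma model_of_edgeE:
  assumes "interaction W" "e \<in> edges (model_of n W)"
  obtains u v where "coupling (model_of n W) e = W u v" "W u v \<noteq> 0"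
proof -
  obtain u v where "e = {u, v}" "W u v \<noteq> 0"
    using assms(2) by (auto simp: model_of_def)
  then show ?thesis
    using that coupling_model_of[OF assms(1)] by blast
qed

lemma pair_coupling_model_of: "interaction W \<Longrightarrow> u < n \<Longrightarrow> v < n \<Longrightarrow> pair_coupling (model_of n W) u v = W u v"
  by (simp add: pair_coupling_def edges_model_of_iff coupling_model_of)

lemma weight_model_of:
  assumes "interaction W" "\<sigma> \<in> configs n"
  shows "weight (model_of n W) \<sigma> = exp (pair_energy n W \<sigma>)"
proof -
  have "weight (model_of n W) \<sigma> = exp (pair_energy n (pair_coupling (model_of n W)) \<sigma>)"
    using weight_eq_exp_pair_energy[OF simple_graph_model_of, of n W \<sigma>] assms(2) by simp
  also have "pair_energy n (pair_coupling (model_of n W)) \<sigma> = pair_energy n W \<sigma>"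
    unfolding pair_energy_def by (simp add: pair_coupling_model_of assms)
  finally show ?thesis .
qed

lemma max_degree_le_nverts:
  assumes "simple_graph M"
  shows "max_degree_le M (nverts M)"
  unfolding max_degree_le_def
proof (intro allI impI)
  fix v
  have "{e \<in> edges M. v \<in> e} \<subseteq> (\<lambda>u. {v, u}) ` {..<nverts M}"
  proof
    fix e assume edge: "e \<in> {e \<in> edges M. v \<in> e}"
    then obtain a b where "e = {a, b}" "a < nverts M" "b < nverts M"
      using assms by (blast elim: simple_graph_edgeE)
    with edge show "e \<in> (\<lambda>u. {v, u}) ` {..<nverts M}" by auto
  qed
  then have "card {e \<in> edges M. v \<in> e} \<le> card {..<nverts M}"
    by (meson card_image_le card_mono finite_imageI finite_lessThan order_trans)
  then show "card {e \<in> edges M. v \<in> e} \<le> nverts M" by simp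
qed

lemma model_of_in_ising_minus:
  assumes interaction_W: "interaction W" and "\<And>u v. W u v \<le> 0" "\<And>u v. \<bar>W u v\<bar> \<le> \<beta>"
  shows "model_of n W \<in> ising_minus n n \<beta> 0"
proof -
  have "coupling (model_of n W) e < 0 \<and> \<bar>coupling (model_of n W) e\<bar> \<le> \<beta>" if edge: "e \<in> edges (model_of n W)" for e
  proof -
    obtain u v where "coupling (model_of n W) e = W u v" "W u v \<noteq> 0"
      using interaction_W edge by (rule model_of_edgeE)
    then show ?thesis
      using assms(2)[of u v] assms(3)[of u v] by simp
  qed
  then show ?thesis
    using max_degree_le_nverts[OF simple_graph_model_of, of n W]
    by (simp add: ising_minus_def antiferromagnetic_def simple_graph_model_of)
qed

lemma rational_model_of:
  assumes interaction_W: "interaction W" and "\<And>u v. W u v \<in> \<rat>"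
  shows "rational_model (model_of n W)"
proof -
  have "coupling (model_of n W) e \<in> \<rat>" if edge: "e \<in> edges (model_of n W)" for e
    using model_of_edgeE[OF interaction_W edge] assms(2) by metis
  then show ?thesis by (simp add: rational_model_def)
qed

lemma partition_function_model_of_pair_coupling:
  assumes "simple_graph M" "\<forall>v<nverts M. \<forall>i\<in>{1, 2}. ext_field M v i = 0"
  shows "partition_function (model_of (nverts M) (pair_coupling M)) = partition_function M"
  unfolding partition_function_def model_of_simps
  using weight_eq_exp_pair_energy[OF assms] weight_model_of[OF interaction_pair_coupling[OF assms(1)]]
  by (intro sum.cong) simp_all

lemma partition_function_model_of_bounds:
  assumes interaction_W: "interaction W" and nonpos: "\<And>u v. W u v \<le> 0"
  shows "exp (total_coupling n W) \<le> partition_function (model_of n W)"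
    and "partition_function (model_of n W) \<le> 2 ^ n"
proof -
  have Z_eq: "partition_function (model_of n W) = (\<Sum>\<sigma>\<in>configs n. exp (pair_energy n W \<sigma>))"
    by (simp add: partition_function_def weight_model_of[OF interaction_W])
  obtain \<sigma> where in_configs: "\<sigma> \<in> configs n"
    using card_configs[of n] by fastforce
  have "exp (total_coupling n W) \<le> exp (pair_energy n W \<sigma>)"
    using pair_energy_ge_total_coupling[of W, OF nonpos] by simp
  also have "\<dots> \<le> partition_function (model_of n W)"
    unfolding Z_eq using in_configs by (intro member_le_sum) (auto simp: finite_configs)
  finally show "exp (total_coupling n W) \<le> partition_function (model_of n W)" .
  have "partition_function (model_of n W) \<le> (\<Sum>\<sigma>\<in>configs n. 1)"
    unfolding Z_eq using pair_energy_nonpos[of W, OF nonpos] by (intro sum_mono) simp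
  then show "partition_function (model_of n W) \<le> 2 ^ n"
    by (simp add: card_configs)
qed

section \<open>The block models\<close>

definition mono_pairs :: "nat set \<Rightarrow> nat set \<Rightarrow> (nat \<Rightarrow> nat) \<Rightarrow> real" where
  "mono_pairs X Y \<sigma> = (\<Sum>u\<in>X. \<Sum>v\<in>Y. of_bool (\<sigma> u = \<sigma> v))"

lemma mono_pairs_nonneg: "mono_pairs X Y \<sigma> \<ge> 0"
  unfolding mono_pairs_def by (intro sum_nonneg) simp

lemma mono_pairs_commute: "mono_pairs X Y \<sigma> = mono_pairs Y X \<sigma>"
  unfolding mono_pairs_def by (subst sum.swap) (simp only: eq_commute)

lemma mono_pairs_ge_card:
  assumes "finite X" "finite Y" and partner: "\<And>u. u \<in> X \<Longrightarrow> \<exists>v\<in>Y. \<sigma> u = \<sigma> v"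
  shows "mono_pairs X Y \<sigma> \<ge> card X"
proof -
  have "1 \<le> (\<Sum>v\<in>Y. of_bool (\<sigma> u = \<sigma> v) :: real)" if in_X: "u \<in> X" for u
  proof -
    obtain v where mono: "v \<in> Y" "\<sigma> u = \<sigma> v" using partner[OF in_X] by blast
    have "of_bool (\<sigma> u = \<sigma> v) \<le> (\<Sum>v\<in>Y. of_bool (\<sigma> u = \<sigma> v) :: real)"
      using mono assms(2) by (intro member_le_sum) auto
    then show ?thesis using mono by simp
  qed
  then have "(\<Sum>u\<in>X. 1) \<le> mono_pairs X Y \<sigma>"
    unfolding mono_pairs_def by (intro sum_mono)
  then show ?thesis by simp
qed

text \<open>One monochromatic pair between two blocks already forces many: with two spins, a block that is not constant
  contains a partner for every vertex of the other block.\<close>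

lemma mono_pairs_ge_of_mono_pair:
  assumes "finite X" "finite Y" "card X = m" "card Y = m"
    and spins: "\<And>u. u \<in> X \<union> Y \<Longrightarrow> \<sigma> u \<in> {1, 2}"
    and "u \<in> X" "v \<in> Y" "\<sigma> u = \<sigma> v"
  shows "mono_pairs X Y \<sigma> \<ge> m"
proof (cases "\<forall>w\<in>X. \<sigma> w = \<sigma> u")
  case True
  then show ?thesis
    using mono_pairs_ge_card[of X Y \<sigma>] assms by auto
next
  case False
  then obtain w where "w \<in> X" "\<sigma> w \<noteq> \<sigma> u" by blast
  moreover from this have "\<sigma> y = \<sigma> u \<or> \<sigma> y = \<sigma> w" if "y \<in> Y" for y
    using spins[of y] spins[of w] spins[of u] that assms(6) by auto
  ultimately have "\<exists>x\<in>X. \<sigma> y = \<sigma> x" if "y \<in> Y" for y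
    using that assms(6) by blast
  then show ?thesis
    using mono_pairs_ge_card[of Y X \<sigma>] assms mono_pairs_commute[of X Y] by auto
qed

lemma mono_pairs_const:
  assumes "\<And>u. u \<in> X \<Longrightarrow> \<sigma> u = c" "\<And>v. v \<in> Y \<Longrightarrow> \<sigma> v = a"
  shows "mono_pairs X Y \<sigma> = (if c = a then real (card X) * real (card Y) else 0)"
  using assms by (simp add: mono_pairs_def)

text \<open>The blocks are numbered in the order \<open>S\<close>, \<open>T\<close>, \<open>A\<close>, \<open>B\<close>, \<open>V\<close>; the first four have \<open>m\<close> vertices, the last
  one has \<open>N\<close> and carries the given graph.\<close>

definition block :: "nat \<Rightarrow> nat \<Rightarrow> nat \<Rightarrow> nat set" where
  "block m N a = (if a < 4 then {a * m..<a * m + m} else {4 * m..<4 * m + N})"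

definition block_of :: "nat \<Rightarrow> nat \<Rightarrow> nat" where
  "block_of m u = (if u < 4 * m then u div m else 4)"

lemma finite_block [simp]: "finite (block m N a)"
  by (simp add: block_def)

lemma card_block: "card (block m N a) = (if a < 4 then m else N)"
  by (simp add: block_def)

lemma block_of_less_4: "u < 4 * m \<Longrightarrow> block_of m u < 4"
  by (simp add: block_of_def less_mult_imp_div_less)

lemma mem_block_of: "u < 4 * m + N \<Longrightarrow> u \<in> block m N (block_of m u)"
proof (cases "u < 4 * m")
  case True
  then have "m > 0" by (cases m) auto
  then have "u div m * m \<le> u" "u < u div m * m + m"
    using div_mult_mod_eq[of u m] mod_less_divisor[of m u] by linarith+
  then show ?thesis
    using block_of_less_4[OF True] True by (simp add: block_def block_of_def)
qed (simp add: block_def block_of_def)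

lemma block_less:
  assumes "a < 4" "u \<in> block m N a"
  shows "u < 4 * m"
proof -
  have "u < a * m + m"
    using assms by (simp add: block_def)
  also have "\<dots> \<le> 4 * m"
    using assms(1) mult_le_mono1[of "Suc a" 4 m] by simp
  finally show ?thesis .
qed

lemma block_less_size: "u \<in> block m N a \<Longrightarrow> u < 4 * m + N"
  using block_less[of a u m N] by (cases "a < 4") (auto simp: block_def)

lemma block_of_eq:
  assumes "u \<in> block m N a" "a < 5"
  shows "block_of m u = a"
proof (cases "a < 4")
  case True
  then have "u div m = a"
    using assms by (intro div_nat_eqI) (auto simp: block_def mult.commute)
  then show ?thesis
    using block_less[OF True assms(1)] by (simp add: block_of_def)
qed (use assms in \<open>auto simp: block_def block_of_def\<close>)

lemma less_5: "{..<5::nat} = {0, 1, 2, 3, 4}"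
  by auto

lemma sum_blocks:
  fixes f :: "nat \<Rightarrow> 'a :: comm_monoid_add"
  shows "(\<Sum>u<4 * m + N. f u) = (\<Sum>a<5. \<Sum>u\<in>block m N a. f u)"
proof -
  have "(\<Sum>u<4 * m + N. f u) = sum f {0..<m} + sum f {m..<m + m} + sum f {2 * m..<3 * m}
      + sum f {3 * m..<4 * m} + sum f {4 * m..<4 * m + N}"
    by (simp add: sum.atLeastLessThan_concat mult_2[symmetric] flip: atLeast0LessThan)
  then show ?thesis
    by (simp add: less_5 block_def ac_simps)
qed

lemma sum_last_block:
  fixes f :: "nat \<Rightarrow> 'a :: comm_monoid_add"
  shows "(\<Sum>u\<in>block m N 4. f u) = (\<Sum>i<N. f (4 * m + i))"
  using sum.shift_bounds_nat_ivl[of f 0 "4 * m" N] by (simp add: block_def add.commute lessThan_atLeast0)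

definition block_coupling :: "nat \<Rightarrow> (nat \<Rightarrow> nat \<Rightarrow> real) \<Rightarrow> (nat \<Rightarrow> nat \<Rightarrow> real) \<Rightarrow> nat \<Rightarrow> nat \<Rightarrow> real" where
  "block_coupling m g J u v = (if 4 * m \<le> u \<and> 4 * m \<le> v then g (u - 4 * m) (v - 4 * m)
     else J (block_of m u) (block_of m v))"

lemma interaction_block_coupling:
  assumes "interaction g" "interaction J"
  shows "interaction (block_coupling m g J)"
  unfolding interaction_def
proof (intro conjI allI)
  show "block_coupling m g J u v = block_coupling m g J v u" for u v
    unfolding block_coupling_def
    by (simp only: conj_commute[of "4 * m \<le> u"] interactionD(1)[OF assms(1), of "u - 4 * m"]
        interactionD(1)[OF assms(2), of "block_of m u"])
  show "block_coupling m g J u u = 0" for u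
    by (simp add: block_coupling_def assms interactionD(2))
qed

lemma block_coupling_block:
  assumes "u \<in> block m N a" "v \<in> block m N b" "a < 5" "b < 5" "a < 4 \<or> b < 4"
  shows "block_coupling m g J u v = J a b"
  using assms block_of_eq[OF assms(1,3)] block_of_eq[OF assms(2,4)] block_less[of a u m N] block_less[of b v m N]
  by (auto simp: block_coupling_def)

lemma pair_energy_block_coupling:
  assumes "interaction J"
  shows "pair_energy (4 * m + N) (block_coupling m g J) \<sigma>
    = (\<Sum>a<5. \<Sum>b<5. J a b * mono_pairs (block m N a) (block m N b) \<sigma>) / 2
      + pair_energy N g (\<lambda>i. \<sigma> (4 * m + i))"
proof -
  let ?B = "block m N" and ?n = "4 * m + N"
  let ?f = "\<lambda>u v. block_coupling m g J u v * of_bool (\<sigma> u = \<sigma> v)"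
  let ?J = "\<lambda>a b. J a b * mono_pairs (?B a) (?B b) \<sigma>" and ?g = "2 * pair_energy N g (\<lambda>i. \<sigma> (4 * m + i))"
  have J_last: "J 4 4 = 0"
    using assms by (rule interactionD)
  have block_pair: "(\<Sum>u\<in>?B a. \<Sum>v\<in>?B b. ?f u v) = ?J a b + (if a = 4 \<and> b = 4 then ?g else 0)"
    if "a < 5" "b < 5" for a b
  proof (cases "a = 4 \<and> b = 4")
    case True
    then show ?thesis
      by (simp add: sum_last_block J_last block_coupling_def pair_energy_def)
  next
    case False
    with that have "a < 4 \<or> b < 4" by linarith
    then have "(\<Sum>u\<in>?B a. \<Sum>v\<in>?B b. ?f u v) = (\<Sum>u\<in>?B a. \<Sum>v\<in>?B b. J a b * of_bool (\<sigma> u = \<sigma> v))"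
      using that by (intro sum.cong refl) (simp only: block_coupling_block)
    then show ?thesis
      using False by (simp only: mono_pairs_def sum_distrib_left) simp
  qed
  have "(\<Sum>u<?n. \<Sum>v<?n. ?f u v) = (\<Sum>a<5. \<Sum>u\<in>?B a. \<Sum>b<5. \<Sum>v\<in>?B b. ?f u v)"
    by (simp only: sum_blocks)
  also have "\<dots> = (\<Sum>a<5. \<Sum>b<5. \<Sum>u\<in>?B a. \<Sum>v\<in>?B b. ?f u v)"
    by (intro sum.cong refl sum.swap)
  also have "\<dots> = (\<Sum>a<5. \<Sum>b<5. ?J a b + (if a = 4 \<and> b = 4 then ?g else 0))"
    by (intro sum.cong refl) (simp only: block_pair lessThan_iff)
  also have "\<dots> = (\<Sum>a<5. \<Sum>b<5. ?J a b) + ?g"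
    by (simp add: sum.distrib less_5)
  finally show ?thesis
    by (simp add: pair_energy_def[of ?n])
qed

text \<open>In \<open>gadget_table\<close> the pairs \<open>S, T\<close> and \<open>A, B\<close> are locked in opposite states, and \<open>V\<close> is either
  pinned (if \<open>S\<close> and \<open>A\<close> agree) or free (if they disagree); the coupling \<open>\<omega>\<close> balances the two phases.\<close>

definition gadget_table :: "real \<Rightarrow> real \<Rightarrow> real \<Rightarrow> nat \<Rightarrow> nat \<Rightarrow> real" where
  "gadget_table \<beta> \<omega> \<kappa> a b =
    (if {a, b} \<in> {{0, 1}, {2, 3}} then - \<beta> else if {a, b} = {0, 2} then - \<omega>
     else if {a, b} \<in> {{0, 4}, {2, 4}} then - \<kappa> else 0)"

definition bipartite_table :: "real \<Rightarrow> nat \<Rightarrow> nat \<Rightarrow> real" where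
  "bipartite_table \<beta> a b = (if (a \<in> {0, 2}) \<noteq> (b \<in> {0, 2}) then - \<beta> else 0)"

lemma interaction_gadget_table: "interaction (gadget_table \<beta> \<omega> \<kappa>)"
  unfolding interaction_def
proof (intro conjI allI)
  show "gadget_table \<beta> \<omega> \<kappa> a b = gadget_table \<beta> \<omega> \<kappa> b a" for a b
    unfolding gadget_table_def by (simp only: insert_commute[of a])
  have "{a} \<noteq> {x, y}" if "x \<noteq> y" for a x y :: nat
    using that by (auto simp: doubleton_eq_iff)
  then show "gadget_table \<beta> \<omega> \<kappa> a a = 0" for a
    by (simp add: gadget_table_def)
qed

lemma interaction_bipartite_table: "interaction (bipartite_table \<beta>)"
  by (auto simp: interaction_def bipartite_table_def)

lemma interaction_zero: "interaction (\<lambda>_ _. 0)"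
  by (simp add: interaction_def)

definition gadget :: "nat \<Rightarrow> nat \<Rightarrow> (nat \<Rightarrow> nat \<Rightarrow> real) \<Rightarrow> real \<Rightarrow> real \<Rightarrow> real \<Rightarrow> ising" where
  "gadget m N g \<beta> \<omega> \<kappa> = model_of (4 * m + N) (block_coupling m g (gadget_table \<beta> \<omega> \<kappa>))"

definition bipartite :: "nat \<Rightarrow> nat \<Rightarrow> real \<Rightarrow> ising" where
  "bipartite m N \<beta> = model_of (4 * m + N) (block_coupling m (\<lambda>_ _. 0) (bipartite_table \<beta>))"

lemma nverts_block_models [simp]:
  "nverts (gadget m N g \<beta> \<omega> \<kappa>) = 4 * m + N"
  "nverts (bipartite m N \<beta>) = 4 * m + N"
  by (simp_all add: gadget_def bipartite_def)

lemma gadget_energy: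
  "pair_energy (4 * m + N) (block_coupling m g (gadget_table \<beta> \<omega> \<kappa>)) \<sigma>
    = - \<beta> * (mono_pairs (block m N 0) (block m N 1) \<sigma> + mono_pairs (block m N 2) (block m N 3) \<sigma>)
      - \<omega> * mono_pairs (block m N 0) (block m N 2) \<sigma>
      - \<kappa> * (mono_pairs (block m N 0) (block m N 4) \<sigma> + mono_pairs (block m N 2) (block m N 4) \<sigma>)
      + pair_energy N g (\<lambda>i. \<sigma> (4 * m + i))"
proof -
  have "mono_pairs (block m N b) (block m N a) \<sigma> = mono_pairs (block m N a) (block m N b) \<sigma>" if "a < b" for a b
    by (rule mono_pairs_commute)
  then show ?thesis
    by (subst pair_energy_block_coupling[OF interaction_gadget_table])
      (simp add: gadget_table_def doubleton_eq_iff less_5 field_simps)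
qed

lemma bipartite_energy:
  "pair_energy (4 * m + N) (block_coupling m (\<lambda>_ _. 0) (bipartite_table \<beta>)) \<sigma>
    = - \<beta> * (mono_pairs (block m N 0) (block m N 1) \<sigma> + mono_pairs (block m N 0) (block m N 3) \<sigma>
      + mono_pairs (block m N 0) (block m N 4) \<sigma> + mono_pairs (block m N 1) (block m N 2) \<sigma>
      + mono_pairs (block m N 2) (block m N 3) \<sigma> + mono_pairs (block m N 2) (block m N 4) \<sigma>)"
proof -
  have "mono_pairs (block m N b) (block m N a) \<sigma> = mono_pairs (block m N a) (block m N b) \<sigma>" if "a < b" for a b
    by (rule mono_pairs_commute)
  moreover have "pair_energy N (\<lambda>_ _. 0) \<tau> = 0" for \<tau>
    by (simp add: pair_energy_def)
  ultimately show ?thesis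
    by (subst pair_energy_block_coupling[OF interaction_bipartite_table])
      (simp add: bipartite_table_def less_5 field_simps)
qed

lemma weight_gadget:
  assumes "interaction g" "\<sigma> \<in> configs (4 * m + N)"
  shows "weight (gadget m N g \<beta> \<omega> \<kappa>) \<sigma> = exp (pair_energy (4 * m + N) (block_coupling m g (gadget_table \<beta> \<omega> \<kappa>)) \<sigma>)"
  unfolding gadget_def
  by (intro weight_model_of interaction_block_coupling interaction_gadget_table assms)

lemma weight_bipartite:
  assumes "\<sigma> \<in> configs (4 * m + N)"
  shows "weight (bipartite m N \<beta>) \<sigma>
    = exp (pair_energy (4 * m + N) (block_coupling m (\<lambda>_ _. 0) (bipartite_table \<beta>)) \<sigma>)"
  unfolding bipartite_def
  by (intro weight_model_of interaction_block_coupling interaction_bipartite_table interaction_zero assms)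

subsection \<open>Locked configurations\<close>

definition locked_config :: "nat \<Rightarrow> nat \<Rightarrow> nat \<Rightarrow> nat \<Rightarrow> (nat \<Rightarrow> nat) \<Rightarrow> nat \<Rightarrow> nat" where
  "locked_config m N c a \<tau> u = (if u < 4 * m then [c, 3 - c, a, 3 - a] ! block_of m u
     else if u < 4 * m + N then \<tau> (u - 4 * m) else undefined)"

definition frozen_config :: "nat \<Rightarrow> nat \<Rightarrow> nat \<Rightarrow> nat \<Rightarrow> nat" where
  "frozen_config m N c = locked_config m N c c (\<lambda>_. 3 - c)"

lemma less_4_cases: "(a::nat) < 4 \<Longrightarrow> a = 0 \<or> a = 1 \<or> a = 2 \<or> a = 3"
  by linarith

lemma locked_config_block: "x < 4 \<Longrightarrow> u \<in> block m N x \<Longrightarrow> locked_config m N c a \<tau> u = [c, 3 - c, a, 3 - a] ! x"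
  using block_of_eq[of u m N x] block_less[of x u m N] by (simp add: locked_config_def)

lemma locked_config_last: "i < N \<Longrightarrow> locked_config m N c a \<tau> (4 * m + i) = \<tau> i"
  by (simp add: locked_config_def)

lemma locked_config_in_configs:
  assumes "c \<in> {1, 2}" "a \<in> {1, 2}" "\<And>i. i < N \<Longrightarrow> \<tau> i \<in> {1, 2}"
  shows "locked_config m N c a \<tau> \<in> configs (4 * m + N)"
proof -
  have "locked_config m N c a \<tau> u \<in> {1, 2}" if "u < 4 * m + N" for u
  proof (cases "u < 4 * m")
    case True
    then show ?thesis
      using less_4_cases[OF block_of_less_4[OF True]] assms(1,2) by (auto simp: locked_config_def)
  next
    case False
    with that have "u - 4 * m < N" by linarith
    with False that show ?thesis
      using assms(3) by (simp add: locked_config_def)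
  qed
  then show ?thesis
    by (auto simp: configs_def PiE_iff extensional_def locked_config_def)
qed

lemma frozen_config_in_configs: "c \<in> {1, 2} \<Longrightarrow> frozen_config m N c \<in> configs (4 * m + N)"
  unfolding frozen_config_def by (rule locked_config_in_configs) auto

lemma frozen_configs_distinct: "m > 0 \<Longrightarrow> frozen_config m N 1 \<noteq> frozen_config m N 2"
  by (auto simp: frozen_config_def locked_config_def block_of_def dest: fun_cong[of _ _ 0])

lemma mono_pairs_locked_config:
  assumes "x < 4" "y < 4"
  shows "mono_pairs (block m N x) (block m N y) (locked_config m N c a \<tau>)
    = (if [c, 3 - c, a, 3 - a] ! x = [c, 3 - c, a, 3 - a] ! y then (real m)\<^sup>2 else 0)"
  using mono_pairs_const[of "block m N x" "locked_config m N c a \<tau>" _ "block m N y"]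
    locked_config_block[OF assms(1)] locked_config_block[OF assms(2)] assms
  by (simp add: card_block power2_eq_square)

lemma mono_pairs_locked_config_last:
  assumes "x < 4"
  shows "mono_pairs (block m N x) (block m N 4) (locked_config m N c a \<tau>)
    = real m * real (card {i. i < N \<and> \<tau> i = [c, 3 - c, a, 3 - a] ! x})"
proof -
  let ?\<sigma> = "locked_config m N c a \<tau>" and ?s = "[c, 3 - c, a, 3 - a] ! x"
  have "(\<Sum>v\<in>block m N 4. of_bool (?s = ?\<sigma> v) :: real) = (\<Sum>i<N. of_bool (\<tau> i = ?s))"
    unfolding sum_last_block by (intro sum.cong) (auto simp: locked_config_last)
  also have "\<dots> = real (card {i. i < N \<and> \<tau> i = ?s})"
    by (simp add: Int_def)
  finally show ?thesis
    using assms by (simp add: mono_pairs_def locked_config_block card_block)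
qed

lemma locked_blocks:
  assumes "\<sigma> \<in> configs (4 * m + N)" "m > 0" "a < 4" "b < 4"
    and less: "mono_pairs (block m N a) (block m N b) \<sigma> < m"
  obtains c where "c \<in> {1, 2}" "\<And>u. u \<in> block m N a \<Longrightarrow> \<sigma> u = c" "\<And>u. u \<in> block m N b \<Longrightarrow> \<sigma> u = 3 - c"
proof -
  have spins: "\<sigma> u \<in> {1, 2}" if "u \<in> block m N a \<union> block m N b" for u
    using that configs_value[OF assms(1)] block_less_size by blast
  have differ: "\<sigma> u \<noteq> \<sigma> v" if "u \<in> block m N a" "v \<in> block m N b" for u v
    using mono_pairs_ge_of_mono_pair[of "block m N a" "block m N b" m \<sigma> u v] spins that less assms(3,4)
    by (auto simp: card_block)
  have "block m N a \<noteq> {}" "block m N b \<noteq> {}"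
    using assms(2-4) by (auto simp: block_def)
  then obtain x y where witnesses: "x \<in> block m N a" "y \<in> block m N b"
    by blast
  show ?thesis
  proof (rule that)
    show "\<sigma> x \<in> {1, 2}" using spins witnesses(1) by blast
    show "\<sigma> u = \<sigma> x" if "u \<in> block m N a" for u
      using spins[of u] spins[of x] spins[of y] differ[OF that witnesses(2)] differ[OF witnesses] that witnesses by auto
    show "\<sigma> u = 3 - \<sigma> x" if "u \<in> block m N b" for u
      using spins[of u] spins[of x] differ[OF witnesses(1) that] that witnesses by auto
  qed
qed

lemma locked_configE:
  assumes in_configs: "\<sigma> \<in> configs (4 * m + N)" and "m > 0"
    and "mono_pairs (block m N 0) (block m N 1) \<sigma> < m" "mono_pairs (block m N 2) (block m N 3) \<sigma> < m"
  obtains c a \<tau> where "c \<in> {1, 2}" "a \<in> {1, 2}" "\<tau> \<in> configs N" "\<sigma> = locked_config m N c a \<tau>"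
proof -
  obtain c where S_T: "c \<in> {1, 2}" "\<And>u. u \<in> block m N 0 \<Longrightarrow> \<sigma> u = c" "\<And>u. u \<in> block m N 1 \<Longrightarrow> \<sigma> u = 3 - c"
    by (rule locked_blocks[OF in_configs \<open>m > 0\<close> _ _ assms(3)]) auto
  obtain a where A_B: "a \<in> {1, 2}" "\<And>u. u \<in> block m N 2 \<Longrightarrow> \<sigma> u = a" "\<And>u. u \<in> block m N 3 \<Longrightarrow> \<sigma> u = 3 - a"
    by (rule locked_blocks[OF in_configs \<open>m > 0\<close> _ _ assms(4)]) auto
  define \<tau> where "\<tau> = restrict (\<lambda>i. \<sigma> (4 * m + i)) {..<N}"
  have \<tau>_spin: "\<tau> i \<in> {1, 2}" if "i < N" for i
    using configs_value[OF in_configs, of "4 * m + i"] that by (simp add: \<tau>_def)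
  have "\<sigma> = locked_config m N c a \<tau>"
  proof (rule configs_eqI[OF in_configs locked_config_in_configs[OF S_T(1) A_B(1) \<tau>_spin]])
    fix u assume less: "u < 4 * m + N"
    show "\<sigma> u = locked_config m N c a \<tau> u"
    proof (cases "u < 4 * m")
      case True
      from less_4_cases[OF block_of_less_4[OF True]] mem_block_of[OF less] S_T A_B show ?thesis
        using True by (auto simp: locked_config_def)
    next
      case False
      with less have "u - 4 * m < N" by linarith
      with False less show ?thesis by (simp add: locked_config_def \<tau>_def)
    qed
  qed
  moreover have "\<tau> \<in> configs N"
    using \<tau>_spin by (auto simp: configs_def PiE_iff \<tau>_def)
  ultimately show ?thesis using that S_T(1) A_B(1) by blast
qed

lemma one_le_card_spin:
  fixes i N :: nat
  assumes "i < N" "\<tau> i = c"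
  shows "1 \<le> real (card {i. i < N \<and> \<tau> i = c})"
proof -
  have "card {i} \<le> card {i. i < N \<and> \<tau> i = c}"
    using assms by (intro card_mono) simp_all
  then show ?thesis by simp
qed

lemma eq_frozen_config:
  assumes in_configs: "\<sigma> \<in> configs (4 * m + N)" and "m > 0"
    and less: "mono_pairs (block m N 0) (block m N 1) \<sigma> < m" "mono_pairs (block m N 2) (block m N 3) \<sigma> < m"
      "mono_pairs (block m N 1) (block m N 2) \<sigma> < m" "mono_pairs (block m N 0) (block m N 4) \<sigma> < m"
  shows "\<sigma> \<in> frozen_config m N ` {1, 2}"
proof -
  obtain c a \<tau> where spins: "c \<in> {1, 2}" "a \<in> {1, 2}" and on_graph: "\<tau> \<in> configs N" and \<sigma>_eq: "\<sigma> = locked_config m N c a \<tau>"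
    using locked_configE[OF in_configs \<open>m > 0\<close> less(1,2)] .
  have m_le_square: "real m \<le> (real m)\<^sup>2"
    using \<open>m > 0\<close> by (simp add: power2_eq_square flip: of_nat_mult)
  have "3 - c \<noteq> a"
    using less(3) m_le_square by (auto simp: \<sigma>_eq mono_pairs_locked_config)
  with spins have [simp]: "a = c" by auto
  have "\<tau> i \<noteq> c" if "i < N" for i
  proof
    assume "\<tau> i = c"
    then have "real m * 1 \<le> real m * real (card {i. i < N \<and> \<tau> i = c})"
      using that by (intro mult_left_mono one_le_card_spin) auto
    with less(4) show False
      by (simp add: \<sigma>_eq mono_pairs_locked_config_last)
  qed
  then have "\<tau> i = 3 - c" if "i < N" for i
    using that spins(1) configs_value[OF on_graph that] by auto
  then have "\<sigma> = frozen_config m N c"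
    unfolding \<sigma>_eq frozen_config_def by (auto simp: locked_config_def fun_eq_iff)
  with spins(1) show ?thesis by blast
qed

subsection \<open>Weights and partition functions\<close>

lemma weight_frozen_bipartite:
  assumes "c \<in> {1, 2}"
  shows "weight (bipartite m N \<beta>) (frozen_config m N c) = 1"
proof -
  have "c \<noteq> 3 - c" using assms by auto
  then show ?thesis
    unfolding weight_bipartite[OF frozen_config_in_configs[OF assms]]
    unfolding bipartite_energy frozen_config_def
    by (simp add: mono_pairs_locked_config mono_pairs_locked_config_last)
qed

lemma weight_bipartite_le:
  assumes not_frozen: "\<sigma> \<in> configs (4 * m + N)" "\<sigma> \<notin> frozen_config m N ` {1, 2}" and "m > 0" "\<beta> \<ge> 0"
  shows "weight (bipartite m N \<beta>) \<sigma> \<le> exp (- \<beta> * m)"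
proof -
  let ?p = "\<lambda>a b. mono_pairs (block m N a) (block m N b) \<sigma>"
  have nonneg: "?p a b \<ge> 0" for a b by (rule mono_pairs_nonneg)
  have "\<not> (?p 0 1 < m \<and> ?p 2 3 < m \<and> ?p 1 2 < m \<and> ?p 0 4 < m)"
    using eq_frozen_config[OF not_frozen(1) \<open>m > 0\<close>] not_frozen(2) by blast
  then have "\<beta> * m \<le> \<beta> * (?p 0 1 + ?p 0 3 + ?p 0 4 + ?p 1 2 + ?p 2 3 + ?p 2 4)"
    using nonneg[of 0 1] nonneg[of 0 3] nonneg[of 0 4] nonneg[of 1 2] nonneg[of 2 3] nonneg[of 2 4] \<open>\<beta> \<ge> 0\<close>
    by (intro mult_left_mono) linarith+
  then show ?thesis
    unfolding weight_bipartite[OF not_frozen(1)] bipartite_energy by simp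
qed

lemma partition_function_le:
  assumes "finite P" "B \<ge> 0" "\<And>\<sigma>. \<sigma> \<in> configs (nverts M) \<Longrightarrow> \<sigma> \<notin> f ` P \<Longrightarrow> weight M \<sigma> \<le> B"
  shows "partition_function M \<le> (\<Sum>x\<in>P. weight M (f x)) + 2 ^ nverts M * B"
proof -
  let ?C = "configs (nverts M)"
  have nonneg: "weight M \<sigma> \<ge> 0" for \<sigma> by (rule less_imp_le[OF weight_pos])
  have "partition_function M \<le> (\<Sum>\<sigma>\<in>f ` P \<union> (?C - f ` P). weight M \<sigma>)"
    unfolding partition_function_def using assms(1) nonneg finite_configs by (intro sum_mono2) auto
  also have "\<dots> = (\<Sum>\<sigma>\<in>f ` P. weight M \<sigma>) + (\<Sum>\<sigma>\<in>?C - f ` P. weight M \<sigma>)"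
    using assms(1) finite_configs by (intro sum.union_disjoint) auto
  also have "(\<Sum>\<sigma>\<in>f ` P. weight M \<sigma>) \<le> (\<Sum>x\<in>P. weight M (f x))"
    using sum_image_le[of P "weight M" f] assms(1) nonneg by (simp add: o_def)
  also have "(\<Sum>\<sigma>\<in>?C - f ` P. weight M \<sigma>) \<le> (\<Sum>\<sigma>\<in>?C - f ` P. B)"
    using assms(3) by (intro sum_mono) auto
  also have "\<dots> = real (card (?C - f ` P)) * B"
    by simp
  also have "\<dots> \<le> real (card ?C) * B"
    using assms(2) by (intro mult_right_mono of_nat_mono card_mono finite_configs) auto
  finally show ?thesis by (simp add: card_configs)
qed

lemma partition_function_bipartite_le:
  assumes "m > 0" "\<beta> \<ge> 0"
  shows "partition_function (bipartite m N \<beta>) \<le> 2 + 2 ^ (4 * m + N) * exp (- \<beta> * m)"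
proof -
  have "partition_function (bipartite m N \<beta>)
      \<le> (\<Sum>c\<in>{1, 2}. weight (bipartite m N \<beta>) (frozen_config m N c)) + 2 ^ nverts (bipartite m N \<beta>) * exp (- \<beta> * m)"
    using weight_bipartite_le[OF _ _ assms] by (intro partition_function_le) auto
  then show ?thesis
    by (simp add: weight_frozen_bipartite)
qed

lemma card_spin_add_card_spin:
  assumes "\<tau> \<in> configs N" "c \<in> {1, 2}" "a \<in> {1, 2}" "a \<noteq> c"
  shows "card {i. i < N \<and> \<tau> i = c} + card {i. i < N \<and> \<tau> i = a} = N"
proof -
  have "card {i. i < N \<and> \<tau> i = c} + card {i. i < N \<and> \<tau> i = a}
      = card ({i. i < N \<and> \<tau> i = c} \<union> {i. i < N \<and> \<tau> i = a})"
    using assms(4) by (subst card_Un_disjoint) auto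
  also have "{i. i < N \<and> \<tau> i = c} \<union> {i. i < N \<and> \<tau> i = a} = {..<N}"
    using configs_value[OF assms(1)] assms(2-4) by fastforce
  finally show ?thesis by simp
qed

context
  fixes m N :: nat and g :: "nat \<Rightarrow> nat \<Rightarrow> real" and \<beta> \<omega> \<kappa> :: real
  assumes interaction_g: "interaction g"
begin

private abbreviation (input) gad :: ising where
  "gad \<equiv> gadget m N g \<beta> \<omega> \<kappa>"

lemma weight_gadget_aligned:
  assumes "c \<in> {1, 2}" "\<And>i. i < N \<Longrightarrow> \<tau> i \<in> {1, 2}"
  shows "weight gad (locked_config m N c c \<tau>)
    = exp (- \<omega> * (real m)\<^sup>2) * exp (- 2 * \<kappa> * m * card {i. i < N \<and> \<tau> i = c} + pair_energy N g \<tau>)"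
proof -
  have in_configs: "locked_config m N c c \<tau> \<in> configs (4 * m + N)"
    by (intro locked_config_in_configs assms)
  have "c \<noteq> 3 - c" using assms(1) by auto
  moreover have "pair_energy N g (\<lambda>i. locked_config m N c c \<tau> (4 * m + i)) = pair_energy N g \<tau>"
    by (rule pair_energy_cong) (rule locked_config_last)
  ultimately show ?thesis
    unfolding weight_gadget[OF interaction_g in_configs] gadget_energy
    by (simp add: mono_pairs_locked_config mono_pairs_locked_config_last flip: exp_add)
qed

lemma weight_gadget_opposed:
  assumes "c \<in> {1, 2}" "a \<in> {1, 2}" "a \<noteq> c" "\<tau> \<in> configs N"
  shows "weight gad (locked_config m N c a \<tau>) = exp (- \<kappa> * m * N) * exp (pair_energy N g \<tau>)"
proof -
  have in_configs: "locked_config m N c a \<tau> \<in> configs (4 * m + N)"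
    by (intro locked_config_in_configs assms(1,2) configs_value[OF assms(4)])
  have "c \<noteq> 3 - c" "a \<noteq> 3 - a" using assms(1,2) by auto
  moreover have "pair_energy N g (\<lambda>i. locked_config m N c a \<tau> (4 * m + i)) = pair_energy N g \<tau>"
    by (rule pair_energy_cong) (rule locked_config_last)
  moreover have "real m * card {i. i < N \<and> \<tau> i = c} + real m * card {i. i < N \<and> \<tau> i = a} = real m * real N"
    unfolding distrib_left[symmetric] of_nat_add[symmetric] card_spin_add_card_spin[OF assms(4,1-3)] ..
  ultimately show ?thesis
    using assms(3)
    unfolding weight_gadget[OF interaction_g in_configs] gadget_energy
    by (simp add: mono_pairs_locked_config mono_pairs_locked_config_last flip: exp_add)
qed

lemma weight_gadget_frozen:
  assumes "c \<in> {1, 2}"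
  shows "weight gad (frozen_config m N c) = exp (- \<omega> * (real m)\<^sup>2) * exp (total_coupling N g)"
proof -
  have no_c: "{i. i < N \<and> 3 - c = c} = {}" using assms by auto
  show ?thesis
    unfolding frozen_config_def by (subst weight_gadget_aligned) (use assms no_c in \<open>auto simp: pair_energy_const\<close>)
qed

lemma sum_weight_gadget_opposed:
  assumes "c \<in> {1, 2}" "a \<in> {1, 2}" "a \<noteq> c"
  shows "(\<Sum>\<tau>\<in>configs N. weight gad (locked_config m N c a \<tau>)) = exp (- \<kappa> * m * N) * partition_function (model_of N g)"
  by (simp add: partition_function_def sum_distrib_left weight_gadget_opposed[OF assms] weight_model_of[OF interaction_g])

lemma partition_function_gadget_ge: "exp (- \<kappa> * m * N) * partition_function (model_of N g) \<le> partition_function gad"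
proof -
  have inj: "inj_on (locked_config m N 1 2) (configs N)"
  proof (rule inj_onI)
    fix \<tau> \<tau>' assume eq: "\<tau> \<in> configs N" "\<tau>' \<in> configs N" "locked_config m N 1 2 \<tau> = locked_config m N 1 2 \<tau>'"
    show "\<tau> = \<tau>'"
    proof (rule configs_eqI[OF eq(1,2)])
      show "\<tau> i = \<tau>' i" if "i < N" for i
        using fun_cong[OF eq(3), of "4 * m + i"] that by (simp add: locked_config_last)
    qed
  qed
  have "exp (- \<kappa> * m * N) * partition_function (model_of N g)
      = (\<Sum>\<tau>\<in>configs N. weight gad (locked_config m N 1 2 \<tau>))"
    by (rule sum_weight_gadget_opposed[symmetric]) auto
  also have "\<dots> = (\<Sum>\<sigma>\<in>locked_config m N 1 2 ` configs N. weight gad \<sigma>)"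
    by (rule sum.reindex[OF inj, unfolded o_def, symmetric])
  also have "\<dots> \<le> partition_function gad"
    unfolding partition_function_def
    using locked_config_in_configs[of 1 2 N _ m] configs_value
    by (intro sum_mono2) (auto simp: finite_configs less_imp_le[OF weight_pos] simp del: insert_iff)
  finally show ?thesis .
qed

context
  assumes g_nonpos: "\<And>u v. g u v \<le> 0" and pos: "m > 0" "\<beta> \<ge> 0" "\<omega> \<ge> 0" "\<kappa> \<ge> 0"
begin

lemma weight_gadget_not_locked_le:
  assumes in_configs: "\<sigma> \<in> configs (4 * m + N)"
    and not_locked: "\<sigma> \<notin> (\<lambda>(c, a, \<tau>). locked_config m N c a \<tau>) ` ({1, 2} \<times> {1, 2} \<times> configs N)"
  shows "weight gad \<sigma> \<le> exp (- \<beta> * m)"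
proof -
  let ?p = "\<lambda>a b. mono_pairs (block m N a) (block m N b) \<sigma>"
  have nonneg: "?p a b \<ge> 0" for a b by (rule mono_pairs_nonneg)
  have "?p 0 1 \<ge> m \<or> ?p 2 3 \<ge> m"
  proof (rule ccontr)
    assume "\<not> ?thesis"
    then have "?p 0 1 < m" "?p 2 3 < m" by (simp_all only: de_Morgan_disj not_le)
    then obtain c a \<tau> where "c \<in> {1, 2}" "a \<in> {1, 2}" "\<tau> \<in> configs N" "\<sigma> = locked_config m N c a \<tau>"
      by (rule locked_configE[OF in_configs pos(1)])
    then have "\<sigma> \<in> (\<lambda>(c, a, \<tau>). locked_config m N c a \<tau>) ` ({1, 2} \<times> {1, 2} \<times> configs N)"
      by (intro image_eqI[of _ _ "(c, a, \<tau>)"]) simp_all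
    with not_locked show False by blast
  qed
  then have "\<beta> * m \<le> \<beta> * (?p 0 1 + ?p 2 3)"
    using nonneg[of 0 1] nonneg[of 2 3] pos(2) by (intro mult_left_mono) auto
  moreover have "\<omega> * ?p 0 2 \<ge> 0" "\<kappa> * (?p 0 4 + ?p 2 4) \<ge> 0"
    using nonneg pos by simp_all
  moreover have "pair_energy N g (\<lambda>i. \<sigma> (4 * m + i)) \<le> 0"
    by (intro pair_energy_nonpos g_nonpos)
  ultimately show ?thesis
    unfolding weight_gadget[OF interaction_g in_configs] gadget_energy by simp
qed

lemma weight_gadget_aligned_le:
  assumes spin: "c \<in> {1, 2}" and in_configs: "\<tau> \<in> configs N" and defect: "i < N" "\<tau> i = c"
  shows "weight gad (locked_config m N c c \<tau>) \<le> exp (- \<omega> * (real m)\<^sup>2) * exp (- 2 * \<kappa> * m)"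
proof -
  have "2 * \<kappa> * m * 1 \<le> 2 * \<kappa> * m * card {i. i < N \<and> \<tau> i = c}"
    using defect pos by (intro mult_left_mono one_le_card_spin) simp_all
  then have "- 2 * \<kappa> * m * card {i. i < N \<and> \<tau> i = c} + pair_energy N g \<tau> \<le> - 2 * \<kappa> * m"
    using pair_energy_nonpos[of g N \<tau>, OF g_nonpos] by linarith
  then show ?thesis
    using weight_gadget_aligned[OF spin, of \<tau>] configs_value[OF in_configs] by (simp add: mult_left_mono)
qed

lemma sum_weight_gadget_aligned_le:
  assumes spin: "c \<in> {1, 2}"
  shows "(\<Sum>\<tau>\<in>configs N. weight gad (locked_config m N c c \<tau>))
    \<le> exp (- \<omega> * (real m)\<^sup>2) * (exp (total_coupling N g) + 2 ^ N * exp (- 2 * \<kappa> * m))"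
proof -
  let ?W = "exp (- \<omega> * (real m)\<^sup>2)" and ?f = "\<lambda>\<tau>. weight gad (locked_config m N c c \<tau>)"
  define \<tau>\<^sub>0 where "\<tau>\<^sub>0 = restrict (\<lambda>_. 3 - c) {..<N}"
  have \<tau>\<^sub>0: "\<tau>\<^sub>0 \<in> configs N" using spin by (auto simp: configs_def \<tau>\<^sub>0_def)
  have "locked_config m N c c \<tau>\<^sub>0 = frozen_config m N c"
    by (auto simp: frozen_config_def locked_config_def \<tau>\<^sub>0_def fun_eq_iff)
  then have frozen: "?f \<tau>\<^sub>0 = ?W * exp (total_coupling N g)"
    using weight_gadget_frozen[OF spin] by simp
  have other: "?f \<tau> \<le> ?W * exp (- 2 * \<kappa> * m)" if not_frozen: "\<tau> \<in> configs N - {\<tau>\<^sub>0}" for \<tau>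
  proof -
    have "\<exists>i<N. \<tau> i \<noteq> \<tau>\<^sub>0 i"
      using not_frozen \<tau>\<^sub>0 configs_eqI by blast
    then obtain i where defect: "i < N" "\<tau> i \<noteq> 3 - c"
      by (auto simp: \<tau>\<^sub>0_def)
    with not_frozen spin configs_value[of \<tau> N i] have "\<tau> i = c" by auto
    with not_frozen defect spin show ?thesis
      by (intro weight_gadget_aligned_le) auto
  qed
  have "(\<Sum>\<tau>\<in>configs N. ?f \<tau>) = ?f \<tau>\<^sub>0 + (\<Sum>\<tau>\<in>configs N - {\<tau>\<^sub>0}. ?f \<tau>)"
    by (rule sum.remove[OF finite_configs \<tau>\<^sub>0])
  also have "(\<Sum>\<tau>\<in>configs N - {\<tau>\<^sub>0}. ?f \<tau>) \<le> (\<Sum>\<tau>\<in>configs N. ?W * exp (- 2 * \<kappa> * m))"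
    by (rule order_trans[OF sum_mono[OF other] sum_mono2]) (auto simp: finite_configs)
  finally show ?thesis
    by (simp add: frozen card_configs algebra_simps)
qed

lemma partition_function_gadget_le:
  "partition_function gad
    \<le> 2 * exp (- \<omega> * (real m)\<^sup>2) * (exp (total_coupling N g) + 2 ^ N * exp (- 2 * \<kappa> * m))
      + 2 * exp (- \<kappa> * m * N) * partition_function (model_of N g)
      + 2 ^ (4 * m + N) * exp (- \<beta> * m)"
proof -
  let ?P = "{1, 2} \<times> {1, 2} \<times> configs N" and ?conf = "\<lambda>(c, a, \<tau>). locked_config m N c a \<tau>"
  let ?sum = "\<lambda>c a. \<Sum>\<tau>\<in>configs N. weight gad (locked_config m N c a \<tau>)"
  have "partition_function gad \<le> (\<Sum>x\<in>?P. weight gad (?conf x)) + 2 ^ nverts gad * exp (- \<beta> * m)"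
  proof (rule partition_function_le)
    show "weight gad \<sigma> \<le> exp (- \<beta> * m)" if "\<sigma> \<in> configs (nverts gad)" "\<sigma> \<notin> ?conf ` ?P" for \<sigma>
      using that unfolding nverts_block_models by (rule weight_gadget_not_locked_le)
  qed (simp_all add: finite_configs)
  also have "(\<Sum>x\<in>?P. weight gad (?conf x)) = (\<Sum>c\<in>{1, 2}. \<Sum>a\<in>{1, 2}. ?sum c a)"
    by (simp only: sum.cartesian_product' prod.case)
  also have "\<dots> = ?sum 1 1 + ?sum 2 2 + (?sum 1 2 + ?sum 2 1)"
    by simp
  also have "?sum 1 2 + ?sum 2 1 = 2 * exp (- \<kappa> * m * N) * partition_function (model_of N g)"
    by (subst (1 2) sum_weight_gadget_opposed) auto
  finally show ?thesis
    using sum_weight_gadget_aligned_le[of 1] sum_weight_gadget_aligned_le[of 2] by simp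
qed

end

end

section \<open>Testing with samples from the frozen configurations\<close>

definition coin_source :: "val \<Rightarrow> val \<Rightarrow> nat \<Rightarrow> source" where
  "coin_source v w d = map_spmf (\<lambda>b. (if b then v else w, d)) coin_spmf"

lemma coin_source_dominated:
  assumes "\<sigma> \<noteq> \<sigma>'" and half: "1 \<le> 2 * \<rho> * pmf (gibbs M) \<sigma>" "1 \<le> 2 * \<rho> * pmf (gibbs M) \<sigma>'" and "\<rho> \<ge> 0"
  shows "dominated_source (ennreal \<rho>) d
    (coin_source (enc_config (nverts M) \<sigma>) (enc_config (nverts M) \<sigma>') d) (sample_access M)"
  unfolding dominated_source_def
proof (intro conjI allI)
  let ?e = "enc_config (nverts M)"
  fix g :: "val \<times> nat \<Rightarrow> ennreal"
  let ?f = "\<lambda>\<tau>. g (?e \<tau>, d)"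
  have half_le: "inverse 2 * ?f \<tau> \<le> ennreal \<rho> * (?f \<tau> * pmf (gibbs M) \<tau>)" if "\<tau> \<in> {\<sigma>, \<sigma>'}" for \<tau>
  proof -
    have "ennreal (1 / 2) \<le> ennreal (\<rho> * pmf (gibbs M) \<tau>)"
      using that half by (intro ennreal_leI) auto
    then have "inverse 2 * ?f \<tau> \<le> ennreal \<rho> * ennreal (pmf (gibbs M) \<tau>) * ?f \<tau>"
      using \<open>\<rho> \<ge> 0\<close> by (intro mult_right_mono) (simp_all add: ennreal_mult)
    then show ?thesis by (simp only: ac_simps)
  qed
  have "(\<integral>\<^sup>+ x. g x \<partial>measure_spmf (coin_source (?e \<sigma>) (?e \<sigma>') d)) = inverse 2 * ?f \<sigma> + inverse 2 * ?f \<sigma>'"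
    by (simp add: coin_source_def nn_integral_spmf_of_set UNIV_bool divide_ennreal_def distrib_left ac_simps)
  also have "\<dots> \<le> ennreal \<rho> * (?f \<sigma> * pmf (gibbs M) \<sigma>) + ennreal \<rho> * (?f \<sigma>' * pmf (gibbs M) \<sigma>')"
    by (intro add_mono half_le) simp_all
  also have "\<dots> = ennreal \<rho> * (\<Sum>\<tau>\<in>{\<sigma>, \<sigma>'}. ?f \<tau> * pmf (gibbs M) \<tau>)"
    using \<open>\<sigma> \<noteq> \<sigma>'\<close> by (simp add: distrib_left)
  also have "(\<Sum>\<tau>\<in>{\<sigma>, \<sigma>'}. ?f \<tau> * pmf (gibbs M) \<tau>)
      = (\<integral>\<^sup>+ \<tau>. ?f \<tau> * indicator {\<sigma>, \<sigma>'} \<tau> \<partial>measure_pmf (gibbs M))"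
    by (subst nn_integral_measure_pmf_support[of "{\<sigma>, \<sigma>'}"]) (auto intro!: sum.cong)
  also have "\<dots> \<le> (\<integral>\<^sup>+ \<tau>. ?f \<tau> \<partial>measure_pmf (gibbs M))"
    by (intro nn_integral_mono) (auto split: split_indicator)
  also have "\<dots> = (\<integral>\<^sup>+ (v, t). g (v, t + d) \<partial>measure_spmf (sample_access M))"
    by (simp add: sample_access_def)
  finally show "(\<integral>\<^sup>+ x. g x \<partial>measure_spmf (coin_source (?e \<sigma>) (?e \<sigma>') d))
      \<le> ennreal \<rho> * (\<integral>\<^sup>+ (v, t). g (v, t + d) \<partial>measure_spmf (sample_access M))"
    by (simp add: mult_left_mono)
qed (simp add: coin_source_def)

lemma measure_output_Compl:
  fixes p :: "(val \<times> nat \<times> nat) spmf"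
  assumes "lossless_spmf p"
  shows "measure (measure_spmf p) {(v, t, k). v \<in> - {a}} = 1 - measure (measure_spmf p) {(v, t, k). v = a}"
proof -
  have "{(v, t, k). v \<in> - {a}} = space (measure_spmf p) - {(v :: val, t :: nat, k :: nat). v = a}"
    by (auto simp: space_measure_spmf)
  then show ?thesis
    using assms measure_spmf.finite_measure_compl[of "{(v, t, k). v = a}" p]
    by (simp add: lossless_spmf_def weight_spmf_def)
qed

lemma tester_on_dominated_source:
  assumes tester: "identity_tester \<M> \<epsilon> ps pt A" and known: "M \<in> \<M> n" "rational_model M" and hidden: "M' \<in> \<M> n"
    and src: "dominated_source (ennreal \<rho>) d src (sample_access M')"
    and factor: "\<rho> \<ge> 1" "\<rho> ^ poly ps n \<le> 3 / 2"
  defines "res \<equiv> run src no_subroutine A (enc_model M)"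
  shows "lossless_spmf res"
    and "(v, t, k) \<in> set_spmf res \<Longrightarrow> t \<le> poly pt (vsize (enc_model M)) + d * poly ps n"
    and "gibbs M = gibbs M' \<Longrightarrow> prob_accept res \<ge> 5 / 8"
    and "tv_dist (gibbs M) (gibbs M') \<ge> 1 - \<epsilon> \<Longrightarrow> prob_reject res \<ge> 5 / 8"
proof -
  let ?res = "run (sample_access M') no_subroutine A (enc_model M)"
  have lossless: "lossless_spmf ?res"
    and bounds: "\<forall>(v, t, k)\<in>set_spmf ?res. t \<le> poly pt (vsize (enc_model M)) \<and> k \<le> poly ps n"
    and accept: "gibbs M = gibbs M' \<Longrightarrow> prob_accept ?res \<ge> 3 / 4"
    and reject: "tv_dist (gibbs M) (gibbs M') \<ge> 1 - \<epsilon> \<Longrightarrow> prob_reject ?res \<ge> 3 / 4"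
    using tester known hidden unfolding identity_tester_def Let_def by blast+
  note dominated = factor(1) src lossless bounds
  show lossless': "lossless_spmf res"
    unfolding res_def by (rule run_dominated_lossless[OF dominated])
  show "(v, t, k) \<in> set_spmf res \<Longrightarrow> t \<le> poly pt (vsize (enc_model M)) + d * poly ps n"
    unfolding res_def by (rule run_dominated_time[OF dominated])
  have transfer: "measure (measure_spmf res) {(v, t, k). v = a} \<ge> 5 / 8"
    if likely: "measure (measure_spmf ?res) {(v, t, k). v = a} \<ge> 3 / 4" for a
  proof -
    have "1 - measure (measure_spmf res) {(v, t, k). v = a}
        \<le> \<rho> ^ poly ps n * (1 - measure (measure_spmf ?res) {(v, t, k). v = a})"
      using run_dominated_measure[OF dominated, of "- {a}", folded res_def]
      unfolding measure_output_Compl[OF lossless] measure_output_Compl[OF lossless'] .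
    also have "\<dots> \<le> 3 / 2 * (1 / 4)"
      using likely factor by (intro mult_mono) (auto simp: measure_spmf.subprob_measure_le_1)
    finally show ?thesis by simp
  qed
  show "gibbs M = gibbs M' \<Longrightarrow> prob_accept res \<ge> 5 / 8"
    using accept unfolding prob_accept_def by (intro transfer)
  show "tv_dist (gibbs M) (gibbs M') \<ge> 1 - \<epsilon> \<Longrightarrow> prob_reject res \<ge> 5 / 8"
    using reject unfolding prob_reject_def by (intro transfer)
qed

lemma tv_dist_ge: "\<bar>measure_pmf.prob p A - measure_pmf.prob q A\<bar> \<le> tv_dist p q"
  unfolding tv_dist_def
proof (rule cSUP_upper)
  show "bdd_above (range (\<lambda>A. \<bar>measure_pmf.prob p A - measure_pmf.prob q A\<bar>))"
  proof (rule bdd_aboveI2)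
    show "\<bar>measure_pmf.prob p A - measure_pmf.prob q A\<bar> \<le> 1" for A
      using measure_pmf.prob_le_1[of p A] measure_pmf.prob_le_1[of q A]
        measure_nonneg[of "measure_pmf p" A] measure_nonneg[of "measure_pmf q" A] by linarith
  qed
qed simp

lemma one_plus_power_le:
  fixes x :: real
  assumes "x \<ge> 0" "real K * x \<le> 3 / 10"
  shows "(1 + x) ^ K \<le> 3 / 2"
proof -
  have "(1 + x) ^ K \<le> exp x ^ K"
    using assms(1) exp_ge_add_one_self[of x] by (intro power_mono) auto
  also have "\<dots> = exp (real K * x)"
    by (simp add: exp_of_nat_mult)
  also have "\<dots> \<le> exp (3 / 10)"
    using assms(2) by simp
  also have "\<dots> \<le> 1 + 3 / 10 + (3 / 10)\<^sup>2"
    by (rule exp_bound) auto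
  also have "\<dots> \<le> 3 / 2"
    by (simp add: power2_eq_square)
  finally show ?thesis .
qed

lemma two_power_le_exp: "2 ^ n \<le> exp (real n)"
proof -
  have "(2::real) ^ n \<le> exp 1 ^ n"
    using exp_ge_add_one_self[of 1] by (intro power_mono) auto
  then show ?thesis by (simp add: exp_of_nat_mult[symmetric])
qed

lemma exp_5_le: "exp (5::real) \<le> 243"
proof -
  have "exp (5::real) = exp 1 ^ 5"
    by (simp add: exp_of_nat_mult[symmetric])
  also have "\<dots> \<le> 3 ^ 5"
    using exp_le by (intro power_mono) auto
  finally show ?thesis by simp
qed

lemma measure_pmf_pair: "x \<noteq> y \<Longrightarrow> measure_pmf.prob p {x, y} = pmf p x + pmf p y"
  by (simp add: measure_measure_pmf_finite)

lemma pmf_gibbs_in_configs: "\<sigma> \<in> configs (nverts M) \<Longrightarrow> pmf (gibbs M) \<sigma> = weight M \<sigma> / partition_function M"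
  by (simp add: pmf_gibbs)

definition block_size :: "nat \<Rightarrow> nat \<Rightarrow> nat" where
  "block_size L N = L * (N + 1)\<^sup>2"

definition gadget_order :: "nat \<Rightarrow> nat \<Rightarrow> nat" where
  "gadget_order L N = 4 * block_size L N + N"

definition balance_bound :: "nat \<Rightarrow> nat \<Rightarrow> nat" where
  "balance_bound L N = L * (N * (N + 1)) + 3 * N"

text \<open>The total coupling of a vertex of the given graph to the block \<open>S\<close>.\<close>

definition pinning :: "nat \<Rightarrow> nat \<Rightarrow> real" where
  "pinning L N = real L * (real N + 1)"

locale block_parameters =
  fixes L N :: nat
  assumes L_ge_4: "L \<ge> 4"
begin

abbreviation (input) m :: nat where "m \<equiv> block_size L N"
abbreviation (input) n :: nat where "n \<equiv> gadget_order L N"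
abbreviation (input) y :: real where "y \<equiv> pinning L N"

lemma y_ge: "y \<ge> 4 * real N" "y \<ge> 4"
proof -
  have "4 * (real N + 1) \<le> y"
    unfolding pinning_def using L_ge_4 by (intro mult_right_mono) auto
  then show "y \<ge> 4 * real N" "y \<ge> 4" by (simp_all add: algebra_simps)
qed

lemma m_eq: "real m = y * real N + y"
  by (simp add: block_size_def pinning_def power2_eq_square algebra_simps)

lemma y_le_m: "y \<le> real m"
  using y_ge by (simp add: m_eq)

lemma m_pos: "m > 0"
  using y_ge(2) y_le_m by (cases m) auto

lemma m_sq_ge_1: "(real m)\<^sup>2 \<ge> 1"
  using m_pos by (simp add: Suc_le_eq)

lemma unlocked_weight_le: "2 ^ (4 * m + N) * exp (- 10 * real m) \<le> exp (real N - 6 * real m)"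
proof -
  have "2 ^ (4 * m + N) * exp (- 10 * real m) \<le> exp (real (4 * m + N)) * exp (- 10 * real m)"
    by (intro mult_right_mono two_power_le_exp) auto
  then show ?thesis by (simp flip: exp_add)
qed

abbreviation (input) bip :: ising where "bip \<equiv> bipartite m N 10"
abbreviation (input) frozen :: "nat \<Rightarrow> nat \<Rightarrow> nat" where "frozen c \<equiv> frozen_config m N c"

lemma frozen_in_configs: "c \<in> {1, 2} \<Longrightarrow> frozen c \<in> configs (4 * m + N)"
  by (rule frozen_config_in_configs)

lemma frozen_distinct: "frozen 1 \<noteq> frozen 2"
  by (rule frozen_configs_distinct[OF m_pos])

definition frozen_source :: "nat \<Rightarrow> source" where
  "frozen_source d = coin_source (enc_config n (frozen 1)) (enc_config n (frozen 2)) d"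

lemma frozen_source_dominated:
  assumes "nverts M = n" "\<rho> \<ge> 0" "\<And>c. c \<in> {1, 2} \<Longrightarrow> 1 \<le> 2 * \<rho> * pmf (gibbs M) (frozen c)"
  shows "dominated_source (ennreal \<rho>) d (frozen_source d) (sample_access M)"
  unfolding frozen_source_def assms(1)[symmetric] using assms(2,3) by (intro coin_source_dominated frozen_distinct) auto

lemma bipartite_in_ising_minus: "bip \<in> ising_minus n n 10 0"
  unfolding bipartite_def gadget_order_def
  by (intro model_of_in_ising_minus interaction_block_coupling interaction_bipartite_table interaction_zero)
    (simp_all add: block_coupling_def bipartite_table_def)

lemma partition_function_bipartite_le_2: "partition_function bip \<le> 2 * (1 + exp (- y))"
proof -
  have "partition_function bip \<le> 2 + 2 ^ (4 * m + N) * exp (- 10 * real m)"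
    using m_pos by (intro partition_function_bipartite_le) simp_all
  also have "\<dots> \<le> 2 + exp (- y)"
    using y_ge y_le_m by (intro add_left_mono order_trans[OF unlocked_weight_le]) simp
  also have "\<dots> \<le> 2 * (1 + exp (- y))"
    unfolding distrib_left by simp
  finally show ?thesis .
qed

lemma pmf_bipartite_frozen: "c \<in> {1, 2} \<Longrightarrow> pmf (gibbs bip) (frozen c) = 1 / partition_function bip"
  by (subst pmf_gibbs_in_configs) (simp_all only: nverts_block_models frozen_in_configs weight_frozen_bipartite)

lemma pmf_bipartite_frozen_ge: "c \<in> {1, 2} \<Longrightarrow> 1 \<le> 2 * (1 + exp (- y)) * pmf (gibbs bip) (frozen c)"
  using partition_function_bipartite_le_2 partition_function_pos[of bip]
  by (simp only: pmf_bipartite_frozen) (simp add: field_simps)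

lemma frozen_source_dominated_bipartite:
  "dominated_source (ennreal (1 + exp (- y))) d (frozen_source d) (sample_access bip)"
  by (intro frozen_source_dominated pmf_bipartite_frozen_ge) (simp_all add: gadget_order_def)

lemma prob_bipartite_frozen_ge: "measure_pmf.prob (gibbs bip) {frozen 1, frozen 2} \<ge> 1 - exp (- y)"
proof -
  let ?Z = "partition_function bip"
  have "(1 - exp (- y)) * ?Z \<le> (1 - exp (- y)) * (2 * (1 + exp (- y)))"
    using partition_function_bipartite_le_2 y_ge(2) by (intro mult_left_mono) auto
  also have "\<dots> \<le> 2"
    by (simp add: algebra_simps)
  finally have "1 - exp (- y) \<le> 2 / ?Z"
    using partition_function_pos[of bip] by (simp only: pos_le_divide_eq)
  then show ?thesis
    unfolding measure_pmf_pair[OF frozen_distinct] by (simp add: pmf_bipartite_frozen)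
qed

end

locale cubic_instance =
  fixes N :: nat and G :: ising
  assumes G_in_family: "G \<in> ising_minus_hat N 3 (-0.6)"
begin

definition g :: "nat \<Rightarrow> nat \<Rightarrow> real" where
  "g = pair_coupling G"

definition arcs :: nat where
  "arcs = (\<Sum>u<N. \<Sum>v<N. of_bool ({u, v} \<in> edges G))"

abbreviation (input) Z :: real where "Z \<equiv> partition_function G"

lemma G_simps: "simple_graph G" "nverts G = N" "\<And>e. e \<in> edges G \<Longrightarrow> coupling G e = - 6 / 10"
    "\<And>v. v < N \<Longrightarrow> card {e \<in> edges G. v \<in> e} \<le> 3"
    "\<forall>v<nverts G. \<forall>i\<in>{1, 2}. ext_field G v i = 0"
  using G_in_family by (auto simp: ising_minus_hat_def max_degree_le_def)

lemma interaction_g: "interaction g"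
  unfolding g_def by (rule interaction_pair_coupling[OF G_simps(1)])

lemma g_eq: "g a b = - 6 / 10 * of_bool ({a, b} \<in> edges G)"
  by (simp add: g_def pair_coupling_def G_simps)

lemma g_nonpos: "g a b \<le> 0"
  by (simp add: g_eq)

lemma partition_function_g: "partition_function (model_of N g) = Z"
  using partition_function_model_of_pair_coupling[OF G_simps(1,5)] by (simp add: g_def G_simps(2))

lemma total_coupling_g: "total_coupling N g = - 3 / 10 * real arcs"
  unfolding total_coupling_def g_eq arcs_def of_nat_sum of_nat_of_bool sum_distrib_left[symmetric] by simp

lemma arcs_le: "arcs \<le> 3 * N"
proof -
  have "(\<Sum>v<N. of_bool ({u, v} \<in> edges G)) \<le> (3::nat)" if "u < N" for u
  proof -
    have "(\<Sum>v<N. of_bool ({u, v} \<in> edges G)) = card {v \<in> {..<N}. {u, v} \<in> edges G}"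
      by (simp add: Int_def)
    also have "\<dots> \<le> card {e \<in> edges G. u \<in> e}"
      by (rule card_inj_on_le[of "\<lambda>v. {u, v}"]) (auto simp: inj_on_def doubleton_eq_iff finite_edges[OF G_simps(1)])
    also have "\<dots> \<le> 3" using G_simps(4)[OF that] .
    finally show ?thesis .
  qed
  then have "arcs \<le> (\<Sum>u<N. 3)"
    unfolding arcs_def by (intro sum_mono) auto
  then show ?thesis by simp
qed

lemma arcs_le_real: "3 / 10 * real arcs \<le> real N"
  using arcs_le by linarith

lemma Z_le: "Z \<le> 2 ^ N"
  using partition_function_model_of_bounds(2)[OF interaction_g g_nonpos, of N] by (simp only: partition_function_g)

lemma Z_ge: "Z \<ge> exp (- real N)"
proof -
  have "exp (- real N) \<le> exp (total_coupling N g)"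
    using arcs_le_real by (simp add: total_coupling_g)
  also have "\<dots> \<le> Z"
    using partition_function_model_of_bounds(1)[OF interaction_g g_nonpos, of N] by (simp only: partition_function_g)
  finally show ?thesis .
qed

end

text \<open>The weight of the frozen configurations is tuned to be about \<open>exp (- y N) Zhat\<close>, the weight that the
  free phase would have for \<open>Z = Zhat\<close>. The term \<open>1 / m\<^sup>2\<close> makes \<open>\<omega>\<close> a fraction in lowest terms.\<close>

locale tuned_gadget = block_parameters L N + cubic_instance N G for L N G +
  fixes u :: nat and Zhat :: real
  assumes u_le_bound: "u \<le> balance_bound L N" and Zhat_pos: "Zhat > 0"
    and tuned: "\<bar>y * real N - real u - 1 / (real m)\<^sup>2 - 3 / 10 * real arcs - ln Zhat\<bar> \<le> 5"
begin

lemma u_le: "real u \<le> y * real N + 3 * real N"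
proof -
  have "real u \<le> real (balance_bound L N)"
    using u_le_bound by (simp only: of_nat_le_iff)
  then show ?thesis
    by (simp add: balance_bound_def pinning_def algebra_simps)
qed

definition \<omega> :: real where "\<omega> = ((real m)\<^sup>2 * real u + 1) / ((real m)\<^sup>2 * (real m)\<^sup>2)"
definition \<kappa> :: real where "\<kappa> = 1 / (real N + 1)"
definition M :: ising where "M = gadget m N g 10 \<omega> \<kappa>"

lemma nverts_M [simp]: "nverts M = 4 * m + N"
  by (simp add: M_def)

lemma \<omega>_pos: "\<omega> > 0"
  unfolding \<omega>_def using m_pos by (intro divide_pos_pos add_nonneg_pos mult_pos_pos) auto

lemma \<kappa>_pos: "\<kappa> > 0" and \<kappa>_le: "\<kappa> \<le> 1"
  by (simp_all add: \<kappa>_def)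

lemma \<omega>_m: "\<omega> * (real m)\<^sup>2 = real u + 1 / (real m)\<^sup>2"
  using m_pos by (simp add: \<omega>_def field_simps)

lemma \<kappa>_m: "\<kappa> * m = y"
  by (simp add: \<kappa>_def m_eq field_simps)

lemma \<omega>_le: "\<omega> \<le> 10"
proof -
  have "real u \<le> real m * 1"
    using u_le y_ge m_eq by linarith
  also have "\<dots> \<le> (real m)\<^sup>2"
    unfolding power2_eq_square using m_pos by (intro mult_left_mono) auto
  finally have "\<omega> * (real m)\<^sup>2 \<le> (real m)\<^sup>2 + 1 / (real m)\<^sup>2"
    by (simp add: \<omega>_m)
  also have "\<dots> \<le> 2 * (real m)\<^sup>2"
    using m_sq_ge_1 by (simp add: divide_le_eq order_trans[OF _ m_sq_ge_1])
  finally show ?thesis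
    using m_pos by simp
qed

lemma M_in_ising_minus: "M \<in> ising_minus n n 10 0" and rational_M: "rational_model M"
proof -
  let ?W = "block_coupling m g (gadget_table 10 \<omega> \<kappa>)"
  have W_cases: "?W a b \<in> {-10, -\<omega>, -\<kappa>, - 6 / 10, 0}" for a b
    by (auto simp: block_coupling_def gadget_table_def g_eq)
  have interaction_W: "interaction ?W"
    by (intro interaction_block_coupling interaction_g interaction_gadget_table)
  have "?W a b \<le> 0" "\<bar>?W a b\<bar> \<le> 10" for a b
    using W_cases[of a b] \<kappa>_pos \<kappa>_le \<omega>_pos \<omega>_le by auto
  then show "M \<in> ising_minus n n 10 0"
    unfolding M_def gadget_def gadget_order_def by (intro model_of_in_ising_minus interaction_W)
  have "\<omega> \<in> \<rat>" "\<kappa> \<in> \<rat>" by (simp_all add: \<omega>_def \<kappa>_def)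
  then have "?W a b \<in> \<rat>" for a b
    using W_cases[of a b] by auto
  then show "rational_model M"
    unfolding M_def gadget_def by (intro rational_model_of interaction_W)
qed

definition frozen_weight :: real where
  "frozen_weight = exp (- (real u + 1 / (real m)\<^sup>2) - 3 / 10 * real arcs)"

lemma frozen_weight_pos: "frozen_weight > 0"
  by (simp add: frozen_weight_def)

lemma frozen_weight_eq: "frozen_weight = exp (- \<omega> * (real m)\<^sup>2) * exp (total_coupling N g)"
  using \<omega>_m by (simp add: frozen_weight_def total_coupling_g flip: exp_add)

lemma pmf_frozen: "c \<in> {1, 2} \<Longrightarrow> pmf (gibbs M) (frozen c) = frozen_weight / partition_function M"
  using frozen_in_configs weight_gadget_frozen[OF interaction_g]
  by (subst pmf_gibbs_in_configs) (simp_all only: M_def nverts_block_models frozen_weight_eq)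

lemma free_weight_ratio:
  "exp (- y * N) / frozen_weight \<le> exp 5 / Zhat"
  "frozen_weight / exp (- y * N) \<le> exp 5 * Zhat"
proof -
  let ?E = "- (real u + 1 / (real m)\<^sup>2) - 3 / 10 * real arcs"
  have "exp (- y * N - ?E) \<le> exp (5 - ln Zhat)" "exp (?E - (- y * N)) \<le> exp (5 + ln Zhat)"
    using tuned unfolding exp_le_cancel_iff by linarith+
  then show "exp (- y * N) / frozen_weight \<le> exp 5 / Zhat" "frozen_weight / exp (- y * N) \<le> exp 5 * Zhat"
    unfolding frozen_weight_def exp_diff exp_add exp_ln[OF Zhat_pos] .
qed

lemma pinned_weight_le:
  "exp (- \<omega> * (real m)\<^sup>2) * (2 ^ N * exp (- 2 * \<kappa> * m)) \<le> frozen_weight * exp (- y)"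
proof -
  have "2 ^ N * exp (- 2 * \<kappa> * m) \<le> exp (real N) * exp (- 2 * \<kappa> * m)"
    by (intro mult_right_mono two_power_le_exp) auto
  also have "\<dots> = exp (real N - 2 * y)"
    using \<kappa>_m by (simp flip: exp_add)
  also have "\<dots> \<le> exp (total_coupling N g) * exp (- y)"
    using y_ge arcs_le_real by (simp add: total_coupling_g flip: exp_add)
  finally show ?thesis
    by (simp add: frozen_weight_eq mult.assoc)
qed

lemma unlocked_weight_le_frozen: "2 ^ (4 * m + N) * exp (- 10 * real m) \<le> frozen_weight * exp (- y)"
proof -
  have "1 / (real m)\<^sup>2 \<le> 1"
    using m_pos by (simp add: divide_le_eq_1 Suc_le_eq)
  then have "real N - 6 * real m \<le> - (real u + 1 / (real m)\<^sup>2) - 3 / 10 * real arcs - y"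
    using u_le arcs_le_real y_ge y_le_m m_eq by linarith
  then show ?thesis
    unfolding frozen_weight_def exp_add[symmetric] by (intro order_trans[OF unlocked_weight_le]) simp
qed

lemma free_weight_le:
  assumes "Z \<le> Zhat / r" "r > 0"
  shows "exp (- y * N) * Z \<le> frozen_weight * (exp 5 / r)"
proof -
  have "exp (- y * N) * Z = frozen_weight * (exp (- y * N) / frozen_weight * Z)"
    using frozen_weight_pos by simp
  also have "\<dots> \<le> frozen_weight * (exp 5 / Zhat * (Zhat / r))"
    using frozen_weight_pos free_weight_ratio(1) assms Zhat_pos partition_function_pos[of G]
    by (intro mult_left_mono mult_mono) auto
  finally show ?thesis using Zhat_pos by simp
qed

lemma partition_function_M_le:
  assumes "Z \<le> Zhat / r" "r > 0"
  shows "partition_function M \<le> 2 * (1 + (2 * exp (- y) + exp 5 / r)) * frozen_weight"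
proof -
  have "partition_function M \<le> 2 * exp (- \<omega> * (real m)\<^sup>2) * (exp (total_coupling N g) + 2 ^ N * exp (- 2 * \<kappa> * m))
      + 2 * exp (- \<kappa> * m * N) * Z + 2 ^ (4 * m + N) * exp (- 10 * real m)"
    unfolding M_def partition_function_g[symmetric]
    using \<omega>_pos \<kappa>_pos by (intro partition_function_gadget_le interaction_g g_nonpos m_pos) simp_all
  also have "\<dots> = 2 * frozen_weight + 2 * (exp (- \<omega> * (real m)\<^sup>2) * (2 ^ N * exp (- 2 * \<kappa> * m)))
      + 2 * (exp (- y * N) * Z) + 2 ^ (4 * m + N) * exp (- 10 * real m)"
    using \<kappa>_m by (simp add: frozen_weight_eq distrib_left)
  also have "\<dots> \<le> 2 * frozen_weight + 2 * (frozen_weight * exp (- y)) + 2 * (frozen_weight * (exp 5 / r))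
      + 2 * (frozen_weight * exp (- y))"
    using pinned_weight_le free_weight_le[OF assms] unlocked_weight_le_frozen
      mult_pos_pos[OF frozen_weight_pos exp_gt_zero[of "- y"]] by linarith
  finally show ?thesis
    by (simp add: algebra_simps)
qed

lemma pmf_frozen_ge:
  assumes "Z \<le> Zhat / r" "r > 0" "c \<in> {1, 2}"
  shows "1 \<le> 2 * (1 + (2 * exp (- y) + exp 5 / r)) * pmf (gibbs M) (frozen c)"
  using partition_function_M_le[OF assms(1,2)] partition_function_pos[of M]
  by (simp only: pmf_frozen[OF assms(3)]) (simp add: field_simps)

lemma prob_frozen_le:
  assumes "Z \<ge> r * Zhat" "r > 0"
  shows "measure_pmf.prob (gibbs M) {frozen 1, frozen 2} \<le> 2 * (exp 5 / r)"
proof -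
  let ?Z = "partition_function M"
  have "exp (- y * N) * (r * Zhat) \<le> exp (- y * N) * Z"
    using assms by simp
  also have "\<dots> \<le> ?Z"
    using partition_function_gadget_ge[OF interaction_g, of \<kappa> m N 10 \<omega>] \<kappa>_m
    by (simp add: M_def partition_function_g mult.assoc)
  finally have free: "exp (- y * N) * (r * Zhat) \<le> ?Z" .
  have "frozen_weight * r = frozen_weight / exp (- y * N) * (exp (- y * N) * r)" by simp
  also have "\<dots> \<le> exp 5 * Zhat * (exp (- y * N) * r)"
    using free_weight_ratio(2) assms(2) by (intro mult_right_mono) auto
  also have "\<dots> \<le> exp 5 * ?Z"
    using free by (simp add: ac_simps)
  finally have "frozen_weight / ?Z \<le> exp 5 / r"
    using partition_function_pos[of M] assms(2) by (simp add: field_simps)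
  then show ?thesis
    unfolding measure_pmf_pair[OF frozen_distinct] by (simp add: pmf_frozen)
qed

context
  fixes \<epsilon> r :: real and ps pt :: "nat poly" and A :: com and d :: nat
  assumes tester: "identity_tester (\<lambda>n. ising_minus n n 10 0) \<epsilon> ps pt A" and \<epsilon>_pos: "\<epsilon> > 0"
    and y_large: "real (poly ps n) * exp (- y) \<le> 1 / 10" "exp (- y) \<le> \<epsilon> / 2"
    and r_large: "2430 * real (poly ps n) \<le> r" "972 / \<epsilon> \<le> r"
begin

private lemma r_pos: "r > 0"
  using r_large(2) \<epsilon>_pos by (simp add: less_le_trans[of 0 "972 / \<epsilon>"])

private lemmas tester_vs_bipartite =
  tester_on_dominated_source[OF tester M_in_ising_minus rational_M bipartite_in_ising_minus frozen_source_dominated_bipartite]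

private lemma one_plus_exp_power_le: "(1 + exp (- y)) ^ poly ps n \<le> 3 / 2"
  using y_large(1) by (intro one_plus_power_le) auto

lemma tester_lossless:
  "lossless_spmf (run (frozen_source d) no_subroutine A (enc_model M))"
  using tester_vs_bipartite(1) one_plus_exp_power_le by simp

lemma tester_time:
  "(v, t, k) \<in> set_spmf (run (frozen_source d) no_subroutine A (enc_model M))
    \<Longrightarrow> t \<le> poly pt (vsize (enc_model M)) + d * poly ps n"
  using tester_vs_bipartite(2)[of v t k] one_plus_exp_power_le by simp

lemma tester_accepts:
  assumes "Z \<le> Zhat / r"
  shows "prob_accept (run (frozen_source d) no_subroutine A (enc_model M))
    \<ge> 5 / 8"
proof -
  have "real (poly ps n) * (exp 5 / r) \<le> real (poly ps n) * (243 / r)"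
    using exp_5_le r_pos by (intro mult_left_mono divide_right_mono) auto
  also have "\<dots> \<le> 1 / 10"
    using r_large(1) r_pos by (simp add: field_simps)
  finally have "real (poly ps n) * (2 * exp (- y) + exp 5 / r) \<le> 3 / 10"
    using y_large(1) by (simp add: distrib_left)
  then have power: "(1 + (2 * exp (- y) + exp 5 / r)) ^ poly ps n \<le> 3 / 2"
    using r_pos by (intro one_plus_power_le) auto
  have dominated: "dominated_source (ennreal (1 + (2 * exp (- y) + exp 5 / r))) d (frozen_source d) (sample_access M)"
    using r_pos by (intro frozen_source_dominated pmf_frozen_ge assms) (auto simp: gadget_order_def)
  show ?thesis
    using r_pos
    by (intro tester_on_dominated_source(3)[OF tester M_in_ising_minus rational_M M_in_ising_minus dominated _ power refl]) simp
qed

lemma tester_rejects: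
  assumes "Z \<ge> r * Zhat"
  shows "prob_reject (run (frozen_source d) no_subroutine A (enc_model M))
    \<ge> 5 / 8"
proof -
  let ?S = "{frozen 1, frozen 2}"
  have "2 * (exp 5 / r) \<le> 2 * (243 / r)"
    using exp_5_le r_pos by (intro mult_left_mono divide_right_mono) auto
  also have "\<dots> \<le> \<epsilon> / 2"
    using r_large(2) r_pos \<epsilon>_pos by (simp add: field_simps)
  finally have "1 - \<epsilon> \<le> \<bar>measure_pmf.prob (gibbs M) ?S - measure_pmf.prob (gibbs bip) ?S\<bar>"
    using prob_frozen_le[OF assms r_pos] prob_bipartite_frozen_ge y_large(2) by linarith
  also have "\<dots> \<le> tv_dist (gibbs M) (gibbs bip)" by (rule tv_dist_ge)
  finally show ?thesis
    using tester_vs_bipartite(4) one_plus_exp_power_le by simp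
qed

end

end

section \<open>Deterministic programs\<close>

definition runs :: "com \<Rightarrow> store \<Rightarrow> store \<Rightarrow> nat \<Rightarrow> bool" where
  "runs c s s' T \<longleftrightarrow> (\<exists>t\<le>T. \<forall>smp sub t\<^sub>0 k. exec smp sub c (s, t\<^sub>0, k) = return_spmf (s', t\<^sub>0 + t, k))"

lemma runsE:
  assumes "runs c s s' T"
  obtains t where "t \<le> T" "\<And>smp sub t\<^sub>0 k. exec smp sub c (s, t\<^sub>0, k) = return_spmf (s', t\<^sub>0 + t, k)"
  using assms unfolding runs_def by blast

lemma runs_mono: "runs c s s' T \<Longrightarrow> T \<le> T' \<Longrightarrow> runs c s s' T'"
  unfolding runs_def by (meson order_trans)

lemma runs_Skip: "runs Skip s s T"
  unfolding runs_def by (rule exI[of _ 0]) simp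

lemma runs_Assign:
  assumes "expr_val e s = v" "1 + expr_cost e s \<le> T"
  shows "runs (Assign x e) s (s(x := v)) T"
  unfolding runs_def using assms by (intro exI[of _ "1 + expr_cost e s"]) simp

lemma runs_Seq:
  assumes "runs c s s' T" "runs d s' s'' T'"
  shows "runs (Seq c d) s s'' (T + T')"
proof -
  obtain t where first: "t \<le> T" "\<And>smp sub t\<^sub>0 k. exec smp sub c (s, t\<^sub>0, k) = return_spmf (s', t\<^sub>0 + t, k)"
    by (rule runsE[OF assms(1)]) blast
  obtain t' where second: "t' \<le> T'" "\<And>smp sub t\<^sub>0 k. exec smp sub d (s', t\<^sub>0, k) = return_spmf (s'', t\<^sub>0 + t', k)"
    by (rule runsE[OF assms(2)]) blast
  show ?thesis
    unfolding runs_def using first second by (intro exI[of _ "t + t'"]) (simp add: add.assoc)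
qed

lemma runs_If:
  assumes "runs (if truthy (expr_val e s) then c else d) s s' T"
  shows "runs (If e c d) s s' (1 + expr_cost e s + T)"
proof -
  obtain t where branch: "t \<le> T"
    "\<And>smp sub t\<^sub>0 k. exec smp sub (if truthy (expr_val e s) then c else d) (s, t\<^sub>0, k) = return_spmf (s', t\<^sub>0 + t, k)"
    by (rule runsE[OF assms]) blast
  have "exec smp sub (If e c d) (s, t\<^sub>0, k) = return_spmf (s', t\<^sub>0 + (1 + expr_cost e s + t), k)" for smp sub t\<^sub>0 k
    using branch(2)[of smp sub "t\<^sub>0 + 1 + expr_cost e s" k] by (auto simp: add.assoc split: if_splits)
  then show ?thesis
    unfolding runs_def using branch(1) by (intro exI[of _ "1 + expr_cost e s + t"]) auto
qed

lemma exec_While_unfold: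
  "exec smp sub (While e c) (s, t, k) =
    (if truthy (expr_val e s) then bind_spmf (exec smp sub c (s, t + 1 + expr_cost e s, k)) (exec smp sub (While e c))
     else return_spmf (s, t + 1 + expr_cost e s, k))"
proof (cases "truthy (expr_val e s)")
  case True
  then show ?thesis
    unfolding exec.simps by (subst while_spmf.simps) (simp add: map_spmf_bind_spmf o_def)
next
  case False
  then show ?thesis
    unfolding exec.simps by (subst while_spmf.simps) simp
qed

lemma runs_While_stop: "\<not> truthy (expr_val e s) \<Longrightarrow> runs (While e c) s s (1 + expr_cost e s)"
  unfolding runs_def by (rule exI[of _ "1 + expr_cost e s"]) (simp add: exec_While_unfold del: exec.simps)

lemma runs_While_step:
  assumes "truthy (expr_val e s)" "runs c s s' T" "runs (While e c) s' s'' T'"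
  shows "runs (While e c) s s'' (1 + expr_cost e s + T + T')"
proof -
  obtain t where body: "t \<le> T" "\<And>smp sub t\<^sub>0 k. exec smp sub c (s, t\<^sub>0, k) = return_spmf (s', t\<^sub>0 + t, k)"
    by (rule runsE[OF assms(2)]) blast
  obtain t' where rest: "t' \<le> T'" "\<And>smp sub t\<^sub>0 k. exec smp sub (While e c) (s', t\<^sub>0, k) = return_spmf (s'', t\<^sub>0 + t', k)"
    by (rule runsE[OF assms(3)]) blast
  have "exec smp sub (While e c) (s, t\<^sub>0, k) = return_spmf (s'', t\<^sub>0 + (1 + expr_cost e s + t + t'), k)" for smp sub t\<^sub>0 k
    by (simp add: exec_While_unfold[of _ _ e c s] assms(1) body(2) rest(2) ac_simps del: exec.simps)
  then show ?thesis
    unfolding runs_def using body(1) rest(1) by (intro exI[of _ "1 + expr_cost e s + t + t'"]) auto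
qed

lemma exec_Seq_runs:
  assumes "runs c s s' T"
  obtains t where "t \<le> T" "\<And>smp sub t\<^sub>0 k d. exec smp sub (Seq c d) (s, t\<^sub>0, k) = exec smp sub d (s', t\<^sub>0 + t, k)"
proof -
  obtain t where "t \<le> T" "\<And>smp sub t\<^sub>0 k. exec smp sub c (s, t\<^sub>0, k) = return_spmf (s', t\<^sub>0 + t, k)"
    by (rule runsE[OF assms]) blast
  then show ?thesis by (intro that[of t]) auto
qed

lemma run_eq_return:
  assumes "runs c ((\<lambda>_. Atom 0)(0 := v)) s' T"
  obtains t where "t \<le> T" "\<And>smp sub. run smp sub c v = return_spmf (s' 0, t, 0)"
proof -
  obtain t where "t \<le> T" "\<And>smp sub t\<^sub>0 k. exec smp sub c ((\<lambda>_. Atom 0)(0 := v), t\<^sub>0, k) = return_spmf (s', t\<^sub>0 + t, k)"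
    by (rule runsE[OF assms]) blast
  then show ?thesis by (intro that[of t]) (auto simp: run_def)
qed

abbreviation num :: "nat \<Rightarrow> expr" where
  "num k \<equiv> Lit (Atom k)"

primrec Assigns :: "(nat \<times> expr) list \<Rightarrow> com" where
  "Assigns [] = Skip"
| "Assigns (a # as) = Seq (Assign (fst a) (snd a)) (Assigns as)"

primrec store_after :: "(nat \<times> expr) list \<Rightarrow> store \<Rightarrow> store" where
  "store_after [] s = s"
| "store_after (a # as) s = store_after as (s(fst a := expr_val (snd a) s))"

primrec cost_of :: "(nat \<times> expr) list \<Rightarrow> store \<Rightarrow> nat" where
  "cost_of [] s = 0"
| "cost_of (a # as) s = 1 + expr_cost (snd a) s + cost_of as (s(fst a := expr_val (snd a) s))"

lemma runs_Assigns:
  assumes "store_after as s = s'" "cost_of as s \<le> T"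
  shows "runs (Assigns as) s s' T"
proof -
  have "runs (Assigns as) s (store_after as s) (cost_of as s)"
  proof (induction as arbitrary: s)
    case (Cons a as)
    have "runs (Assign (fst a) (snd a)) s (s(fst a := expr_val (snd a) s)) (1 + expr_cost (snd a) s)"
      by (rule runs_Assign) simp_all
    from runs_Seq[OF this Cons] show ?case by (simp add: add.assoc fun_upd_def)
  qed (simp add: runs_Skip)
  then show ?thesis
    using assms by (auto elim: runs_mono)
qed

lemma floorlog_le: "floorlog 2 n \<le> n"
  by (simp add: floorlog_le_iff less_exp)

lemma floorlog_mult_le: "floorlog 2 (x * c) \<le> floorlog 2 x + c"
proof (cases "x = 0")
  case False
  have "x < 2 ^ floorlog 2 x" using False floorlog_bounds[of x 2] by simp
  then have "x * c < 2 ^ floorlog 2 x * 2 ^ c"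
    by (intro mult_strict_mono' less_exp) auto
  then show ?thesis
    by (simp add: floorlog_le_iff power_add)
qed (simp add: floorlog_def)

lemma floorlog_mult_power_le: "floorlog 2 (x * c ^ j) \<le> floorlog 2 x + j * c"
proof (induction j)
  case (Suc j)
  have "floorlog 2 (x * c ^ j * c) \<le> floorlog 2 (x * c ^ j) + c" by (rule floorlog_mult_le)
  with Suc show ?case by (simp add: ac_simps)
qed simp

subsection \<open>Counting loops\<close>

definition For :: "nat \<Rightarrow> expr \<Rightarrow> com \<Rightarrow> com" where
  "For i l c = Seq (Assign i l) (While (Reg i) (Seq c (Assign i (Arith Sub (Reg i) (num 1)))))"

definition for_cost :: "nat \<Rightarrow> nat \<Rightarrow> nat" where
  "for_cost k B = k * (B + k + 7) + 3"

lemma for_cost_mono: "k \<le> k' \<Longrightarrow> B \<le> B' \<Longrightarrow> for_cost k B \<le> for_cost k' B'"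
  unfolding for_cost_def by (intro add_le_mono mult_le_mono) simp_all

text \<open>The store after \<open>j\<close> iterations is \<open>f j\<close>, up to the loop counter \<open>i\<close>, which counts down from \<open>k\<close>.\<close>

lemma runs_For:
  assumes limit: "expr_val l s = Atom k" "expr_cost l s \<le> C"
    and start: "f 0 = s" and counter: "\<And>j. j \<le> k \<Longrightarrow> f j i = Atom 0"
    and body: "\<And>j. j < k \<Longrightarrow> runs c ((f j)(i := Atom (k - j))) ((f (Suc j))(i := Atom (k - j))) B"
  shows "runs (For i l c) s (f k) (C + for_cost k B)"
proof -
  let ?decr = "Assign i (Arith Sub (Reg i) (num 1))"
  let ?W = "While (Reg i) (Seq c ?decr)"
  have loop: "runs ?W ((f j)(i := Atom (k - j))) (f k) ((k - j) * (B + k + 7) + 2)" if "j \<le> k" for j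
    using that
  proof (induction rule: inc_induct)
    case base
    have "(f k)(i := Atom (k - k)) = f k"
      using counter[of k] by (auto simp: fun_upd_idem)
    then show ?case
      using runs_While_stop[of "Reg i" "f k"] counter[of k] by (simp add: truthy_def)
  next
    case (step j)
    let ?s = "(f j)(i := Atom (k - j))" and ?s' = "(f (Suc j))(i := Atom (k - j))"
    have "floorlog 2 (k - j) + floorlog 2 1 \<le> k + 1"
      using floorlog_le[of "k - j"] floorlog_le[of 1] by linarith
    then have "runs ?decr ?s' (?s'(i := Atom (k - j - 1))) (k + 5)"
      by (intro runs_Assign) simp_all
    then have "runs ?decr ?s' ((f (Suc j))(i := Atom (k - Suc j))) (k + 5)"
      by simp
    from runs_While_step[OF _ runs_Seq[OF body[OF \<open>j < k\<close>] this] step.IH]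
    have "runs ?W ?s (f k) (2 + (B + (k + 5)) + ((k - Suc j) * (B + k + 7) + 2))"
      using step.hyps by (simp add: truthy_def)
    moreover have "k - j = Suc (k - Suc j)"
      using step.hyps by linarith
    then have "2 + (B + (k + 5)) + ((k - Suc j) * (B + k + 7) + 2) = (k - j) * (B + k + 7) + 2"
      by simp
    ultimately show ?case by (simp only:)
  qed
  have init: "runs (Assign i l) s (s(i := Atom k)) (C + 1)"
    using limit by (intro runs_Assign) auto
  have "runs ?W (s(i := Atom k)) (f k) (k * (B + k + 7) + 2)"
    using loop[of 0] start by simp
  from runs_Seq[OF init this] show ?thesis
    unfolding For_def for_cost_def by (rule runs_mono) simp
qed

subsection \<open>Repeating list entries\<close>

lemma enc_list_simps [simp]: "enc_list [] = Atom 0" "enc_list (v # vs) = Cell v (enc_list vs)"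
  by (simp_all add: enc_list_def)

lemma left_val_drop: "j < length xs \<Longrightarrow> left_val (enc_list (drop j xs)) = xs ! j"
  by (simp add: Cons_nth_drop_Suc[symmetric])

lemma right_val_drop: "j < length xs \<Longrightarrow> right_val (enc_list (drop j xs)) = enc_list (drop (Suc j) xs)"
  by (simp add: Cons_nth_drop_Suc[symmetric])

definition Repeat :: "nat \<Rightarrow> nat \<Rightarrow> nat \<Rightarrow> nat \<Rightarrow> com" where
  "Repeat i l x y = For i (Reg l) (Assign y (MkCell (Reg x) (Reg y)))"

definition repeat_cost :: "nat \<Rightarrow> nat" where
  "repeat_cost k = 1 + for_cost k 4"

lemma runs_Repeat:
  assumes "s l = Atom k" "s i = Atom 0" "s y = enc_list ws" "i \<noteq> x" "i \<noteq> y" "x \<noteq> y"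
  shows "runs (Repeat i l x y) s (s(y := enc_list (replicate k (s x) @ ws))) (repeat_cost k)"
  unfolding Repeat_def repeat_cost_def
proof (rule runs_For)
  let ?f = "\<lambda>j. s(y := enc_list (replicate j (s x) @ ws))"
  show "runs (Assign y (MkCell (Reg x) (Reg y))) ((?f j)(i := Atom (k - j))) ((?f (Suc j))(i := Atom (k - j))) 4" for j
  proof -
    have "(?f (Suc j))(i := Atom (k - j)) = ((?f j)(i := Atom (k - j)))(y := enc_list (replicate (Suc j) (s x) @ ws))"
      using assms by (simp add: fun_upd_twist)
    moreover have "runs (Assign y (MkCell (Reg x) (Reg y))) ((?f j)(i := Atom (k - j))) \<dots> 4"
      by (rule runs_Assign) (use assms in auto)
    ultimately show ?thesis by simp
  qed
qed (use assms in \<open>auto simp: fun_upd_idem\<close>)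

definition blocks :: "nat \<Rightarrow> 'a list \<Rightarrow> 'a list \<Rightarrow> 'a list" where
  "blocks m vs ws = concat (map (replicate m) vs) @ ws"

lemma blocks_simps [simp]:
  "blocks m [] ws = ws"
  "blocks m (v # vs) ws = replicate m v @ blocks m vs ws"
  by (simp_all add: blocks_def)

lemma set_blocks_subset: "set (blocks m vs ws) \<subseteq> set vs \<union> set ws"
  by (auto simp: blocks_def)

lemma length_blocks: "length (blocks m vs ws) = length vs * m + length ws"
  by (induction vs) auto

primrec Prepend :: "nat \<Rightarrow> nat \<Rightarrow> nat list \<Rightarrow> nat \<Rightarrow> com" where
  "Prepend i l [] y = Skip"
| "Prepend i l (x # xs) y = Seq (Prepend i l xs y) (Repeat i l x y)"

lemma runs_Prepend:
  assumes "s l = Atom k" "s i = Atom 0" "s y = enc_list ws" "i \<notin> set (y # xs)" "y \<notin> set (l # xs)"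
    and time: "length xs * repeat_cost k \<le> T"
  shows "runs (Prepend i l xs y) s (s(y := enc_list (blocks k (map s xs) ws))) T"
proof -
  have "runs (Prepend i l xs y) s (s(y := enc_list (blocks k (map s xs) ws))) (length xs * repeat_cost k)"
    using assms(4,5)
  proof (induction xs)
    case Nil
    then show ?case
      using assms(3) by (simp add: runs_Skip fun_upd_idem)
  next
    case (Cons x xs)
    let ?ws = "blocks k (map s xs) ws"
    let ?s = "s(y := enc_list ?ws)"
    have prepend: "runs (Prepend i l xs y) s ?s (length xs * repeat_cost k)"
      by (rule Cons.IH) (use Cons.prems in auto)
    have "runs (Repeat i l x y) ?s (?s(y := enc_list (replicate k (?s x) @ ?ws))) (repeat_cost k)"
      using assms(1,2) Cons.prems by (intro runs_Repeat) auto
    then have "runs (Repeat i l x y) ?s (s(y := enc_list (replicate k (s x) @ ?ws))) (repeat_cost k)"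
      using Cons.prems by simp
    from runs_Seq[OF prepend this] show ?case
      by (simp add: add.commute fun_upd_def)
  qed
  then show ?thesis
    using time by (rule runs_mono)
qed

section \<open>Computing the gadget\<close>

text \<open>Register \<open>r_zero\<close> is never written and holds \<open>0\<close>.\<close>

abbreviation (input) r_io :: nat where "r_io \<equiv> 0"
abbreviation (input) r_N :: nat where "r_N \<equiv> 2"
abbreviation (input) r_N1 :: nat where "r_N1 \<equiv> 3"
abbreviation (input) r_N2 :: nat where "r_N2 \<equiv> 4"
abbreviation (input) r_range :: nat where "r_range \<equiv> 5"
abbreviation (input) r_lhs :: nat where "r_lhs \<equiv> 6"
abbreviation (input) r_rhs :: nat where "r_rhs \<equiv> 7"
abbreviation (input) r_steps :: nat where "r_steps \<equiv> 8"
abbreviation (input) r_high :: nat where "r_high \<equiv> 9"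
abbreviation (input) r_outer :: nat where "r_outer \<equiv> 10"
abbreviation (input) r_inner :: nat where "r_inner \<equiv> 11"
abbreviation (input) r_rows :: nat where "r_rows \<equiv> 12"
abbreviation (input) r_row :: nat where "r_row \<equiv> 13"
abbreviation (input) r_rest :: nat where "r_rest \<equiv> 14"
abbreviation (input) r_arcs :: nat where "r_arcs \<equiv> 15"
abbreviation (input) r_m :: nat where "r_m \<equiv> 16"
abbreviation (input) r_msq :: nat where "r_msq \<equiv> 17"
abbreviation (input) r_n :: nat where "r_n \<equiv> 18"
abbreviation (input) r_omega :: nat where "r_omega \<equiv> 19"
abbreviation (input) r_kappa :: nat where "r_kappa \<equiv> 20"
abbreviation (input) r_beta :: nat where "r_beta \<equiv> 21"
abbreviation (input) r_zero :: nat where "r_zero \<equiv> 22"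
abbreviation (input) r_one :: nat where "r_one \<equiv> 23"
abbreviation (input) r_two :: nat where "r_two \<equiv> 24"
abbreviation (input) r_field :: nat where "r_field \<equiv> 25"
abbreviation (input) r_row_S :: nat where "r_row_S \<equiv> 26"
abbreviation (input) r_row_T :: nat where "r_row_T \<equiv> 27"
abbreviation (input) r_row_A :: nat where "r_row_A \<equiv> 28"
abbreviation (input) r_row_B :: nat where "r_row_B \<equiv> 29"
abbreviation (input) r_reversed :: nat where "r_reversed \<equiv> 30"
abbreviation (input) r_matrix :: nat where "r_matrix \<equiv> 31"
abbreviation (input) r_frozen1 :: nat where "r_frozen1 \<equiv> 32"
abbreviation (input) r_frozen2 :: nat where "r_frozen2 \<equiv> 33"
abbreviation (input) r_fields :: nat where "r_fields \<equiv> 34"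
abbreviation (input) r_gadget :: nat where "r_gadget \<equiv> 35"
abbreviation (input) r_answer :: nat where "r_answer \<equiv> 36"

subsection \<open>Search for the logarithm\<close>

definition Setup :: com where
  "Setup = Assigns [(r_N, Left (Left (Reg r_io))), (r_rows, Left (Right (Left (Reg r_io)))),
     (r_lhs, Right (Left (Right (Right (Reg r_io))))), (r_rhs, Right (Right (Right (Reg r_io)))),
     (r_N1, Arith Add (Reg r_N) (num 1)), (r_N2, Arith Add (Reg r_N) (num 2)),
     (r_range, Arith Mul (Reg r_N1) (Reg r_N))]"

lemma runs_Setup:
  assumes "s r_io = Cell (Cell (Atom N) (Cell rws flds)) (Cell r (Cell (Cell sg (Atom a)) (Atom b)))"
  shows "runs Setup s (s(r_N := Atom N, r_rows := rws, r_lhs := Atom a, r_rhs := Atom b, r_N1 := Atom (N + 1),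
     r_N2 := Atom (N + 2), r_range := Atom ((N + 1) * N))) (60 + 4 * N)"
  unfolding Setup_def using assms floorlog_le[of N] floorlog_le[of "Suc N"] floorlog_le[of "Suc 0"] floorlog_le[of 2]
  by (intro runs_Assigns) simp_all

definition Power :: com where
  "Power = For r_outer (Reg r_range)
     (Assigns [(r_rhs, Arith Mul (Reg r_rhs) (Reg r_N2)), (r_lhs, Arith Mul (Reg r_lhs) (Reg r_N1))])"

definition power_cost :: "nat \<Rightarrow> nat \<Rightarrow> nat \<Rightarrow> nat" where
  "power_cost N K B = 1 + for_cost K (2 * B + 2 * N + 20)"

lemma runs_Power:
  assumes store: "s r_lhs = Atom a" "s r_rhs = Atom b" "s r_N1 = Atom (N + 1)" "s r_N2 = Atom (N + 2)"
      "s r_range = Atom K" "s r_outer = Atom 0"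
    and bits: "floorlog 2 a + floorlog 2 b + K * (N + 2) \<le> B"
  shows "runs Power s (s(r_lhs := Atom (a * (N + 1) ^ K), r_rhs := Atom (b * (N + 2) ^ K))) (power_cost N K B)"
  unfolding Power_def power_cost_def
proof (rule runs_For)
  let ?f = "\<lambda>j. s(r_lhs := Atom (a * (N + 1) ^ j), r_rhs := Atom (b * (N + 2) ^ j))"
  fix j assume "j < K"
  then have "j * (N + 1) \<le> K * (N + 2)" "j * (N + 2) \<le> K * (N + 2)"
    by (intro mult_le_mono; simp)+
  then have "floorlog 2 (a * (N + 1) ^ j) \<le> B" "floorlog 2 (b * (N + 2) ^ j) \<le> B"
    using floorlog_mult_power_le[of a "N + 1" j] floorlog_mult_power_le[of b "N + 2" j] bits by linarith+
  then show "runs (Assigns [(r_rhs, Arith Mul (Reg r_rhs) (Reg r_N2)), (r_lhs, Arith Mul (Reg r_lhs) (Reg r_N1))])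
      ((?f j)(r_outer := Atom (K - j))) ((?f (Suc j))(r_outer := Atom (K - j))) (2 * B + 2 * N + 20)"
    using store floorlog_le[of "N + 1"] floorlog_le[of "N + 2"]
    by (intro runs_Assigns) (auto simp: fun_eq_iff ac_simps)
qed (use store in \<open>auto simp: fun_eq_iff\<close>)

text \<open>The least \<open>j \<le> i\<close> such that \<open>P * M ^ j \<le> Q * (M + 1) ^ j\<close>, or \<open>i\<close> if there is none.\<close>

primrec search_steps :: "nat \<Rightarrow> nat \<Rightarrow> nat \<Rightarrow> nat \<Rightarrow> nat" where
  "search_steps Q P M 0 = 0"
| "search_steps Q P M (Suc i) =
     (let j = search_steps Q P M i in if Q * (M + 1) ^ j < P * M ^ j then j + 1 else j)"

lemma search_steps_le: "search_steps Q P M i \<le> i"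
  by (induction i) (auto simp: Let_def)

definition Search_update :: "(nat \<times> expr) list" where
  "Search_update = [(r_lhs, Arith Mul (Reg r_lhs) (Reg r_N2)), (r_rhs, Arith Mul (Reg r_rhs) (Reg r_N1)),
     (r_steps, Arith Add (Reg r_steps) (num 1))]"

definition Search :: com where
  "Search = For r_outer (Arith Mul (num 3) (Reg r_range))
     (If (Arith Less (Reg r_lhs) (Reg r_rhs)) (Assigns Search_update) Skip)"

definition search_cost :: "nat \<Rightarrow> nat \<Rightarrow> nat \<Rightarrow> nat" where
  "search_cost N K B = K + 10 + for_cost (3 * K) (5 * B + 2 * N + 40)"

lemma runs_Search_step:
  assumes store: "s r_lhs = Atom Q" "s r_rhs = Atom P" "s r_N1 = Atom (N + 1)" "s r_N2 = Atom (N + 2)" "s r_steps = Atom j"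
    and bits: "floorlog 2 Q \<le> B" "floorlog 2 P \<le> B" "floorlog 2 j \<le> B"
  shows "runs (If (Arith Less (Reg r_lhs) (Reg r_rhs)) (Assigns Search_update) Skip) s
    (if Q < P then s(r_lhs := Atom (Q * (N + 2)), r_rhs := Atom (P * (N + 1)), r_steps := Atom (j + 1)) else s)
    (5 * B + 2 * N + 40)"
    (is "runs ?c s ?s' _")
proof -
  have "runs (Assigns Search_update) s ?s' (3 * B + 2 * N + 30)" if "Q < P"
    unfolding Search_update_def
    using store bits that floorlog_le[of "N + 1"] floorlog_le[of "N + 2"] floorlog_le[of "Suc 0"] by (intro runs_Assigns) simp_all
  then have "runs (if truthy (expr_val (Arith Less (Reg r_lhs) (Reg r_rhs)) s) then Assigns Search_update else Skip) s ?s'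
      (3 * B + 2 * N + 30)"
    using store by (simp add: truthy_def runs_Skip)
  from runs_If[OF this] show ?thesis
    by (rule runs_mono) (use store bits in simp)
qed

lemma runs_Search:
  fixes Q P :: nat
  assumes store: "s r_lhs = Atom Q" "s r_rhs = Atom P" "s r_N1 = Atom (N + 1)" "s r_N2 = Atom (N + 2)"
      "s r_range = Atom K" "s r_outer = Atom 0" "s r_steps = Atom 0"
    and bits: "floorlog 2 Q + floorlog 2 P + 3 * K * (N + 2) \<le> B"
  defines "J \<equiv> search_steps Q P (N + 1)"
  shows "runs Search s (s(r_lhs := Atom (Q * (N + 2) ^ J (3 * K)), r_rhs := Atom (P * (N + 1) ^ J (3 * K)),
    r_steps := Atom (J (3 * K)))) (search_cost N K B)"
  unfolding Search_def search_cost_def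
proof (rule runs_For)
  let ?f = "\<lambda>i. s(r_lhs := Atom (Q * (N + 2) ^ J i), r_rhs := Atom (P * (N + 1) ^ J i), r_steps := Atom (J i))"
  fix i assume "i < 3 * K"
  then have "J i \<le> 3 * K" using search_steps_le[of Q P "N + 1" i] by (simp add: J_def)
  then have "J i * (N + 1) \<le> 3 * K * (N + 2)" "J i * (N + 2) \<le> 3 * K * (N + 2)" "J i * 1 \<le> 3 * K * (N + 2)"
    by (intro mult_le_mono; simp)+
  then have "floorlog 2 (Q * (N + 2) ^ J i) \<le> B" "floorlog 2 (P * (N + 1) ^ J i) \<le> B" "floorlog 2 (J i) \<le> B"
    using floorlog_mult_power_le[of P "N + 1" "J i"] floorlog_mult_power_le[of Q "N + 2" "J i"] floorlog_le[of "J i"] bits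
    by linarith+
  moreover have "J (Suc i) = (if Q * (N + 2) ^ J i < P * (N + 1) ^ J i then J i + 1 else J i)"
    by (simp add: J_def Let_def)
  ultimately show "runs (If (Arith Less (Reg r_lhs) (Reg r_rhs)) (Assigns Search_update) Skip)
      ((?f i)(r_outer := Atom (3 * K - i))) ((?f (Suc i))(r_outer := Atom (3 * K - i))) (5 * B + 2 * N + 40)"
    using runs_Search_step[of "(?f i)(r_outer := Atom (3 * K - i))" "Q * (N + 2) ^ J i" "P * (N + 1) ^ J i" N "J i" B] store
    by (auto simp: fun_upd_twist ac_simps elim!: back_subst[where P = "\<lambda>s'. runs _ _ s' _"])
next
  show "expr_cost (Arith Mul (num 3) (Reg r_range)) s \<le> K + 10"
    using store floorlog_le[of 3] floorlog_le[of K] by simp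
qed (use store in \<open>auto simp: fun_eq_iff J_def\<close>)

definition Prepare :: com where
  "Prepare = Seq Setup (Seq Power (Seq (Assign r_high (Arith Less (Reg r_rhs) (Reg r_lhs))) Search))"

definition search_range :: "nat \<Rightarrow> nat" where
  "search_range N = (N + 1) * N"

definition search_lhs :: "nat \<Rightarrow> nat \<Rightarrow> nat" where
  "search_lhs a N = a * (N + 1) ^ search_range N"

definition search_rhs :: "nat \<Rightarrow> nat \<Rightarrow> nat" where
  "search_rhs b N = b * (N + 2) ^ search_range N"

definition search_result :: "nat \<Rightarrow> nat \<Rightarrow> nat \<Rightarrow> nat" where
  "search_result a b N = search_steps (search_lhs a N) (search_rhs b N) (N + 1) (3 * search_range N)"

lemma search_result_le: "search_result a b N \<le> 3 * search_range N"
  unfolding search_result_def by (rule search_steps_le)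

text \<open>\<open>F\<close> is the bit length of \<open>Zhat\<close>, and \<open>number_bits N F\<close> bounds that of all numbers occurring in the search.\<close>

definition number_bits :: "nat \<Rightarrow> nat \<Rightarrow> nat" where
  "number_bits N F = 2 * (F + search_range N * (N + 2)) + 3 * search_range N * (N + 2)"

definition prepare_cost :: "nat \<Rightarrow> nat \<Rightarrow> nat" where
  "prepare_cost N F = (60 + 4 * N) + (power_cost N (search_range N) (number_bits N F)
     + ((4 + 2 * number_bits N F) + search_cost N (search_range N) (number_bits N F)))"

lemma prepare_cost_mono: "N \<le> N' \<Longrightarrow> F \<le> F' \<Longrightarrow> prepare_cost N F \<le> prepare_cost N' F'"
  unfolding prepare_cost_def power_cost_def search_cost_def number_bits_def search_range_def
  by (intro add_le_mono mult_le_mono for_cost_mono order_refl)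

lemma number_bits_le_prepare_cost: "number_bits N F \<le> prepare_cost N F"
  by (simp add: prepare_cost_def)

lemma search_bits_le:
  "floorlog 2 (search_lhs a N) + floorlog 2 (search_rhs b N) + 3 * search_range N * (N + 2)
    \<le> number_bits N (floorlog 2 a + floorlog 2 b)"
proof -
  define d where "d = search_range N * (N + 2)"
  have "search_range N * (N + 1) \<le> d" by (simp add: d_def)
  then have "floorlog 2 (search_lhs a N) \<le> floorlog 2 a + d"
    using floorlog_mult_power_le[of a "N + 1" "search_range N"] unfolding search_lhs_def by linarith
  moreover have "floorlog 2 (search_rhs b N) \<le> floorlog 2 b + d"
    unfolding search_rhs_def d_def by (rule floorlog_mult_power_le)
  ultimately show ?thesis
    unfolding number_bits_def d_def[symmetric] by simp
qed

lemma floorlog_search_power_le: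
  assumes "j \<le> 3 * search_range N"
  shows "floorlog 2 (search_lhs a N * (N + 2) ^ j) \<le> number_bits N (floorlog 2 a + floorlog 2 b)"
    and "floorlog 2 (search_rhs b N * (N + 1) ^ j) \<le> number_bits N (floorlog 2 a + floorlog 2 b)"
proof -
  have "j * (N + 2) \<le> 3 * search_range N * (N + 2)" "j * (N + 1) \<le> 3 * search_range N * (N + 2)"
    using assms by (intro mult_le_mono; simp)+
  then show "floorlog 2 (search_lhs a N * (N + 2) ^ j) \<le> number_bits N (floorlog 2 a + floorlog 2 b)"
    and "floorlog 2 (search_rhs b N * (N + 1) ^ j) \<le> number_bits N (floorlog 2 a + floorlog 2 b)"
    using floorlog_mult_power_le[of "search_lhs a N" "N + 2" j] floorlog_mult_power_le[of "search_rhs b N" "N + 1" j]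
      search_bits_le[of a N b] by linarith+
qed

lemma runs_Prepare:
  fixes a b N :: nat
  assumes store: "s r_io = Cell (Cell (Atom N) (Cell rws flds)) (Cell r (Cell (Cell sg (Atom a)) (Atom b)))"
    and clear: "\<And>i. i \<noteq> r_io \<Longrightarrow> s i = Atom 0"
  defines "F \<equiv> floorlog 2 a + floorlog 2 b"
    and "Q \<equiv> search_lhs a N" and "P \<equiv> search_rhs b N" and "J \<equiv> search_result a b N"
  obtains s' where "runs Prepare s s' (prepare_cost N F)" "s' r_N = Atom N" "s' r_rows = rws" "s' r_N1 = Atom (N + 1)"
    "s' r_steps = Atom J" "s' r_high = Atom (of_bool (P < Q))"
    "s' r_lhs = Atom (Q * (N + 2) ^ J)" "s' r_rhs = Atom (P * (N + 1) ^ J)"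
    "\<forall>i\<in>{r_outer, r_inner, r_arcs, r_row, r_rest, r_reversed, r_matrix, r_zero}. s' i = Atom 0"
    "floorlog 2 (Q * (N + 2) ^ J) \<le> number_bits N F" "floorlog 2 (P * (N + 1) ^ J) \<le> number_bits N F"
proof -
  let ?K = "search_range N" and ?bits = "number_bits N F"
  define s_input where "s_input = s(r_N := Atom N, r_rows := rws, r_lhs := Atom a, r_rhs := Atom b, r_N1 := Atom (N + 1),
    r_N2 := Atom (N + 2), r_range := Atom ?K)"
  define s_power where "s_power = s_input(r_lhs := Atom Q, r_rhs := Atom P)"
  define s_high where "s_high = s_power(r_high := Atom (of_bool (P < Q)))"
  define s_search where
    "s_search = s_high(r_lhs := Atom (Q * (N + 2) ^ J), r_rhs := Atom (P * (N + 1) ^ J), r_steps := Atom J)"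
  note stores = s_input_def s_power_def s_high_def s_search_def
  have read_input: "runs Setup s s_input (60 + 4 * N)"
    unfolding s_input_def search_range_def by (rule runs_Setup) (rule store)
  have power: "runs Power s_input s_power (power_cost N ?K ?bits)"
    unfolding s_power_def Q_def P_def search_lhs_def search_rhs_def
    by (rule runs_Power) (simp_all add: s_input_def clear F_def number_bits_def)
  have high: "runs (Assign r_high (Arith Less (Reg r_rhs) (Reg r_lhs))) s_power s_high (4 + 2 * ?bits)"
    using search_bits_le[of a N b] unfolding s_high_def
    by (intro runs_Assign) (simp_all add: s_power_def Q_def P_def F_def)
  have search: "runs Search s_high s_search (search_cost N ?K ?bits)"
    unfolding s_search_def J_def search_result_def Q_def P_def F_def
    by (rule runs_Search[OF _ _ _ _ _ _ _ search_bits_le]) (simp_all add: stores clear Q_def P_def)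
  have "runs Prepare s s_search (prepare_cost N F)"
    unfolding Prepare_def prepare_cost_def
    by (rule runs_Seq[OF read_input runs_Seq[OF power runs_Seq[OF high search]]])
  moreover have "floorlog 2 (Q * (N + 2) ^ J) \<le> ?bits" "floorlog 2 (P * (N + 1) ^ J) \<le> ?bits"
    unfolding Q_def P_def F_def J_def by (rule floorlog_search_power_le[OF search_result_le])+
  ultimately show ?thesis
    by (intro that[of s_search]) (simp_all add: stores clear)
qed

subsection \<open>Counting the arcs\<close>

definition count_cells :: "val list \<Rightarrow> nat" where
  "count_cells vs = length (filter is_cell vs)"

lemma count_cells_le: "count_cells vs \<le> length vs"
  by (simp add: count_cells_def)

lemma count_cells_take_Suc:
  "j < length vs \<Longrightarrow> count_cells (take (Suc j) vs) = count_cells (take j vs) + of_bool (is_cell (vs ! j))"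
  by (simp add: count_cells_def take_Suc_conv_app_nth)

definition Count_row :: com where
  "Count_row = For r_inner (Reg r_N)
     (Assigns [(r_arcs, Arith Add (Reg r_arcs) (IsCell (Left (Reg r_row)))), (r_row, Right (Reg r_row))])"

definition count_row_cost :: "nat \<Rightarrow> nat" where
  "count_row_cost N = 1 + for_cost N (N * N + N + 15)"

lemma runs_Count_row:
  assumes store: "s r_N = Atom N" "s r_inner = Atom 0" "s r_arcs = Atom c" "s r_row = enc_list rw"
    and row_length: "length rw = N" and count_le: "c \<le> N * N"
  shows "runs Count_row s (s(r_arcs := Atom (c + count_cells rw), r_row := Atom 0)) (count_row_cost N)"
proof -
  let ?f = "\<lambda>j. s(r_arcs := Atom (c + count_cells (take j rw)), r_row := enc_list (drop j rw))"
  have "runs Count_row s (?f N) (count_row_cost N)"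
    unfolding Count_row_def count_row_cost_def
  proof (rule runs_For)
    fix j assume less: "j < N"
    have "floorlog 2 (c + count_cells (take j rw)) \<le> N * N + N"
      using count_cells_le[of "take j rw"] less row_length count_le floorlog_le[of "c + count_cells (take j rw)"] by simp
    then show "runs (Assigns [(r_arcs, Arith Add (Reg r_arcs) (IsCell (Left (Reg r_row)))), (r_row, Right (Reg r_row))])
        ((?f j)(r_inner := Atom (N - j))) ((?f (Suc j))(r_inner := Atom (N - j))) (N * N + N + 15)"
      using store row_length less floorlog_le[of "of_bool (is_cell (rw ! j))"]
      by (intro runs_Assigns)
        (auto simp: fun_eq_iff left_val_drop right_val_drop count_cells_take_Suc)
  qed (use store row_length in \<open>auto simp: fun_eq_iff count_cells_def\<close>)
  then show ?thesis using row_length by simp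
qed

definition Count :: com where
  "Count = Seq (Assign r_rest (Reg r_rows))
     (For r_outer (Reg r_N) (Seq (Assigns [(r_row, Left (Reg r_rest)), (r_rest, Right (Reg r_rest))]) Count_row))"

definition count_cost :: "nat \<Rightarrow> nat" where
  "count_cost N = 2 + (1 + for_cost N (6 + count_row_cost N))"

lemma sum_count_cells_take_le:
  assumes "\<forall>rw\<in>set rws. length rw = N" "j \<le> N"
  shows "sum_list (map count_cells (take j rws)) \<le> N * N"
proof -
  have "sum_list (map count_cells (take j rws)) \<le> (\<Sum>_\<leftarrow>take j rws. N)"
    using assms(1) by (intro sum_list_mono) (metis count_cells_le in_set_takeD)
  also have "\<dots> \<le> N * N"
    using assms(2) by (simp add: sum_list_triv min.coboundedI2)
  finally show ?thesis .
qed

lemma runs_Count: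
  assumes store: "s r_N = Atom N" "s r_outer = Atom 0" "s r_inner = Atom 0" "s r_arcs = Atom 0" "s r_row = Atom 0"
      "s r_rest = Atom 0" "s r_rows = enc_list (map enc_list rws)"
    and shape: "length rws = N" "\<forall>rw\<in>set rws. length rw = N"
  shows "runs Count s (s(r_arcs := Atom (sum_list (map count_cells rws)))) (count_cost N)"
proof -
  let ?c = "\<lambda>j. sum_list (map count_cells (take j rws))"
  let ?f = "\<lambda>j. s(r_arcs := Atom (?c j), r_rest := enc_list (map enc_list (drop j rws)))"
  let ?next = "Assigns [(r_row, Left (Reg r_rest)), (r_rest, Right (Reg r_rest))]"
  have init: "runs (Assign r_rest (Reg r_rows)) s (s(r_rest := s r_rows)) 2"
    by (rule runs_Assign) simp_all
  have "runs (For r_outer (Reg r_N) (Seq ?next Count_row)) (s(r_rest := s r_rows)) (?f N)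
      (1 + for_cost N (6 + count_row_cost N))"
  proof (rule runs_For)
    fix j assume less: "j < N"
    let ?s = "(?f j)(r_outer := Atom (N - j))"
    let ?s' = "?s(r_row := enc_list (rws ! j), r_rest := enc_list (map enc_list (drop (Suc j) rws)))"
    have advance: "runs ?next ?s ?s' 6"
      using less shape left_val_drop[of j "map enc_list rws"] right_val_drop[of j "map enc_list rws"]
      by (intro runs_Assigns) (auto simp: fun_eq_iff drop_map)
    have "runs Count_row ?s' (?s'(r_arcs := Atom (?c j + count_cells (rws ! j)), r_row := Atom 0)) (count_row_cost N)"
      using store shape less sum_count_cells_take_le[OF shape(2), of j] by (intro runs_Count_row) auto
    moreover have "?s'(r_arcs := Atom (?c j + count_cells (rws ! j)), r_row := Atom 0)
        = (?f (Suc j))(r_outer := Atom (N - j))"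
      using store shape less by (auto simp: fun_eq_iff take_Suc_conv_app_nth)
    ultimately show "runs (Seq ?next Count_row) ?s ((?f (Suc j))(r_outer := Atom (N - j))) (6 + count_row_cost N)"
      using runs_Seq[OF advance] by simp
  qed (use store shape in \<open>auto simp: fun_eq_iff\<close>)
  moreover have "?f N = s(r_arcs := Atom (sum_list (map count_cells rws)))"
    using store shape by (auto simp: fun_eq_iff)
  ultimately show ?thesis
    using runs_Seq[OF init] unfolding Count_def count_cost_def by simp
qed

subsection \<open>Writing down the gadget\<close>

definition frac_val :: "nat \<Rightarrow> nat \<Rightarrow> val" where
  "frac_val p q = Cell (Cell (Atom 1) (Atom p)) (Atom q)"

definition zero_val :: val where
  "zero_val = Cell (Cell (Atom 0) (Atom 0)) (Atom 1)"

definition block_row :: "nat \<Rightarrow> nat \<Rightarrow> val list \<Rightarrow> val \<Rightarrow> val" where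
  "block_row m N vs v = enc_list (blocks m vs (replicate N v))"

definition graph_row :: "nat \<Rightarrow> val \<Rightarrow> val list \<Rightarrow> val" where
  "graph_row m kv rw = enc_list (blocks m [kv, Atom 0, kv, Atom 0] rw)"

definition gadget_val :: "nat \<Rightarrow> nat \<Rightarrow> val \<Rightarrow> val \<Rightarrow> val \<Rightarrow> val list list \<Rightarrow> val" where
  "gadget_val m N bv wv kv rws = Cell (Atom (4 * m + N))
     (Cell (enc_list (blocks m
         [block_row m N [Atom 0, bv, wv, Atom 0] kv, block_row m N [bv, Atom 0, Atom 0, Atom 0] (Atom 0),
          block_row m N [wv, Atom 0, Atom 0, bv] kv, block_row m N [Atom 0, Atom 0, bv, Atom 0] (Atom 0)]
         (map (graph_row m kv) rws)))
       (enc_list (replicate (4 * m + N) (Cell zero_val zero_val))))"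

definition Layout :: "nat \<Rightarrow> nat list \<Rightarrow> nat \<Rightarrow> com" where
  "Layout y xs x = Seq (Assign y (num 0)) (Seq (Repeat r_inner r_N x y) (Prepend r_inner r_m xs y))"

primrec Layouts :: "(nat \<times> nat list \<times> nat) list \<Rightarrow> com" where
  "Layouts [] = Skip"
| "Layouts (l # ls) = Seq (Layout (fst l) (fst (snd l)) (snd (snd l))) (Layouts ls)"

primrec store_after_layouts :: "nat \<Rightarrow> nat \<Rightarrow> (nat \<times> nat list \<times> nat) list \<Rightarrow> store \<Rightarrow> store" where
  "store_after_layouts m N [] s = s"
| "store_after_layouts m N (l # ls) s =
     store_after_layouts m N ls (s(fst l := block_row m N (map s (fst (snd l))) (s (snd (snd l)))))"

definition layout_cost :: "nat \<Rightarrow> nat \<Rightarrow> nat" where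
  "layout_cost m N = 2 + (repeat_cost N + 4 * repeat_cost m)"

lemma runs_Layout:
  assumes "s r_m = Atom m" "s r_N = Atom N" "s r_inner = Atom 0" "length xs = 4"
    "r_inner \<notin> set (y # x # xs)" "y \<notin> set (r_m # r_N # x # xs)"
  shows "runs (Layout y xs x) s (s(y := block_row m N (map s xs) (s x))) (layout_cost m N)"
proof -
  let ?s_init = "s(y := Atom 0)" and ?s_last = "s(y := enc_list (replicate N (s x)))"
  have "runs (Assign y (num 0)) s ?s_init 2"
    by (rule runs_Assign) simp_all
  moreover have "runs (Repeat r_inner r_N x y) ?s_init ?s_last (repeat_cost N)"
    using runs_Repeat[of ?s_init r_N N r_inner y "[]" x] assms by auto
  moreover have "runs (Prepend r_inner r_m xs y) ?s_last (s(y := block_row m N (map s xs) (s x))) (4 * repeat_cost m)"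
  proof -
    have "map ?s_last xs = map s xs" using assms(6) by auto
    then show ?thesis
      using runs_Prepend[of ?s_last r_m m r_inner y "replicate N (s x)" xs "4 * repeat_cost m"] assms by (simp add: block_row_def)
  qed
  ultimately show ?thesis
    unfolding Layout_def layout_cost_def by (intro runs_Seq)
qed

lemma runs_Layouts:
  assumes "s r_m = Atom m" "s r_N = Atom N" "s r_inner = Atom 0"
    and "\<forall>(y, xs, x)\<in>set ls. length xs = 4 \<and> r_inner \<notin> set (y # x # xs) \<and> y \<notin> set (r_m # r_N # x # xs)"
  shows "runs (Layouts ls) s (store_after_layouts m N ls s) (length ls * layout_cost m N)"
  using assms
proof (induction ls arbitrary: s)
  case Nil
  then show ?case by (simp add: runs_Skip)
next
  case (Cons l ls)
  obtain y xs x where layout: "l = (y, xs, x)" by (cases l)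
  let ?s = "s(y := block_row m N (map s xs) (s x))"
  have "runs (Layout y xs x) s ?s (layout_cost m N)"
    using Cons.prems by (intro runs_Layout) (auto simp: layout)
  moreover have "runs (Layouts ls) ?s (store_after_layouts m N ls ?s) (length ls * layout_cost m N)"
    using Cons.prems by (intro Cons.IH) (auto simp: layout)
  ultimately show ?case
    by (simp add: layout runs_Seq)
qed

definition Rows :: com where
  "Rows = Seq (For r_outer (Reg r_N) (Seq (Assigns [(r_row, Left (Reg r_rows)), (r_rows, Right (Reg r_rows))])
       (Seq (Prepend r_inner r_m [r_kappa, r_zero, r_kappa, r_zero] r_row)
          (Assigns [(r_reversed, MkCell (Reg r_row) (Reg r_reversed)), (r_row, num 0)]))))
     (For r_outer (Reg r_N)
        (Assigns [(r_matrix, MkCell (Left (Reg r_reversed)) (Reg r_matrix)), (r_reversed, Right (Reg r_reversed))]))"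

definition rows_cost :: "nat \<Rightarrow> nat \<Rightarrow> nat" where
  "rows_cost m N = (1 + for_cost N (6 + (4 * repeat_cost m + 6))) + (1 + for_cost N 8)"

lemma runs_Rows_forward:
  assumes store: "s r_N = Atom N" "s r_outer = Atom 0" "s r_inner = Atom 0" "s r_m = Atom m" "s r_row = Atom 0"
      "s r_reversed = Atom 0" "s r_zero = Atom 0" "s r_rows = enc_list (map enc_list rws)"
    and rows_length: "length rws = N"
  shows "runs (For r_outer (Reg r_N) (Seq (Assigns [(r_row, Left (Reg r_rows)), (r_rows, Right (Reg r_rows))])
       (Seq (Prepend r_inner r_m [r_kappa, r_zero, r_kappa, r_zero] r_row)
          (Assigns [(r_reversed, MkCell (Reg r_row) (Reg r_reversed)), (r_row, num 0)])))) s
    (s(r_rows := Atom 0, r_reversed := enc_list (rev (map (graph_row m (s r_kappa)) rws))))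
    (1 + for_cost N (6 + (4 * repeat_cost m + 6)))"
proof -
  let ?R = "map (graph_row m (s r_kappa)) rws"
  let ?f = "\<lambda>j. s(r_rows := enc_list (map enc_list (drop j rws)), r_reversed := enc_list (rev (take j ?R)))"
  let ?next = "Assigns [(r_row, Left (Reg r_rows)), (r_rows, Right (Reg r_rows))]"
  let ?prepend = "Prepend r_inner r_m [r_kappa, r_zero, r_kappa, r_zero] r_row"
  let ?push = "Assigns [(r_reversed, MkCell (Reg r_row) (Reg r_reversed)), (r_row, num 0)]"
  have "runs (For r_outer (Reg r_N) (Seq ?next (Seq ?prepend ?push))) s (?f N) (1 + for_cost N (6 + (4 * repeat_cost m + 6)))"
  proof (rule runs_For)
    fix j assume less: "j < N"
    let ?s = "(?f j)(r_outer := Atom (N - j))"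
    let ?s_row = "?s(r_row := enc_list (rws ! j), r_rows := enc_list (map enc_list (drop (Suc j) rws)))"
    let ?s_prepended = "?s_row(r_row := graph_row m (s r_kappa) (rws ! j))"
    have "runs ?next ?s ?s_row 6"
      using less rows_length left_val_drop[of j "map enc_list rws"] right_val_drop[of j "map enc_list rws"]
      by (intro runs_Assigns) (auto simp: fun_eq_iff drop_map)
    moreover have "runs ?prepend ?s_row ?s_prepended (4 * repeat_cost m)"
      using runs_Prepend[of ?s_row r_m m r_inner r_row "rws ! j" "[r_kappa, r_zero, r_kappa, r_zero]" "4 * repeat_cost m"] store
      by (simp add: graph_row_def)
    moreover have "runs ?push ?s_prepended ((?f (Suc j))(r_outer := Atom (N - j))) 6"
      using store rows_length less by (intro runs_Assigns) (auto simp: fun_eq_iff take_Suc_conv_app_nth)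
    ultimately show "runs (Seq ?next (Seq ?prepend ?push)) ?s ((?f (Suc j))(r_outer := Atom (N - j)))
        (6 + (4 * repeat_cost m + 6))"
      by (intro runs_Seq)
  qed (use store rows_length in \<open>auto simp: fun_eq_iff\<close>)
  then show ?thesis using rows_length by simp
qed

lemma runs_Rows_reverse:
  assumes store: "s r_N = Atom N" "s r_outer = Atom 0" "s r_reversed = enc_list (rev vs)" "s r_matrix = Atom 0"
    and rows_length: "length vs = N"
  shows "runs (For r_outer (Reg r_N)
        (Assigns [(r_matrix, MkCell (Left (Reg r_reversed)) (Reg r_matrix)), (r_reversed, Right (Reg r_reversed))])) s
    (s(r_reversed := Atom 0, r_matrix := enc_list vs)) (1 + for_cost N 8)"
proof -
  let ?f = "\<lambda>j. s(r_reversed := enc_list (drop j (rev vs)), r_matrix := enc_list (rev (take j (rev vs))))"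
  let ?move = "Assigns [(r_matrix, MkCell (Left (Reg r_reversed)) (Reg r_matrix)), (r_reversed, Right (Reg r_reversed))]"
  have "runs (For r_outer (Reg r_N) ?move) s (?f N) (1 + for_cost N 8)"
  proof (rule runs_For)
    show "runs ?move ((?f j)(r_outer := Atom (N - j))) ((?f (Suc j))(r_outer := Atom (N - j))) 8" if "j < N" for j
      using that rows_length left_val_drop[of j "rev vs"] right_val_drop[of j "rev vs"] take_Suc_conv_app_nth[of j "rev vs"]
      by (intro runs_Assigns) (auto simp: fun_eq_iff)
  qed (use store rows_length in \<open>auto simp: fun_eq_iff\<close>)
  then show ?thesis using rows_length by simp
qed

lemma runs_Rows:
  assumes store: "s r_N = Atom N" "s r_outer = Atom 0" "s r_inner = Atom 0" "s r_m = Atom m" "s r_row = Atom 0"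
      "s r_reversed = Atom 0" "s r_matrix = Atom 0" "s r_zero = Atom 0" "s r_rows = enc_list (map enc_list rws)"
    and rows_length: "length rws = N"
  shows "runs Rows s (s(r_rows := Atom 0, r_matrix := enc_list (map (graph_row m (s r_kappa)) rws))) (rows_cost m N)"
proof -
  let ?R = "map (graph_row m (s r_kappa)) rws"
  let ?s = "s(r_rows := Atom 0, r_reversed := enc_list (rev ?R))"
  have "runs Rows s (?s(r_reversed := Atom 0, r_matrix := enc_list ?R)) (rows_cost m N)"
    unfolding Rows_def rows_cost_def
  proof (rule runs_Seq[OF runs_Rows_forward[OF store(1-6,8,9) rows_length] runs_Rows_reverse])
    show "length ?R = N" using rows_length by simp
  qed (use store in simp_all)
  moreover have "?s(r_reversed := Atom 0, r_matrix := enc_list ?R) = s(r_rows := Atom 0, r_matrix := enc_list ?R)"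
    using store by (auto simp: fun_eq_iff)
  ultimately show ?thesis by simp
qed

text \<open>With \<open>m = \<Theta>(N\<^sup>2)\<close>, the total coupling \<open>m\<^sup>2 \<omega>\<close> is \<open>balance\<close> up to an error of \<open>1 / m\<^sup>2\<close>.\<close>

definition balance :: "nat \<Rightarrow> nat \<Rightarrow> nat \<Rightarrow> nat \<Rightarrow> nat" where
  "balance L N arcs j = L * (N * (N + 1)) - N - 3 * arcs div 10 + j div (N + 1)"

lemma balance_le: "j \<le> 3 * search_range N \<Longrightarrow> balance L N arcs j \<le> balance_bound L N"
proof -
  assume "j \<le> 3 * search_range N"
  then have "j div (N + 1) \<le> (3 * N * (N + 1)) div (N + 1)"
    unfolding search_range_def by (intro div_le_mono) (simp add: algebra_simps)
  also have "\<dots> = 3 * N" by (rule nonzero_mult_div_cancel_right) simp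
  finally show ?thesis unfolding balance_def balance_bound_def by linarith
qed

definition omega_val :: "nat \<Rightarrow> nat \<Rightarrow> val" where
  "omega_val m u = frac_val (m * m * u + 1) (m * m * (m * m))"

definition params :: "nat \<Rightarrow> (nat \<times> expr) list" where
  "params L = [(r_m, Arith Mul (num L) (Arith Mul (Reg r_N1) (Reg r_N1))), (r_msq, Arith Mul (Reg r_m) (Reg r_m)),
     (r_n, Arith Add (Arith Mul (num 4) (Reg r_m)) (Reg r_N)),
     (r_omega, Arith Add (Arith Sub (Arith Sub (Arith Mul (num L) (Arith Mul (Reg r_N) (Reg r_N1))) (Reg r_N))
        (Arith Div (Arith Mul (num 3) (Reg r_arcs)) (num 10))) (Arith Div (Reg r_steps) (Reg r_N1))),
     (r_omega, MkCell (MkCell (num 1) (Arith Add (Arith Mul (Reg r_msq) (Reg r_omega)) (num 1)))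
        (Arith Mul (Reg r_msq) (Reg r_msq))),
     (r_kappa, MkCell (MkCell (num 1) (num 1)) (Reg r_N1)),
     (r_beta, Lit (frac_val 10 1)), (r_one, num 1), (r_two, num 2), (r_field, Lit (Cell zero_val zero_val))]"

definition param_bound :: "nat \<Rightarrow> nat \<Rightarrow> nat" where
  "param_bound L N = (let m = block_size L N; U = balance_bound L N in
     m * m * (m * m) + m * m * U + m * m + 4 * m + U + L + 12 * ((N + 1) * (N + 1)))"

definition params_cost :: "nat \<Rightarrow> nat \<Rightarrow> nat" where
  "params_cost L N = 200 + 40 * param_bound L N"

lemma cost_of_params:
  fixes L N :: nat
  defines "m \<equiv> block_size L N" and "LN \<equiv> L * (N * (N + 1))"
  assumes store: "s r_N = Atom N" "s r_N1 = Atom (N + 1)" "s r_steps = Atom j" "s r_arcs = Atom arcs"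
  shows "cost_of (params L) s = 60
    + (floorlog 2 L + floorlog 2 ((N + 1) * (N + 1)) + 2 * floorlog 2 (N + 1)) + 2 * floorlog 2 m
    + (floorlog 2 4 + floorlog 2 m + floorlog 2 (4 * m) + floorlog 2 N)
    + (floorlog 2 L + floorlog 2 (N * (N + 1)) + floorlog 2 N + floorlog 2 (N + 1) + floorlog 2 LN + floorlog 2 N
      + floorlog 2 (LN - N) + floorlog 2 (3 * arcs div 10)
      + floorlog 2 (3 * arcs) + floorlog 2 10 + floorlog 2 3 + floorlog 2 arcs
      + floorlog 2 j + floorlog 2 (N + 1) + floorlog 2 (LN - N - 3 * arcs div 10) + floorlog 2 (j div (N + 1)))
    + (floorlog 2 (m * m) + floorlog 2 (balance L N arcs j) + floorlog 2 (m * m * balance L N arcs j) + floorlog 2 1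
      + 2 * floorlog 2 (m * m))"
  using store by (simp add: params_def m_def LN_def balance_def block_size_def power2_eq_square)

lemma cost_of_params_le:
  fixes L N :: nat
  defines "V \<equiv> param_bound L N"
  assumes store: "s r_N = Atom N" "s r_N1 = Atom (N + 1)" "s r_steps = Atom j" "s r_arcs = Atom arcs"
    and bounds: "arcs \<le> 3 * N" "j \<le> 3 * search_range N"
  shows "cost_of (params L) s \<le> params_cost L N"
proof -
  define m where "m = block_size L N"
  define u where "u = balance L N arcs j"
  let ?LN = "L * (N * (N + 1))"
  have balance: "u \<le> balance_bound L N"
    unfolding u_def by (rule balance_le[OF bounds(2)])
  have V_eq: "V = m * m * (m * m) + m * m * balance_bound L N + m * m + 4 * m + balance_bound L N + L
      + 12 * ((N + 1) * (N + 1))"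
    by (simp add: V_def param_bound_def Let_def m_def)
  have bits: "floorlog 2 x \<le> V" if "x \<le> V" for x
    using floorlog_le[of x] that by linarith
  have squares: "N * (N + 1) \<le> (N + 1) * (N + 1)" "N + 1 \<le> (N + 1) * (N + 1)"
    by simp_all
  have "3 * search_range N = 3 * (N * (N + 1))"
    by (simp add: search_range_def mult.commute)
  also have "\<dots> \<le> 12 * ((N + 1) * (N + 1))"
    by (rule mult_le_mono[OF _ squares(1)]) simp
  finally have steps: "j \<le> 12 * ((N + 1) * (N + 1))"
    using bounds(2) by (rule order_trans[rotated])
  have "floorlog 2 L \<le> V" "floorlog 2 ((N + 1) * (N + 1)) \<le> V" "floorlog 2 (N + 1) \<le> V" "floorlog 2 N \<le> V"
      "floorlog 2 (N * (N + 1)) \<le> V" "floorlog 2 10 \<le> V" "floorlog 2 4 \<le> V" "floorlog 2 3 \<le> V" "floorlog 2 1 \<le> V"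
    by (rule bits, use V_eq squares in linarith)+
  moreover have "floorlog 2 m \<le> V" "floorlog 2 (4 * m) \<le> V" "floorlog 2 (m * m) \<le> V" "floorlog 2 u \<le> V"
      "floorlog 2 (m * m * u) \<le> V"
    by (rule bits, use V_eq balance mult_le_mono2[OF balance, of "m * m"] in linarith)+
  moreover have "floorlog 2 ?LN \<le> V" "floorlog 2 (?LN - N) \<le> V" "floorlog 2 (?LN - N - 3 * arcs div 10) \<le> V"
    by (rule bits, use V_eq balance_bound_def[of L N] in linarith)+
  moreover have "floorlog 2 (3 * arcs) \<le> V" "floorlog 2 (3 * arcs div 10) \<le> V" "floorlog 2 arcs \<le> V"
      "floorlog 2 j \<le> V" "floorlog 2 (j div (N + 1)) \<le> V"
    by (rule bits, use V_eq bounds(1) squares steps div_le_dividend[of j "N + 1"] in linarith)+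
  ultimately show ?thesis
    unfolding cost_of_params[OF store, of L, folded m_def u_def] params_cost_def V_def by linarith
qed

lemma runs_params:
  fixes L :: nat
  assumes store: "s r_N = Atom N" "s r_N1 = Atom (N + 1)" "s r_steps = Atom j" "s r_arcs = Atom arcs"
    and bounds: "arcs \<le> 3 * N" "j \<le> 3 * search_range N"
  defines "m \<equiv> block_size L N" and "u \<equiv> balance L N arcs j"
  shows "runs (Assigns (params L)) s
    (s(r_m := Atom m, r_msq := Atom (m * m), r_n := Atom (4 * m + N), r_omega := omega_val m u,
       r_kappa := frac_val 1 (N + 1), r_beta := frac_val 10 1, r_one := Atom 1, r_two := Atom 2,
       r_field := Cell zero_val zero_val)) (params_cost L N)"
proof (rule runs_Assigns[OF _ cost_of_params_le[OF store bounds]])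
  have "m = L * ((N + 1) * (N + 1))"
    by (simp add: m_def block_size_def power2_eq_square)
  then show "store_after (params L) s = s(r_m := Atom m, r_msq := Atom (m * m), r_n := Atom (4 * m + N),
       r_omega := omega_val m u, r_kappa := frac_val 1 (N + 1), r_beta := frac_val 10 1, r_one := Atom 1, r_two := Atom 2,
       r_field := Cell zero_val zero_val)"
    using store by (simp add: params_def u_def balance_def frac_val_def omega_val_def)
qed

definition gadget_layouts :: "(nat \<times> nat list \<times> nat) list" where
  "gadget_layouts =
    [(r_row_S, [r_zero, r_beta, r_omega, r_zero], r_kappa), (r_row_T, [r_beta, r_zero, r_zero, r_zero], r_zero),
     (r_row_A, [r_omega, r_zero, r_zero, r_beta], r_kappa), (r_row_B, [r_zero, r_zero, r_beta, r_zero], r_zero),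
     (r_frozen1, [r_one, r_two, r_one, r_two], r_two), (r_frozen2, [r_two, r_one, r_two, r_one], r_one)]"

lemma runs_gadget_layouts:
  assumes store: "s r_m = Atom m" "s r_N = Atom N" "s r_inner = Atom 0" "s r_zero = Atom 0" "s r_one = Atom 1" "s r_two = Atom 2"
      "s r_beta = bv" "s r_omega = wv" "s r_kappa = kv"
  obtains s' where "runs (Layouts gadget_layouts) s s' (length gadget_layouts * layout_cost m N)"
    "s' r_row_S = block_row m N [Atom 0, bv, wv, Atom 0] kv" "s' r_row_T = block_row m N [bv, Atom 0, Atom 0, Atom 0] (Atom 0)"
    "s' r_row_A = block_row m N [wv, Atom 0, Atom 0, bv] kv" "s' r_row_B = block_row m N [Atom 0, Atom 0, bv, Atom 0] (Atom 0)"
    "s' r_frozen1 = block_row m N [Atom 1, Atom 2, Atom 1, Atom 2] (Atom 2)"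
    "s' r_frozen2 = block_row m N [Atom 2, Atom 1, Atom 2, Atom 1] (Atom 1)"
    "\<And>i. i \<notin> {r_row_S, r_row_T, r_row_A, r_row_B, r_frozen1, r_frozen2} \<Longrightarrow> s' i = s i"
proof (rule that)
  show "runs (Layouts gadget_layouts) s (store_after_layouts m N gadget_layouts s) (length gadget_layouts * layout_cost m N)"
    by (rule runs_Layouts) (use store in \<open>simp_all add: gadget_layouts_def\<close>)
qed (use store in \<open>simp_all add: gadget_layouts_def\<close>)

definition Assemble :: com where
  "Assemble = Seq Rows (Seq (Prepend r_inner r_m [r_row_S, r_row_T, r_row_A, r_row_B] r_matrix)
     (Seq (Assign r_fields (num 0)) (Seq (Repeat r_inner r_n r_field r_fields)
     (Assign r_gadget (MkCell (Reg r_n) (MkCell (Reg r_matrix) (Reg r_fields)))))))"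

definition assemble_cost :: "nat \<Rightarrow> nat \<Rightarrow> nat" where
  "assemble_cost m N = rows_cost m N + (4 * repeat_cost m + (2 + (repeat_cost (4 * m + N) + 6)))"

lemma runs_Assemble:
  assumes store: "s r_N = Atom N" "s r_outer = Atom 0" "s r_inner = Atom 0" "s r_m = Atom m" "s r_row = Atom 0"
      "s r_reversed = Atom 0" "s r_matrix = Atom 0" "s r_zero = Atom 0" "s r_rows = enc_list (map enc_list rws)"
      "s r_n = Atom (4 * m + N)"
    and rows_length: "length rws = N"
  obtains s' where "runs Assemble s s' (assemble_cost m N)"
    "s' r_gadget = Cell (Atom (4 * m + N))
      (Cell (enc_list (blocks m (map s [r_row_S, r_row_T, r_row_A, r_row_B]) (map (graph_row m (s r_kappa)) rws)))
        (enc_list (replicate (4 * m + N) (s r_field))))"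
    "s' r_frozen1 = s r_frozen1" "s' r_frozen2 = s r_frozen2"
proof -
  let ?R = "map (graph_row m (s r_kappa)) rws" and ?blocks = "[r_row_S, r_row_T, r_row_A, r_row_B]"
  define s_matrix where "s_matrix = s(r_rows := Atom 0, r_matrix := enc_list ?R)"
  define s_blocks where "s_blocks = s_matrix(r_matrix := enc_list (blocks m (map s_matrix ?blocks) ?R))"
  define s_clear where "s_clear = s_blocks(r_fields := Atom 0)"
  define s_fields where "s_fields = s_clear(r_fields := enc_list (replicate (4 * m + N) (s_clear r_field) @ []))"
  define s_gadget where "s_gadget = s_fields(r_gadget := Cell (Atom (4 * m + N)) (Cell (s_fields r_matrix) (s_fields r_fields)))"
  note stores = s_matrix_def s_blocks_def s_clear_def s_fields_def s_gadget_def
  have graph_rows: "runs Rows s s_matrix (rows_cost m N)"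
    unfolding s_matrix_def by (rule runs_Rows) (rule store rows_length)+
  have matrix: "runs (Prepend r_inner r_m ?blocks r_matrix) s_matrix s_blocks (4 * repeat_cost m)"
    unfolding s_blocks_def using store by (intro runs_Prepend) (simp_all add: s_matrix_def)
  have clear_fields: "runs (Assign r_fields (num 0)) s_blocks s_clear 2"
    unfolding s_clear_def by (rule runs_Assign) simp_all
  have write_fields: "runs (Repeat r_inner r_n r_field r_fields) s_clear s_fields (repeat_cost (4 * m + N))"
    unfolding s_fields_def using store by (intro runs_Repeat) (simp_all add: s_matrix_def s_blocks_def s_clear_def)
  have result: "runs (Assign r_gadget (MkCell (Reg r_n) (MkCell (Reg r_matrix) (Reg r_fields)))) s_fields s_gadget 6"
    unfolding s_gadget_def using store by (intro runs_Assign) (simp_all add: s_matrix_def s_blocks_def s_clear_def s_fields_def)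
  show ?thesis
  proof (rule that)
    show "runs Assemble s s_gadget (assemble_cost m N)"
      unfolding Assemble_def assemble_cost_def
      by (rule runs_Seq[OF graph_rows runs_Seq[OF matrix runs_Seq[OF clear_fields runs_Seq[OF write_fields result]]]])
  qed (simp_all add: stores)
qed

definition Build :: "nat \<Rightarrow> com" where
  "Build L = Seq Count (Seq (Assigns (params L)) (Seq (Layouts gadget_layouts) Assemble))"

definition build_cost :: "nat \<Rightarrow> nat \<Rightarrow> nat" where
  "build_cost L N = count_cost N + (params_cost L N
     + (length gadget_layouts * layout_cost (block_size L N) N + assemble_cost (block_size L N) N))"

lemma runs_Build:
  fixes L :: nat
  assumes store: "s r_N = Atom N" "s r_rows = enc_list (map enc_list rws)" "s r_N1 = Atom (N + 1)" "s r_steps = Atom j"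
      "\<forall>i\<in>{r_outer, r_inner, r_arcs, r_row, r_rest, r_reversed, r_matrix, r_zero}. s i = Atom 0"
    and shape: "length rws = N" "\<forall>rw\<in>set rws. length rw = N"
    and bounds: "sum_list (map count_cells rws) \<le> 3 * N" "j \<le> 3 * search_range N"
  defines "m \<equiv> block_size L N" and "u \<equiv> balance L N (sum_list (map count_cells rws)) j"
  obtains s' where "runs (Build L) s s' (build_cost L N)"
    "s' r_gadget = gadget_val m N (frac_val 10 1) (omega_val m u) (frac_val 1 (N + 1)) rws"
    "s' r_frozen1 = block_row m N [Atom 1, Atom 2, Atom 1, Atom 2] (Atom 2)"
    "s' r_frozen2 = block_row m N [Atom 2, Atom 1, Atom 2, Atom 1] (Atom 1)"
proof -
  define s_count where "s_count = s(r_arcs := Atom (sum_list (map count_cells rws)))"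
  define s_params where "s_params = s_count(r_m := Atom m, r_msq := Atom (m * m), r_n := Atom (4 * m + N),
    r_omega := omega_val m u, r_kappa := frac_val 1 (N + 1), r_beta := frac_val 10 1, r_one := Atom 1, r_two := Atom 2,
    r_field := Cell zero_val zero_val)"
  have count: "runs Count s s_count (count_cost N)"
    unfolding s_count_def using store shape by (intro runs_Count) auto
  have params: "runs (Assigns (params L)) s_count s_params (params_cost L N)"
    unfolding s_params_def m_def u_def using store bounds by (intro runs_params) (auto simp: s_count_def)
  have s_params: "s_params r_m = Atom m" "s_params r_N = Atom N" "s_params r_inner = Atom 0" "s_params r_zero = Atom 0"
      "s_params r_one = Atom 1" "s_params r_two = Atom 2" "s_params r_beta = frac_val 10 1" "s_params r_omega = omega_val m u"
      "s_params r_kappa = frac_val 1 (N + 1)"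
    using store by (simp_all add: s_params_def s_count_def)
  obtain s_layouts where layouts: "runs (Layouts gadget_layouts) s_params s_layouts (length gadget_layouts * layout_cost m N)"
    and written: "s_layouts r_row_S = block_row m N [Atom 0, frac_val 10 1, omega_val m u, Atom 0] (frac_val 1 (N + 1))"
      "s_layouts r_row_T = block_row m N [frac_val 10 1, Atom 0, Atom 0, Atom 0] (Atom 0)"
      "s_layouts r_row_A = block_row m N [omega_val m u, Atom 0, Atom 0, frac_val 10 1] (frac_val 1 (N + 1))"
      "s_layouts r_row_B = block_row m N [Atom 0, Atom 0, frac_val 10 1, Atom 0] (Atom 0)"
      "s_layouts r_frozen1 = block_row m N [Atom 1, Atom 2, Atom 1, Atom 2] (Atom 2)"
      "s_layouts r_frozen2 = block_row m N [Atom 2, Atom 1, Atom 2, Atom 1] (Atom 1)"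
    and unchanged: "\<And>i. i \<notin> {r_row_S, r_row_T, r_row_A, r_row_B, r_frozen1, r_frozen2} \<Longrightarrow> s_layouts i = s_params i"
    by (rule runs_gadget_layouts[OF s_params]) blast
  have s_layouts: "s_layouts r_N = Atom N" "s_layouts r_outer = Atom 0" "s_layouts r_inner = Atom 0" "s_layouts r_m = Atom m"
      "s_layouts r_row = Atom 0" "s_layouts r_reversed = Atom 0" "s_layouts r_matrix = Atom 0" "s_layouts r_zero = Atom 0"
      "s_layouts r_rows = enc_list (map enc_list rws)" "s_layouts r_n = Atom (4 * m + N)"
    using store by (simp_all add: unchanged s_params_def s_count_def)
  obtain s' where assemble: "runs Assemble s_layouts s' (assemble_cost m N)"
    and result: "s' r_gadget = Cell (Atom (4 * m + N))
        (Cell (enc_list (blocks m (map s_layouts [r_row_S, r_row_T, r_row_A, r_row_B])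
            (map (graph_row m (s_layouts r_kappa)) rws)))
          (enc_list (replicate (4 * m + N) (s_layouts r_field))))"
      "s' r_frozen1 = s_layouts r_frozen1" "s' r_frozen2 = s_layouts r_frozen2"
    using runs_Assemble[OF s_layouts shape(1)] .
  show ?thesis
  proof (rule that)
    show "runs (Build L) s s' (build_cost L N)"
      unfolding Build_def build_cost_def m_def[symmetric]
      by (rule runs_Seq[OF count runs_Seq[OF params runs_Seq[OF layouts assemble]]])
    show "s' r_gadget = gadget_val m N (frac_val 10 1) (omega_val m u) (frac_val 1 (N + 1)) rws"
      by (simp add: result written unchanged s_params_def gadget_val_def)
  qed (simp_all add: result written)
qed

lemma build_cost_mono: "N \<le> N' \<Longrightarrow> build_cost L N \<le> build_cost L N'"
  unfolding build_cost_def count_cost_def count_row_cost_def params_cost_def param_bound_def layout_cost_def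
    assemble_cost_def rows_cost_def repeat_cost_def block_size_def balance_bound_def Let_def
  by (intro add_le_mono mult_le_mono for_cost_mono power_mono order_refl) simp_all

section \<open>Encoding the gadget\<close>

definition entry_val :: "real \<Rightarrow> val" where
  "entry_val w = (if w = 0 then Atom 0 else enc_real w)"

definition coupling_rows :: "nat \<Rightarrow> (nat \<Rightarrow> nat \<Rightarrow> real) \<Rightarrow> val list list" where
  "coupling_rows n W = map (\<lambda>u. map (\<lambda>v. entry_val (W u v)) [0..<n]) [0..<n]"

lemma length_coupling_rows: "length (coupling_rows n W) = n" "\<forall>rw\<in>set (coupling_rows n W). length rw = n"
  by (auto simp: coupling_rows_def)

lemma enc_real_of_rat: "enc_real (of_rat q) = enc_rat q"
  by (simp add: enc_real_def)

lemma enc_real_zero: "enc_real 0 = zero_val"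
  using enc_real_of_rat[of 0] by (simp add: enc_rat_def zero_val_def)

lemma is_cell_entry_val: "is_cell (entry_val w) \<longleftrightarrow> w \<noteq> 0"
  by (simp add: entry_val_def enc_real_def enc_rat_def split: prod.split)

lemma entry_val_neg_frac:
  assumes "coprime p q" "p > 0" "q > 0"
  shows "entry_val (- (real p / real q)) = frac_val p q"
proof -
  have "- (real p / real q) = of_rat (Fract (- int p) (int q))"
    using assms(3) by (simp add: of_rat_rat)
  moreover have "quotient_of (Fract (- int p) (int q)) = (- int p, int q)"
    using assms by (simp add: quotient_of_Fract normalize_stable)
  ultimately have "enc_real (- (real p / real q)) = frac_val p q"
    using assms(2) by (simp add: enc_real_of_rat enc_rat_def frac_val_def)
  then show ?thesis
    using assms(2,3) by (simp add: entry_val_def)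
qed

lemma enc_rat_posE:
  assumes "q > 0"
  obtains a b :: nat where "a > 0" "b > 0" "enc_rat q = Cell (Cell (Atom 0) (Atom a)) (Atom b)"
    "real_of_rat q = real a / real b"
proof -
  obtain p d where quotient: "quotient_of q = (p, d)" by (cases "quotient_of q")
  have denom_pos: "d > 0" using quotient_of_denom_pos[OF quotient] .
  have q_eq: "q = of_int p / of_int d" using quotient_of_div[OF quotient] .
  with assms denom_pos have num_pos: "p > 0" by (simp add: zero_less_divide_iff)
  show ?thesis
  proof (rule that[of "nat p" "nat d"])
    show "enc_rat q = Cell (Cell (Atom 0) (Atom (nat p))) (Atom (nat d))"
      using num_pos by (simp add: enc_rat_def quotient)
    show "real_of_rat q = real (nat p) / real (nat d)"
      using num_pos denom_pos by (simp add: q_eq of_rat_divide)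
  qed (use num_pos denom_pos in auto)
qed

lemma enc_model_eq_coupling_rows:
  assumes "\<And>e. e \<in> edges M \<Longrightarrow> coupling M e \<noteq> 0"
  shows "enc_model M = Cell (Atom (nverts M)) (Cell (enc_list (map enc_list (coupling_rows (nverts M) (pair_coupling M))))
    (enc_list (map (\<lambda>v. Cell (enc_real (ext_field M v 1)) (enc_real (ext_field M v 2))) [0..<nverts M])))"
proof -
  have "(if {u, v} \<in> edges M then enc_real (coupling M {u, v}) else Atom 0) = entry_val (pair_coupling M u v)" for u v
    using assms by (simp add: entry_val_def pair_coupling_def)
  then show ?thesis
    by (simp add: enc_model_def coupling_rows_def Let_def o_def)
qed

lemma enc_model_model_of:
  assumes interaction: "interaction W"
  shows "enc_model (model_of n W)
    = Cell (Atom n) (Cell (enc_list (map enc_list (coupling_rows n W))) (enc_list (replicate n (Cell zero_val zero_val))))"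
proof -
  have "coupling_rows n (pair_coupling (model_of n W)) = coupling_rows n W"
    by (auto simp: coupling_rows_def pair_coupling_model_of[OF interaction])
  then show ?thesis
    by (subst enc_model_eq_coupling_rows) (auto elim: model_of_edgeE[OF interaction] simp: enc_real_zero map_replicate_const)
qed

lemma map_upt_const:
  assumes "\<And>u. a \<le> u \<Longrightarrow> u < b \<Longrightarrow> f u = v"
  shows "map f [a..<b] = replicate (b - a) v"
  using assms by (intro nth_equalityI) auto

lemma map_upt_blocks:
  assumes "\<And>a u. a < 4 \<Longrightarrow> u \<in> block m N a \<Longrightarrow> f u = h a"
  shows "map f [0..<4 * m + N] = blocks m [h 0, h 1, h 2, h 3] (map (\<lambda>i. f (4 * m + i)) [0..<N])"
proof -
  have split: "[i..<k] = [i..<j] @ [j..<k]" if "i \<le> j" "j \<le> k" for i j k :: nat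
    using upt_add_eq_append[of i j "k - j"] that by simp
  have "[0..<4 * m + N] = [0..<m] @ [m..<2 * m] @ [2 * m..<3 * m] @ [3 * m..<4 * m] @ [4 * m..<4 * m + N]"
    using split[of 0 m "4 * m + N"] split[of m "2 * m" "4 * m + N"]
      split[of "2 * m" "3 * m" "4 * m + N"] split[of "3 * m" "4 * m" "4 * m + N"] by simp
  moreover have "map f [4 * m..<4 * m + N] = map (\<lambda>i. f (4 * m + i)) [0..<N]"
    by (intro nth_equalityI) auto
  moreover have "map f [0..<m] = replicate (m - 0) (h 0)" "map f [m..<2 * m] = replicate (2 * m - m) (h 1)"
      "map f [2 * m..<3 * m] = replicate (3 * m - 2 * m) (h 2)" "map f [3 * m..<4 * m] = replicate (4 * m - 3 * m) (h 3)"
    by (intro map_upt_const assms; simp add: block_def)+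
  ultimately show ?thesis by simp
qed

lemma enc_block_row:
  assumes "a < 4" "u \<in> block m N a"
  shows "enc_list (map (\<lambda>v. entry_val (block_coupling m g J u v)) [0..<4 * m + N])
    = block_row m N (map (\<lambda>b. entry_val (J a b)) [0, 1, 2, 3]) (entry_val (J a 4))"
proof -
  have "map (\<lambda>v. entry_val (block_coupling m g J u v)) [0..<4 * m + N]
      = blocks m [entry_val (J a 0), entry_val (J a 1), entry_val (J a 2), entry_val (J a 3)]
          (map (\<lambda>i. entry_val (block_coupling m g J u (4 * m + i))) [0..<N])"
    using assms by (intro map_upt_blocks) (simp add: block_coupling_block)
  also have "map (\<lambda>i. entry_val (block_coupling m g J u (4 * m + i))) [0..<N] = replicate N (entry_val (J a 4))"
    using map_upt_const[of 0 N "\<lambda>i. entry_val (block_coupling m g J u (4 * m + i))" "entry_val (J a 4)"]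
      block_coupling_block[OF assms(2), of _ 4] assms(1) by (simp add: block_def)
  finally show ?thesis by (simp add: block_row_def)
qed

lemma enc_graph_row:
  assumes "i < N" "J 4 0 = J 4 2" "J 4 1 = 0" "J 4 3 = 0"
  shows "enc_list (map (\<lambda>v. entry_val (block_coupling m g J (4 * m + i) v)) [0..<4 * m + N])
    = graph_row m (entry_val (J 4 2)) (map (\<lambda>j. entry_val (g i j)) [0..<N])"
proof -
  have last_block: "4 * m + i \<in> block m N 4"
    using assms(1) by (simp add: block_def)
  have "map (\<lambda>v. entry_val (block_coupling m g J (4 * m + i) v)) [0..<4 * m + N]
      = blocks m [entry_val (J 4 0), entry_val (J 4 1), entry_val (J 4 2), entry_val (J 4 3)]
          (map (\<lambda>j. entry_val (block_coupling m g J (4 * m + i) (4 * m + j))) [0..<N])"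
    by (intro map_upt_blocks) (simp add: block_coupling_block[OF last_block])
  then show ?thesis
    by (simp add: graph_row_def block_coupling_def assms(2-4) assms(3)[unfolded One_nat_def] entry_val_def[of 0])
qed

lemma enc_model_gadget:
  assumes interaction: "interaction g"
  shows "enc_model (gadget m N g \<beta> \<omega> \<kappa>)
    = gadget_val m N (entry_val (- \<beta>)) (entry_val (- \<omega>)) (entry_val (- \<kappa>)) (coupling_rows N g)"
proof -
  let ?J = "gadget_table \<beta> \<omega> \<kappa>"
  let ?W = "block_coupling m g ?J"
  let ?row = "\<lambda>u. enc_list (map (\<lambda>v. entry_val (?W u v)) [0..<4 * m + N])"
  let ?block = "\<lambda>a. block_row m N (map (\<lambda>b. entry_val (?J a b)) [0, 1, 2, 3]) (entry_val (?J a 4))"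
  have "map ?row [0..<4 * m + N] = blocks m [?block 0, ?block 1, ?block 2, ?block 3] (map (\<lambda>i. ?row (4 * m + i)) [0..<N])"
    by (rule map_upt_blocks) (rule enc_block_row)
  also have "map (\<lambda>i. ?row (4 * m + i)) [0..<N]
      = map (\<lambda>i. graph_row m (entry_val (?J 4 2)) (map (\<lambda>j. entry_val (g i j)) [0..<N])) [0..<N]"
    by (intro map_cong refl enc_graph_row) (auto simp: gadget_table_def doubleton_eq_iff)
  also have "\<dots> = map (graph_row m (entry_val (- \<kappa>))) (coupling_rows N g)"
    by (simp add: coupling_rows_def gadget_table_def doubleton_eq_iff)
  finally have "map enc_list (coupling_rows (4 * m + N) ?W)
      = blocks m [?block 0, ?block 1, ?block 2, ?block 3] (map (graph_row m (entry_val (- \<kappa>))) (coupling_rows N g))"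
    by (simp add: coupling_rows_def[of "4 * m + N"] o_def)
  then show ?thesis
    unfolding gadget_def enc_model_model_of[OF interaction_block_coupling[OF interaction interaction_gadget_table]] gadget_val_def
    by (simp add: gadget_table_def doubleton_eq_iff entry_val_def[of 0])
qed

lemma enc_frozen_config:
  "enc_config (4 * m + N) (frozen_config m N c) = block_row m N [Atom c, Atom (3 - c), Atom c, Atom (3 - c)] (Atom (3 - c))"
proof -
  let ?\<sigma> = "frozen_config m N c"
  have "map (\<lambda>v. Atom (?\<sigma> v)) [0..<4 * m + N]
      = blocks m [Atom ([c, 3 - c, c, 3 - c] ! 0), Atom ([c, 3 - c, c, 3 - c] ! 1), Atom ([c, 3 - c, c, 3 - c] ! 2),
          Atom ([c, 3 - c, c, 3 - c] ! 3)] (map (\<lambda>i. Atom (?\<sigma> (4 * m + i))) [0..<N])"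
    by (rule map_upt_blocks) (simp add: frozen_config_def locked_config_block)
  also have "map (\<lambda>i. Atom (?\<sigma> (4 * m + i))) [0..<N] = replicate N (Atom (3 - c))"
    using map_upt_const[of 0 N "\<lambda>i. Atom (?\<sigma> (4 * m + i))"] by (simp add: frozen_config_def locked_config_last)
  finally show ?thesis by (simp add: enc_config_def block_row_def)
qed

lemma vsize_enc_list_le:
  assumes "\<forall>v\<in>set vs. vsize v \<le> c"
  shows "vsize (enc_list vs) \<le> 1 + length vs * (1 + c)"
  using assms by (induction vs) (auto simp: floorlog_def)

lemma vsize_enc_blocks_le:
  assumes "length vs = 4" "length ws = N" "\<forall>v\<in>set vs \<union> set ws. vsize v \<le> c"
  shows "vsize (enc_list (blocks m vs ws)) \<le> 1 + (4 * m + N) * (1 + c)"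
proof -
  have "\<forall>v\<in>set (blocks m vs ws). vsize v \<le> c"
    using assms(3) set_blocks_subset[of m vs ws] by blast
  from vsize_enc_list_le[OF this] show ?thesis
    by (simp only: length_blocks assms(1,2))
qed

lemma vsize_block_row_le:
  assumes "length vs = 4" "\<forall>v\<in>set vs. vsize v \<le> c" "vsize w \<le> c"
  shows "vsize (block_row m N vs w) \<le> 1 + (4 * m + N) * (1 + c)"
  unfolding block_row_def using assms by (intro vsize_enc_blocks_le) auto

lemma vsize_graph_row_le:
  assumes "length rw = N" "vsize (Atom 0) \<le> c" "vsize kv \<le> c" "\<forall>v\<in>set rw. vsize v \<le> c"
  shows "vsize (graph_row m kv rw) \<le> 1 + (4 * m + N) * (1 + c)"
  unfolding graph_row_def using assms by (intro vsize_enc_blocks_le) auto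

definition gadget_val_bound :: "nat \<Rightarrow> nat \<Rightarrow> nat" where
  "gadget_val_bound n c = 4 + n + n * (1 + (1 + n * (1 + c))) + n * (1 + c) + 1"

lemma vsize_gadget_val_le:
  assumes entries: "vsize (Atom 0) \<le> c" "vsize bv \<le> c" "vsize wv \<le> c" "vsize kv \<le> c" "vsize (Cell zero_val zero_val) \<le> c"
    and rows: "length rws = N" "\<forall>rw\<in>set rws. length rw = N \<and> (\<forall>v\<in>set rw. vsize v \<le> c)"
  shows "vsize (gadget_val m N bv wv kv rws) \<le> gadget_val_bound (4 * m + N) c"
proof -
  let ?n = "4 * m + N"
  let ?blocks = "[block_row m N [Atom 0, bv, wv, Atom 0] kv, block_row m N [bv, Atom 0, Atom 0, Atom 0] (Atom 0),
    block_row m N [wv, Atom 0, Atom 0, bv] kv, block_row m N [Atom 0, Atom 0, bv, Atom 0] (Atom 0)]"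
  define R where "R = 1 + ?n * (1 + c)"
  note row_le = vsize_block_row_le[where m = m and N = N and c = c, folded R_def]
    vsize_graph_row_le[where m = m and N = N and c = c, folded R_def]
  have "\<forall>v\<in>set ?blocks. vsize v \<le> R"
    using entries by (auto intro!: row_le(1) simp del: vsize.simps)
  moreover have "\<forall>v\<in>set (map (graph_row m kv) rws). vsize v \<le> R"
    using entries rows(2) by (auto intro!: row_le(2) simp del: vsize.simps)
  ultimately have "\<forall>v\<in>set ?blocks \<union> set (map (graph_row m kv) rws). vsize v \<le> R"
    by blast
  then have "vsize (enc_list (blocks m ?blocks (map (graph_row m kv) rws))) \<le> 1 + ?n * (1 + (1 + ?n * (1 + c)))"
    unfolding R_def by (rule vsize_enc_blocks_le[rotated 2]) (simp_all add: rows(1))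
  moreover have "vsize (enc_list (replicate ?n (Cell zero_val zero_val))) \<le> 1 + ?n * (1 + c)"
    using vsize_enc_list_le[of "replicate ?n (Cell zero_val zero_val)" c] entries(5) by (simp only: length_replicate) simp
  ultimately show ?thesis
    using floorlog_le[of ?n] unfolding gadget_val_def gadget_val_bound_def vsize.simps by linarith
qed

lemma vsize_frac_val: "vsize (frac_val p q) \<le> 6 + p + q"
  using floorlog_le[of p] floorlog_le[of q] floorlog_le[of 1] by (simp add: frac_val_def)

context cubic_instance
begin

lemma enc_model_G: "\<exists>flds. enc_model G = Cell (Atom N) (Cell (enc_list (map enc_list (coupling_rows N g))) flds)"
  using enc_model_eq_coupling_rows[of G] by (simp add: G_simps(2,3) g_def)

lemma sum_count_coupling_rows: "sum_list (map count_cells (coupling_rows N g)) = arcs"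
proof -
  have "count_cells (map (\<lambda>v. entry_val (g u v)) [0..<N]) = (\<Sum>v<N. of_bool ({u, v} \<in> edges G))" for u
  proof -
    have "count_cells (map (\<lambda>v. entry_val (g u v)) [0..<N]) = card {v \<in> {..<N}. {u, v} \<in> edges G}"
      by (simp add: count_cells_def length_filter_conv_card is_cell_entry_val g_eq cong: conj_cong)
    then show ?thesis by (simp add: Int_def)
  qed
  then show ?thesis
    by (simp add: coupling_rows_def arcs_def o_def interv_sum_list_conv_sum_set_nat atLeast0LessThan)
qed

lemma vsize_coupling_rows:
  assumes "rw \<in> set (coupling_rows N g)" "v \<in> set rw"
  shows "vsize v \<le> 14"
proof -
  obtain a b where v_eq: "v = entry_val (g a b)"
    using assms by (auto simp: coupling_rows_def)
  have "- 6 / 10 = - (real 3 / real 5)" by simp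
  then have "entry_val (- 6 / 10) = frac_val 3 5"
    using entry_val_neg_frac[of 3 5] by (simp add: coprime_iff_gcd_eq_1 gcd_non_0_nat)
  then show ?thesis
    using vsize_frac_val[of 3 5] by (auto simp: v_eq g_eq entry_val_def[of 0] floorlog_def)
qed

end

definition model_size_bound :: "nat \<Rightarrow> nat \<Rightarrow> nat" where
  "model_size_bound L N = (let m = block_size L N in
     gadget_val_bound (4 * m + N) (60 + (m * m * balance_bound L N + m * m * (m * m)) + N))"

lemma model_size_bound_mono: "N \<le> N' \<Longrightarrow> model_size_bound L N \<le> model_size_bound L N'"
  unfolding model_size_bound_def gadget_val_bound_def balance_bound_def block_size_def Let_def
  by (intro add_le_mono mult_le_mono power_mono order_refl) simp_all

context tuned_gadget
begin

lemma entry_val_omega: "entry_val (- \<omega>) = omega_val m u"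
proof -
  have "coprime (m * m * u + 1) (m * m)"
  proof (rule coprimeI)
    fix d assume dvd: "d dvd m * m * u + 1" "d dvd m * m"
    have "d dvd m * m * u" by (rule dvd_mult2[OF dvd(2)])
    with dvd(1) show "is_unit d" using dvd_add_right_iff by blast
  qed
  then have "coprime (m * m * u + 1) (m * m * (m * m))"
    by (simp only: coprime_mult_right_iff)
  then have "entry_val (- (real (m * m * u + 1) / real (m * m * (m * m)))) = omega_val m u"
    unfolding omega_val_def using m_pos by (intro entry_val_neg_frac) auto
  moreover have "\<omega> = real (m * m * u + 1) / real (m * m * (m * m))"
    by (simp add: \<omega>_def power2_eq_square add.commute)
  ultimately show ?thesis by (simp only:)
qed

lemma enc_model_M:
  "enc_model M = gadget_val m N (frac_val 10 1) (omega_val m u) (frac_val 1 (N + 1)) (coupling_rows N g)"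
proof -
  have "entry_val (- 10) = frac_val 10 1"
    using entry_val_neg_frac[of 10 1] by simp
  moreover have "entry_val (- \<kappa>) = frac_val 1 (N + 1)"
    using entry_val_neg_frac[of 1 "N + 1"] by (simp add: \<kappa>_def add.commute)
  ultimately show ?thesis
    unfolding M_def enc_model_gadget[OF interaction_g] by (simp only: entry_val_omega)
qed

lemma vsize_enc_model_M: "vsize (enc_model M) \<le> model_size_bound L N"
  unfolding enc_model_M model_size_bound_def Let_def
proof (rule vsize_gadget_val_le)
  let ?c = "60 + (m * m * balance_bound L N + m * m * (m * m)) + N"
  show "vsize (frac_val 10 1) \<le> ?c" "vsize (frac_val 1 (N + 1)) \<le> ?c"
    using vsize_frac_val[of 10 1] vsize_frac_val[of 1 "N + 1"] by linarith+
  show "vsize (omega_val m u) \<le> ?c"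
    using vsize_frac_val[of "m * m * u + 1" "m * m * (m * m)"] mult_le_mono2[OF u_le_bound, of "m * m"]
    unfolding omega_val_def by linarith
  show "vsize (Atom 0) \<le> ?c" "vsize (Cell zero_val zero_val) \<le> ?c"
    using floorlog_le[of 0] floorlog_le[of 1] by (simp_all add: zero_val_def)
  show "\<forall>rw\<in>set (coupling_rows N g). length rw = N \<and> (\<forall>v\<in>set rw. vsize v \<le> ?c)"
    using length_coupling_rows(2) vsize_coupling_rows by fastforce
qed (rule length_coupling_rows)

end

section \<open>Correctness of the search\<close>

lemma search_steps_spec:
  fixes Q P M :: nat
  defines "J \<equiv> search_steps Q P M"
  shows "(J i < i \<longrightarrow> P * M ^ J i \<le> Q * (M + 1) ^ J i) \<and>
    (J i > 0 \<longrightarrow> Q * (M + 1) ^ (J i - 1) < P * M ^ (J i - 1))"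
proof (induction i)
  case (Suc i)
  have "J i \<le> i" unfolding J_def by (rule search_steps_le)
  moreover have "J (Suc i) = (if Q * (M + 1) ^ J i < P * M ^ J i then J i + 1 else J i)"
    by (simp add: J_def Let_def)
  ultimately show ?case using Suc by auto
qed (simp add: J_def)

definition log_step :: "nat \<Rightarrow> real" where
  "log_step M = ln (1 + 1 / real M)"

lemma ln_Suc_eq_log_step: "M > 0 \<Longrightarrow> ln (real (M + 1)) = log_step M + ln (real M)"
proof -
  assume "M > 0"
  moreover from this have "real (M + 1) = (1 + 1 / real M) * real M"
    by (simp add: field_simps)
  ultimately show ?thesis
    unfolding log_step_def by (simp only: ln_mult_pos add_pos_pos zero_less_one divide_pos_pos of_nat_0_less_iff)
qed

lemma log_step_le: "log_step M \<le> 1 / real M"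
  unfolding log_step_def by (rule ln_add_one_self_le_self) simp

lemma log_step_ge:
  assumes "M > 0"
  shows "log_step M \<ge> 1 / (real M + 1)"
proof -
  have "ln (real M / (real M + 1)) \<le> real M / (real M + 1) - 1"
    using assms by (intro ln_le_minus_one) auto
  moreover have "ln (real M / (real M + 1)) = - log_step M"
    using ln_Suc_eq_log_step[OF assms] assms by (simp add: ln_div add.commute)
  ultimately show ?thesis
    by (simp add: field_simps)
qed

lemma ln_2_le_mult_log_step:
  assumes "M > 0"
  shows "ln 2 \<le> real M * log_step M"
proof -
  have "2 = 1 + real M * (1 / real M)" using assms by simp
  also have "\<dots> \<le> (1 + 1 / real M) ^ M"
    by (rule Bernoulli_inequality) (use assms in \<open>auto intro: order_trans[of _ 0]\<close>)
  finally have "ln 2 \<le> ln ((1 + 1 / real M) ^ M)"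
    by (subst ln_le_cancel_iff) (use assms in \<open>auto intro: add_pos_nonneg\<close>)
  then show ?thesis
    by (simp add: ln_realpow log_step_def add_pos_nonneg)
qed

lemma power_le_iff_ln_le:
  fixes a b M i j :: nat
  assumes pos: "a > 0" "b > 0" "M > 0"
  shows "a * M ^ i * (M + 1) ^ j \<le> b * (M + 1) ^ i * M ^ j \<longleftrightarrow> ln (real a / real b) \<le> (real i - real j) * log_step M"
proof -
  have ln_prod: "ln (real (x * p ^ i * q ^ j)) = ln (real x) + real i * ln (real p) + real j * ln (real q)"
    if "x > 0" "p > 0" "q > 0" for x p q :: nat
    using that by (simp add: ln_mult ln_realpow)
  have "a * M ^ i * (M + 1) ^ j \<le> b * (M + 1) ^ i * M ^ j
      \<longleftrightarrow> ln (real (a * M ^ i * (M + 1) ^ j)) \<le> ln (real (b * (M + 1) ^ i * M ^ j))"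
    using pos by (subst ln_le_cancel_iff) (simp_all only: of_nat_0_less_iff of_nat_le_iff nat_0_less_mult_iff zero_less_power
        add_pos_pos zero_less_one)
  also have "\<dots> \<longleftrightarrow> ln (real a / real b) \<le> (real i - real j) * log_step M"
    using pos ln_Suc_eq_log_step[OF pos(3)]
    by (subst (1 2) ln_prod) (simp_all add: ln_div algebra_simps)
  finally show ?thesis .
qed

context
  fixes a b N :: nat
  assumes pos: "a > 0" "b > 0"
begin

private abbreviation (input) K :: nat where "K \<equiv> search_range N"
private abbreviation (input) J :: nat where "J \<equiv> search_result a b N"
private abbreviation (input) l :: real where "l \<equiv> ln (real a / real b)"
private abbreviation (input) z :: real where "z \<equiv> log_step (N + 1)"

private lemma search_order_iff:
  "search_lhs a N * (N + 2) ^ j \<le> search_rhs b N * (N + 1) ^ j \<longleftrightarrow> l \<le> (real K - real j) * z"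
  "search_rhs b N * (N + 1) ^ j \<le> search_lhs a N * (N + 2) ^ j \<longleftrightarrow> (real K - real j) * z \<le> l"
proof -
  have base: "N + 1 + 1 = N + 2" "N + 1 > 0" by simp_all
  show "search_lhs a N * (N + 2) ^ j \<le> search_rhs b N * (N + 1) ^ j \<longleftrightarrow> l \<le> (real K - real j) * z"
    using power_le_iff_ln_le[OF pos base(2), of K j] unfolding base(1) search_lhs_def search_rhs_def .
  have "l = - ln (real b / real a)"
    using pos by (simp add: ln_div)
  then show "search_rhs b N * (N + 1) ^ j \<le> search_lhs a N * (N + 2) ^ j \<longleftrightarrow> (real K - real j) * z \<le> l"
    using power_le_iff_ln_le[OF pos(2,1) base(2), of j K] unfolding base(1) search_lhs_def search_rhs_def
    by (simp add: ac_simps algebra_simps)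
qed

private lemma N_ln_2_le: "real N * ln 2 \<le> real K * z"
proof -
  have "real N * ln 2 \<le> real N * (real (N + 1) * z)"
    by (intro mult_left_mono ln_2_le_mult_log_step) simp_all
  then show ?thesis by (simp add: search_range_def algebra_simps)
qed

lemma search_too_high:
  assumes "search_rhs b N < search_lhs a N"
  shows "2 ^ N < real a / real b"
proof -
  have "real K * z < l"
    using assms search_order_iff(1)[of 0] by simp
  then have "ln (2 ^ N) < l"
    using N_ln_2_le by (simp add: ln_realpow)
  then show ?thesis
    using pos by (subst (asm) ln_less_cancel_iff) simp_all
qed

lemma search_too_low:
  assumes "search_lhs a N * (N + 2) ^ J < search_rhs b N * (N + 1) ^ J"
  shows "real a / real b < exp (- real N)"
proof -
  have "\<not> J < 3 * K"
    using assms search_steps_spec[of "search_lhs a N" "search_rhs b N" "N + 1" "3 * K"]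
    by (auto simp: search_result_def)
  with search_result_le[of a b N] have exhausted: "J = 3 * K" by linarith
  have "l < (real K - real J) * z"
    using assms search_order_iff(2)[of J] by linarith
  also have "\<dots> = - 2 * (real K * z)"
    by (simp add: exhausted algebra_simps)
  also have "\<dots> \<le> - 2 * (real N * (2 / 3))"
    using N_ln_2_le mult_left_mono[OF ln2_ge_two_thirds, of "real N"] by linarith
  also have "\<dots> \<le> - real N"
    by simp
  finally have "exp l < exp (- real N)"
    by (simp only: exp_less_cancel_iff)
  then show ?thesis
    using pos by simp
qed

private lemma search_result_brackets:
  assumes "search_lhs a N \<le> search_rhs b N" "search_rhs b N * (N + 1) ^ J \<le> search_lhs a N * (N + 2) ^ J"
  shows "(real K - real J) * z \<le> l" "l \<le> (real K - real J) * z + z"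
proof -
  show "(real K - real J) * z \<le> l"
    using assms(2) search_order_iff(2) by blast
  show "l \<le> (real K - real J) * z + z"
  proof (cases "J > 0")
    case True
    then have "search_lhs a N * (N + 2) ^ (J - 1) < search_rhs b N * (N + 1) ^ (J - 1)"
      using search_steps_spec[of "search_lhs a N" "search_rhs b N" "N + 1" "3 * K"] by (simp add: search_result_def)
    then have "l \<le> (real K - real (J - 1)) * z"
      using search_order_iff(1)[of "J - 1"] by linarith
    then show ?thesis
      using True by (simp add: of_nat_diff algebra_simps)
  next
    case False
    moreover have "0 \<le> z"
      using order_trans[OF _ log_step_ge[of "N + 1"], of 0] by simp
    ultimately show ?thesis
      using assms(1) search_order_iff(1)[of 0] by simp
  qed
qed

private lemma log_step_error_le: "real K * (1 / real (N + 1) - z) \<le> 1"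
proof -
  have "1 / real (N + 1) - z \<le> 1 / real (N + 1) - 1 / (real (N + 1) + 1)"
    using log_step_ge[of "N + 1"] by simp
  also have "\<dots> = 1 / (real (N + 1) * (real N + 2))"
    by (simp add: field_simps)
  finally have "real K * (1 / real (N + 1) - z) \<le> real K * (1 / (real (N + 1) * (real N + 2)))"
    by (rule mult_left_mono) simp
  also have "\<dots> = real N / (real N + 2)"
    by (simp add: search_range_def divide_simps) (simp add: algebra_simps)
  also have "\<dots> \<le> 1"
    by simp
  finally show ?thesis .
qed

text \<open>Since \<open>1 / (N + 2) \<le> z \<le> 1 / (N + 1)\<close>, replacing \<open>z\<close> by \<open>1 / (N + 1)\<close> in \<open>(K - J) z \<approx> l\<close> is harmless.\<close>

lemma search_result_approximates_ln:
  assumes "search_lhs a N \<le> search_rhs b N" "search_rhs b N * (N + 1) ^ J \<le> search_lhs a N * (N + 2) ^ J"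
  shows "\<bar>real N - real J / real (N + 1) - l\<bar> \<le> 3"
proof -
  define e where "e = 1 / real (N + 1) - z"
  have e_nonneg: "0 \<le> e"
    using log_step_le[of "N + 1"] by (simp add: e_def)
  have "\<bar>real K - real J\<bar> \<le> 2 * real K"
    using search_result_le[of a b N] by (simp add: abs_le_iff)
  then have "\<bar>real K - real J\<bar> * e \<le> 2 * real K * e"
    using e_nonneg by (rule mult_right_mono)
  then have "\<bar>(real K - real J) * e\<bar> \<le> 2"
    using e_nonneg log_step_error_le[folded e_def] by (simp add: abs_mult)
  moreover have "real N - real J / real (N + 1) = (real K - real J) * z + (real K - real J) * e"
    unfolding distrib_left[symmetric] by (simp add: e_def search_range_def field_simps)
  moreover have "z \<le> 1"
    using order_trans[OF log_step_le[of "N + 1"], of 1] by simp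
  ultimately show ?thesis
    using search_result_brackets[OF assms] by linarith
qed

end

lemma nat_div_bounds: "real (x div y) \<le> real x / real y" "real x / real y \<le> real (x div y) + 1"
  using floor_correct[of "real x / real y"] by (simp_all add: floor_divide_of_nat_eq)

lemma balance_tuned:
  fixes L N arcs j :: nat and D Zh :: real
  assumes approx: "\<bar>real N - real j / real (N + 1) - ln Zh\<bar> \<le> 3" and arcs_le: "arcs \<le> 3 * N" and L_ge_4: "L \<ge> 4"
    and D_ge_1: "D \<ge> 1"
  shows "\<bar>pinning L N * real N - real (balance L N arcs j) - 1 / D - 3 / 10 * real arcs - ln Zh\<bar> \<le> 5"
proof -
  have "N + 3 * arcs div 10 \<le> 4 * N" using arcs_le by linarith
  also have "\<dots> \<le> L * (N * (N + 1))" using L_ge_4 by (intro mult_le_mono) auto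
  finally have "real (balance L N arcs j) = real (L * (N * (N + 1))) - real N - real (3 * arcs div 10) + real (j div (N + 1))"
    unfolding balance_def by linarith
  moreover have "real (L * (N * (N + 1))) = pinning L N * real N" by (simp add: pinning_def algebra_simps)
  moreover have "0 \<le> 1 / D" "1 / D \<le> 1" using D_ge_1 by simp_all
  moreover have "real (3 * arcs) / real 10 = 3 / 10 * real arcs" by simp
  ultimately show ?thesis
    using nat_div_bounds[of "3 * arcs" 10] nat_div_bounds[of j "N + 1"] approx unfolding abs_le_iff by linarith
qed

section \<open>Polynomial bounds\<close>

definition poly_bounded :: "(nat \<Rightarrow> nat) \<Rightarrow> bool" where
  "poly_bounded f \<longleftrightarrow> (\<exists>p :: nat poly. \<forall>x. f x \<le> poly p x)"

lemma poly_nat_mono: "x \<le> y \<Longrightarrow> poly p x \<le> poly p (y :: nat)"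
  by (induction p) (auto intro: add_mono mult_mono)

lemma poly_bounded_const: "poly_bounded (\<lambda>_. c)"
  unfolding poly_bounded_def by (rule exI[of _ "[:c:]"]) simp

lemma poly_bounded_id: "poly_bounded (\<lambda>x. x)"
  unfolding poly_bounded_def by (rule exI[of _ "[:0, 1:]"]) simp

lemma poly_bounded_add: "poly_bounded f \<Longrightarrow> poly_bounded g \<Longrightarrow> poly_bounded (\<lambda>x. f x + g x)"
  unfolding poly_bounded_def by (metis add_mono poly_add)

lemma poly_bounded_mult: "poly_bounded f \<Longrightarrow> poly_bounded g \<Longrightarrow> poly_bounded (\<lambda>x. f x * g x)"
  unfolding poly_bounded_def by (metis mult_le_mono poly_mult)

lemma poly_bounded_poly: "poly_bounded f \<Longrightarrow> poly_bounded (\<lambda>x. poly p (f x))"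
  unfolding poly_bounded_def by (metis poly_nat_mono poly_pcompose)

lemmas poly_bounded_intros = poly_bounded_const poly_bounded_id poly_bounded_add poly_bounded_mult poly_bounded_poly

lemma poly_mult_exp_tendsto_0:
  fixes q :: "nat poly"
  shows "(\<lambda>x. real (poly q x) * exp (- real x)) \<longlonglongrightarrow> 0"
proof -
  have "(\<lambda>x. real x ^ k * real (poly q x) * exp (- real x)) \<longlonglongrightarrow> 0" for k
  proof (induction q arbitrary: k)
    case (pCons c q)
    have "(\<lambda>x. real c * (real x ^ k / exp (real x)) + real x ^ Suc k * real (poly q x) * exp (- real x)) \<longlonglongrightarrow> real c * 0 + 0"
      by (intro tendsto_intros pCons.IH filterlim_compose[OF tendsto_power_div_exp_0 filterlim_real_sequentially])
    then show ?case
      by (simp add: algebra_simps exp_minus divide_inverse)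
  qed simp
  from this[of 0] show ?thesis by simp
qed

section \<open>The reduction\<close>

definition Sampler :: com where
  "Sampler = Seq (Flip r_io) (If (Reg r_io) (Assign r_io (Reg r_frozen1)) (Assign r_io (Reg r_frozen2)))"

definition Answer :: com where
  "Answer = Seq (Call r_gadget Sampler r_answer) (If (Reg r_answer) (Assign r_io (num 0)) (Assign r_io (num 1)))"

definition Decide :: "nat \<Rightarrow> com" where
  "Decide L = If (Reg r_high) (Assign r_io (num 0))
     (If (Arith Less (Reg r_lhs) (Reg r_rhs)) (Assign r_io (num 1)) (Seq (Build L) Answer))"

definition Reduce :: "nat \<Rightarrow> com" where
  "Reduce L = Seq Prepare (Decide L)"

lemma exec_Sampler:
  "map_spmf (\<lambda>(s', t', k'). (s' 0, t')) (exec smp sub Sampler (s, 0, 0)) = coin_source (s r_frozen1) (s r_frozen2) 5"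
proof -
  have "exec smp sub (If (Reg r_io) (Assign r_io (Reg r_frozen1)) (Assign r_io (Reg r_frozen2)))
        (s(r_io := Atom (of_bool b)), 1, 0)
      = return_spmf (s(r_io := if b then s r_frozen1 else s r_frozen2), 5, 0)" for b
    by (cases b) (auto simp: truthy_def)
  then show ?thesis
    by (simp add: Sampler_def coin_source_def map_spmf_conv_bind_spmf o_def del: exec.simps(4))
qed

lemma exec_Answer:
  assumes "s r_gadget \<in> Q"
  shows "exec smp (subroutine_on Q A) Answer (s, t, k) = map_spmf (\<lambda>(v, t', k').
    (s(r_answer := v, r_io := if truthy v then Atom 0 else Atom 1), t + t' + 5, k))
    (run (coin_source (s r_frozen1) (s r_frozen2) 5) no_subroutine A (s r_gadget))"
proof -
  have "exec smp (subroutine_on Q A) (If (Reg r_answer) (Assign r_io (num 0)) (Assign r_io (num 1))) (s(r_answer := v), t\<^sub>0, k)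
      = return_spmf (s(r_answer := v, r_io := if truthy v then Atom 0 else Atom 1), t\<^sub>0 + 4, k)" for v t\<^sub>0
    by (cases "truthy v") auto
  then show ?thesis
    using assms exec_Sampler[of smp "subroutine_on Q A" s]
    by (simp add: Answer_def subroutine_on_def map_spmf_conv_bind_spmf o_def case_prod_beta
        del: exec.simps(4)) (simp add: ac_simps)
qed

lemma exec_If_False:
  "\<not> truthy (expr_val e s) \<Longrightarrow> exec smp sub (If e c d) (s, t, k) = exec smp sub d (s, t + 1 + expr_cost e s, k)"
  by simp

lemma exec_Reduce_eq_Answer:
  assumes prepare: "runs Prepare s\<^sub>0 s T" and build: "runs (Build L) s s' T'"
    and continue: "\<not> truthy (expr_val (Reg r_high) s)" "\<not> truthy (expr_val (Arith Less (Reg r_lhs) (Reg r_rhs)) s)"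
  obtains t where "t \<le> T + expr_cost (Arith Less (Reg r_lhs) (Reg r_rhs)) s + T' + 4"
    "exec smp sub (Reduce L) (s\<^sub>0, 0, 0) = exec smp sub Answer (s', t, 0)"
proof -
  obtain t where prepare_eq: "t \<le> T"
    "\<And>smp sub t\<^sub>0 k d. exec smp sub (Seq Prepare d) (s\<^sub>0, t\<^sub>0, k) = exec smp sub d (s, t\<^sub>0 + t, k)"
    by (rule exec_Seq_runs[OF prepare]) blast
  obtain t' where build_eq: "t' \<le> T'"
    "\<And>smp sub t\<^sub>0 k d. exec smp sub (Seq (Build L) d) (s, t\<^sub>0, k) = exec smp sub d (s', t\<^sub>0 + t', k)"
    by (rule exec_Seq_runs[OF build]) blast
  let ?less = "Arith Less (Reg r_lhs) (Reg r_rhs)"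
  have "exec smp sub (Reduce L) (s\<^sub>0, 0, 0)
      = exec smp sub Answer (s', 0 + t + 1 + expr_cost (Reg r_high) s + 1 + expr_cost ?less s + t', 0)"
    unfolding Reduce_def prepare_eq(2) Decide_def exec_If_False[OF continue(1)] exec_If_False[OF continue(2)] build_eq(2) ..
  then show ?thesis
    by (rule that[rotated]) (use prepare_eq(1) build_eq(1) in simp)
qed

definition decides :: "real \<Rightarrow> real \<Rightarrow> real \<Rightarrow> nat \<Rightarrow> (val \<times> nat \<times> nat) spmf \<Rightarrow> bool" where
  "decides Z Zhat r T res \<longleftrightarrow> lossless_spmf res \<and> (\<forall>(v, t, k)\<in>set_spmf res. t \<le> T) \<and>
     (Z \<le> Zhat / r \<longrightarrow> prob_reject res \<ge> 5 / 8) \<and> (Z \<ge> r * Zhat \<longrightarrow> prob_accept res \<ge> 5 / 8)"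

lemma decides_mono: "decides Z Zhat r T res \<Longrightarrow> T \<le> T' \<Longrightarrow> decides Z Zhat r T' res"
  unfolding decides_def by (fastforce intro: order_trans)

lemma decides_return:
  assumes "t \<le> T" and "v = Atom 0 \<and> \<not> Z \<ge> r * Zhat \<or> v = Atom 1 \<and> \<not> Z \<le> Zhat / r"
  shows "decides Z Zhat r T (return_spmf (v, t, k))"
  using assms
  by (auto simp: decides_def prob_accept_def prob_reject_def measure_spmf_return_spmf measure_return indicator_def)

lemma decides_negate:
  assumes "lossless_spmf p" "\<And>v t k. (v, t, k) \<in> set_spmf p \<Longrightarrow> t \<le> T"
    and "Z \<le> Zhat / r \<Longrightarrow> prob_accept p \<ge> 5 / 8" "Z \<ge> r * Zhat \<Longrightarrow> prob_reject p \<ge> 5 / 8"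
  shows "decides Z Zhat r (T\<^sub>0 + T) (map_spmf (\<lambda>(v, t, k). (if truthy v then Atom 0 else Atom 1, T\<^sub>0 + t, 0)) p)"
    (is "decides _ _ _ _ ?q")
proof -
  have "prob_accept p \<le> prob_reject ?q" "prob_reject p \<le> prob_accept ?q"
    unfolding prob_accept_def prob_reject_def measure_map_spmf
    by (rule measure_spmf.finite_measure_mono; auto simp: truthy_def)+
  with assms show ?thesis
    unfolding decides_def by fastforce
qed

definition time_bound :: "nat \<Rightarrow> nat poly \<Rightarrow> nat poly \<Rightarrow> nat \<Rightarrow> nat" where
  "time_bound L ps pt x = 4 * prepare_cost x x + build_cost L x + 20
     + (poly pt (model_size_bound L x) + 5 * poly ps (gadget_order L x))"

lemma poly_bounded_time_bound: "poly_bounded (time_bound L ps pt)"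
  unfolding time_bound_def prepare_cost_def power_cost_def search_cost_def number_bits_def search_range_def
    build_cost_def count_cost_def count_row_cost_def params_cost_def param_bound_def layout_cost_def
    assemble_cost_def rows_cost_def repeat_cost_def for_cost_def model_size_bound_def gadget_val_bound_def
    gadget_order_def balance_bound_def block_size_def power2_eq_square Let_def
  by (intro poly_bounded_intros)

lemma gadget_order_mono: "N \<le> N' \<Longrightarrow> gadget_order L N \<le> gadget_order L N'"
  unfolding gadget_order_def block_size_def by (intro add_le_mono mult_le_mono power_mono order_refl) simp_all

text \<open>The constants are \<open>10 * 3 ^ 5\<close> and \<open>4 * 3 ^ 5\<close>, where \<open>3 ^ 5\<close> bounds \<open>exp 5\<close>.\<close>

definition sufficient_parameters :: "real \<Rightarrow> nat poly \<Rightarrow> nat \<Rightarrow> nat poly \<Rightarrow> bool" where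
  "sufficient_parameters \<epsilon> ps L r \<longleftrightarrow> L \<ge> 4 \<and>
     (\<forall>N. real (poly ps (gadget_order L N)) * exp (- pinning L N) \<le> 1 / 10 \<and> exp (- pinning L N) \<le> \<epsilon> / 2 \<and>
       poly r N > 1 \<and> 2430 * real (poly ps (gadget_order L N)) \<le> real (poly r N) \<and> 972 / \<epsilon> \<le> real (poly r N))"

locale reduction_instance = cubic_instance N G for N G +
  fixes \<epsilon> :: real and ps pt r :: "nat poly" and A :: com and L a b :: nat and Zhat :: rat
  assumes \<epsilon>_pos: "\<epsilon> > 0" and tester: "identity_tester (\<lambda>n. ising_minus n n 10 0) \<epsilon> ps pt A"
    and params: "sufficient_parameters \<epsilon> ps L r"
    and Zhat_frac: "a > 0" "b > 0" "enc_rat Zhat = Cell (Cell (Atom 0) (Atom a)) (Atom b)" "real_of_rat Zhat = real a / real b"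
begin

sublocale block_parameters L N
  using params by unfold_locales (simp add: sufficient_parameters_def)

abbreviation (input) sub :: subroutine where
  "sub \<equiv> subroutine_on (enc_model ` {M \<in> ising_minus n n 10 0. rational_model M}) A"

abbreviation (input) input :: val where
  "input \<equiv> Cell (enc_model G) (Cell (Atom (poly r N)) (enc_rat Zhat))"

abbreviation (input) s\<^sub>0 :: store where
  "s\<^sub>0 \<equiv> (\<lambda>_. Atom 0)(0 := input)"

abbreviation (input) J :: nat where
  "J \<equiv> search_result a b N"

lemma r_gt_1: "poly r N > 1"
  using params by (simp add: sufficient_parameters_def)

lemma Zhat_pos: "real_of_rat Zhat > 0"
  using Zhat_frac by simp

definition prepare_time :: nat where
  "prepare_time = prepare_cost N (floorlog 2 a + floorlog 2 b)"

definition input_size :: nat where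
  "input_size = N + vsize (enc_rat Zhat)"

lemma prepare_time_le: "prepare_time \<le> prepare_cost input_size input_size"
  unfolding prepare_time_def by (intro prepare_cost_mono) (simp_all add: input_size_def Zhat_frac(3))

lemma Prepare_outcome:
  obtains s where "runs Prepare s\<^sub>0 s prepare_time" "s r_N = Atom N" "s r_rows = enc_list (map enc_list (coupling_rows N g))"
    "s r_N1 = Atom (N + 1)" "s r_steps = Atom J" "s r_high = Atom (of_bool (search_rhs b N < search_lhs a N))"
    "s r_lhs = Atom (search_lhs a N * (N + 2) ^ J)" "s r_rhs = Atom (search_rhs b N * (N + 1) ^ J)"
    "\<forall>i\<in>{r_outer, r_inner, r_arcs, r_row, r_rest, r_reversed, r_matrix, r_zero}. s i = Atom 0"
    "expr_cost (Arith Less (Reg r_lhs) (Reg r_rhs)) s \<le> 3 + 2 * prepare_time"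
proof -
  obtain flds where input_graph: "enc_model G = Cell (Atom N) (Cell (enc_list (map enc_list (coupling_rows N g))) flds)"
    using enc_model_G by blast
  have input: "s\<^sub>0 r_io = Cell (Cell (Atom N) (Cell (enc_list (map enc_list (coupling_rows N g))) flds))
      (Cell (Atom (poly r N)) (Cell (Cell (Atom 0) (Atom a)) (Atom b)))"
    by (simp add: input_graph Zhat_frac(3))
  have clear: "s\<^sub>0 i = Atom 0" if "i \<noteq> r_io" for i
    using that by simp
  obtain s where store: "runs Prepare s\<^sub>0 s prepare_time" "s r_N = Atom N" "s r_rows = enc_list (map enc_list (coupling_rows N g))"
    "s r_N1 = Atom (N + 1)" "s r_steps = Atom J" "s r_high = Atom (of_bool (search_rhs b N < search_lhs a N))"
    "s r_lhs = Atom (search_lhs a N * (N + 2) ^ J)" "s r_rhs = Atom (search_rhs b N * (N + 1) ^ J)"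
    "\<forall>i\<in>{r_outer, r_inner, r_arcs, r_row, r_rest, r_reversed, r_matrix, r_zero}. s i = Atom 0"
    and bits: "floorlog 2 (search_lhs a N * (N + 2) ^ J) \<le> number_bits N (floorlog 2 a + floorlog 2 b)"
      "floorlog 2 (search_rhs b N * (N + 1) ^ J) \<le> number_bits N (floorlog 2 a + floorlog 2 b)"
    using runs_Prepare[where s = s\<^sub>0, OF input clear, folded prepare_time_def] .
  have "expr_cost (Arith Less (Reg r_lhs) (Reg r_rhs)) s \<le> 3 + 2 * prepare_time"
    using bits number_bits_le_prepare_cost[of N "floorlog 2 a + floorlog 2 b"] by (simp add: store(7,8) prepare_time_def)
  with store show ?thesis by (rule that)
qed

lemma decides_of_runs:
  assumes "runs (Decide L) s (s(r_io := v)) T" "runs Prepare s\<^sub>0 s prepare_time"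
    and "v = Atom 0 \<and> \<not> Z \<ge> real (poly r N) * real_of_rat Zhat \<or> v = Atom 1 \<and> \<not> Z \<le> real_of_rat Zhat / real (poly r N)"
  shows "decides Z (real_of_rat Zhat) (real (poly r N)) (prepare_time + T) (run no_samples sub (Reduce L) input)"
proof -
  have "runs (Reduce L) s\<^sub>0 (s(r_io := v)) (prepare_time + T)"
    unfolding Reduce_def by (rule runs_Seq[OF assms(2,1)])
  then obtain t where "t \<le> prepare_time + T" "run no_samples sub (Reduce L) input = return_spmf (v, t, 0)"
    by (rule run_eq_return) simp
  then show ?thesis
    using decides_return[OF _ assms(3)] by simp
qed

lemma decides_high:
  assumes high: "search_rhs b N < search_lhs a N"
  shows "decides Z (real_of_rat Zhat) (real (poly r N)) (time_bound L ps pt input_size) (run no_samples sub (Reduce L) input)"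
proof -
  obtain s where prepare: "runs Prepare s\<^sub>0 s prepare_time" and store: "s r_high = Atom (of_bool (search_rhs b N < search_lhs a N))"
    by (rule Prepare_outcome)
  have "runs (if truthy (expr_val (Reg r_high) s) then Assign r_io (num 0)
      else If (Arith Less (Reg r_lhs) (Reg r_rhs)) (Assign r_io (num 1)) (Seq (Build L) Answer)) s (s(r_io := Atom 0)) 2"
    using high by (simp add: store truthy_def runs_Assign)
  then have decide: "runs (Decide L) s (s(r_io := Atom 0)) 4"
    unfolding Decide_def by (rule runs_mono[OF runs_If]) simp
  have "Z \<le> 2 ^ N" by (rule Z_le)
  also have "\<dots> < real_of_rat Zhat"
    using search_too_high[OF Zhat_frac(1,2) high] by (simp only: Zhat_frac(4))
  also have "\<dots> \<le> real (poly r N) * real_of_rat Zhat"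
    using r_gt_1 Zhat_pos mult_right_mono[of 1 "real (poly r N)" "real_of_rat Zhat"] by simp
  finally have "decides Z (real_of_rat Zhat) (real (poly r N)) (prepare_time + 4) (run no_samples sub (Reduce L) input)"
    by (intro decides_of_runs[OF decide prepare]) simp
  then show ?thesis
    using prepare_time_le by (elim decides_mono) (simp add: time_bound_def)
qed

lemma decides_low:
  assumes not_high: "\<not> search_rhs b N < search_lhs a N"
    and low: "search_lhs a N * (N + 2) ^ J < search_rhs b N * (N + 1) ^ J"
  shows "decides Z (real_of_rat Zhat) (real (poly r N)) (time_bound L ps pt input_size) (run no_samples sub (Reduce L) input)"
proof -
  obtain s where prepare: "runs Prepare s\<^sub>0 s prepare_time" and store: "s r_high = Atom (of_bool (search_rhs b N < search_lhs a N))"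
      "s r_lhs = Atom (search_lhs a N * (N + 2) ^ J)" "s r_rhs = Atom (search_rhs b N * (N + 1) ^ J)"
    and cost: "expr_cost (Arith Less (Reg r_lhs) (Reg r_rhs)) s \<le> 3 + 2 * prepare_time"
    by (rule Prepare_outcome)
  let ?low = "If (Arith Less (Reg r_lhs) (Reg r_rhs)) (Assign r_io (num 1)) (Seq (Build L) Answer)"
  have "runs (if truthy (expr_val (Arith Less (Reg r_lhs) (Reg r_rhs)) s) then Assign r_io (num 1) else Seq (Build L) Answer)
      s (s(r_io := Atom 1)) 2"
    using low by (simp add: store truthy_def runs_Assign)
  then have "runs ?low s (s(r_io := Atom 1)) (6 + 2 * prepare_time)"
    by (rule runs_mono[OF runs_If]) (use cost in simp)
  then have "runs (if truthy (expr_val (Reg r_high) s) then Assign r_io (num 0) else ?low)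
      s (s(r_io := Atom 1)) (6 + 2 * prepare_time)"
    using not_high by (simp add: store truthy_def)
  then have decide: "runs (Decide L) s (s(r_io := Atom 1)) (8 + 2 * prepare_time)"
    unfolding Decide_def by (rule runs_mono[OF runs_If]) simp
  have "real_of_rat Zhat / real (poly r N) \<le> real_of_rat Zhat"
    using r_gt_1 Zhat_pos divide_left_mono[of 1 "real (poly r N)" "real_of_rat Zhat"] by simp
  also have "\<dots> < exp (- real N)"
    using search_too_low[OF Zhat_frac(1,2) low] by (simp only: Zhat_frac(4))
  also have "\<dots> \<le> Z" by (rule Z_ge)
  finally have "decides Z (real_of_rat Zhat) (real (poly r N)) (prepare_time + (8 + 2 * prepare_time))
      (run no_samples sub (Reduce L) input)"
    by (intro decides_of_runs[OF decide prepare]) simp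
  then show ?thesis
    using prepare_time_le by (elim decides_mono) (simp add: time_bound_def)
qed

lemma tuned_gadgetI:
  assumes "search_lhs a N \<le> search_rhs b N" "search_rhs b N * (N + 1) ^ J \<le> search_lhs a N * (N + 2) ^ J"
  shows "tuned_gadget L N G (balance L N arcs J) (real_of_rat Zhat)"
proof unfold_locales
  show "balance L N arcs J \<le> balance_bound L N"
    by (rule balance_le[OF search_result_le])
  show "0 < real_of_rat Zhat" by (rule Zhat_pos)
  show "\<bar>y * real N - real (balance L N arcs J) - 1 / (real m)\<^sup>2 - 3 / 10 * real arcs - ln (real_of_rat Zhat)\<bar> \<le> 5"
    using search_result_approximates_ln[OF Zhat_frac(1,2) assms] arcs_le L_ge_4 m_sq_ge_1 unfolding Zhat_frac(4) by (rule balance_tuned)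
qed

lemma Reduce_outcome:
  assumes not_high: "\<not> search_rhs b N < search_lhs a N"
    and not_low: "\<not> search_lhs a N * (N + 2) ^ J < search_rhs b N * (N + 1) ^ J"
    and M: "M \<in> ising_minus n n 10 0" "rational_model M"
      "enc_model M = gadget_val m N (frac_val 10 1) (omega_val m (balance L N arcs J)) (frac_val 1 (N + 1)) (coupling_rows N g)"
  obtains t where "t \<le> 3 * prepare_time + build_cost L N + 20"
    "run no_samples sub (Reduce L) input = map_spmf (\<lambda>(v, t', k). (if truthy v then Atom 0 else Atom 1, t + t', 0))
      (run (frozen_source 5) no_subroutine A (enc_model M))"
proof -
  obtain s where prepare: "runs Prepare s\<^sub>0 s prepare_time"
    and store: "s r_N = Atom N" "s r_rows = enc_list (map enc_list (coupling_rows N g))"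
      "s r_N1 = Atom (N + 1)" "s r_steps = Atom J"
      "\<forall>i\<in>{r_outer, r_inner, r_arcs, r_row, r_rest, r_reversed, r_matrix, r_zero}. s i = Atom 0"
      "s r_high = Atom (of_bool (search_rhs b N < search_lhs a N))"
      "s r_lhs = Atom (search_lhs a N * (N + 2) ^ J)" "s r_rhs = Atom (search_rhs b N * (N + 1) ^ J)"
    and cost: "expr_cost (Arith Less (Reg r_lhs) (Reg r_rhs)) s \<le> 3 + 2 * prepare_time"
    by (rule Prepare_outcome)
  obtain s' where build: "runs (Build L) s s' (build_cost L N)" and gadget: "s' r_gadget = enc_model M"
    and frozen: "s' r_frozen1 = enc_config n (frozen 1)" "s' r_frozen2 = enc_config n (frozen 2)"
    using arcs_le
    by (rule runs_Build[OF store(1-5) length_coupling_rows _ search_result_le, unfolded sum_count_coupling_rows])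
      (simp_all add: M(3) gadget_order_def enc_frozen_config)
  have "\<not> truthy (expr_val (Reg r_high) s)" "\<not> truthy (expr_val (Arith Less (Reg r_lhs) (Reg r_rhs)) s)"
    using not_high not_low by (simp_all add: store truthy_def)
  then obtain t where "t \<le> prepare_time + expr_cost (Arith Less (Reg r_lhs) (Reg r_rhs)) s + build_cost L N + 4"
    and reduce: "exec no_samples sub (Reduce L) (s\<^sub>0, 0, 0) = exec no_samples sub Answer (s', t, 0)"
    by (rule exec_Reduce_eq_Answer[OF prepare build])
  then have "t + 5 \<le> 3 * prepare_time + build_cost L N + 20"
    using cost by linarith
  moreover have "exec no_samples sub Answer (s', t, 0)
      = map_spmf (\<lambda>(v, t', k'). (s'(r_answer := v, r_io := if truthy v then Atom 0 else Atom 1), t + t' + 5, 0))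
        (run (frozen_source 5) no_subroutine A (enc_model M))"
    using M(1,2) by (subst exec_Answer) (simp_all add: gadget frozen frozen_source_def)
  then have "run no_samples sub (Reduce L) input
      = map_spmf (\<lambda>(v, t', k). (if truthy v then Atom 0 else Atom 1, t + 5 + t', 0))
        (run (frozen_source 5) no_subroutine A (enc_model M))"
    using reduce by (simp add: run_def spmf.map_comp o_def case_prod_beta ac_simps)
  ultimately show ?thesis using that by blast
qed

lemma decides_tuned:
  assumes not_high: "\<not> search_rhs b N < search_lhs a N"
    and not_low: "\<not> search_lhs a N * (N + 2) ^ J < search_rhs b N * (N + 1) ^ J"
  shows "decides Z (real_of_rat Zhat) (real (poly r N)) (time_bound L ps pt input_size) (run no_samples sub (Reduce L) input)"
proof -
  interpret tuned_gadget L N G "balance L N arcs J" "real_of_rat Zhat"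
    using not_high not_low by (intro tuned_gadgetI) simp_all
  obtain t where overhead: "t \<le> 3 * prepare_time + build_cost L N + 20"
    and outcome: "run no_samples sub (Reduce L) input = map_spmf (\<lambda>(v, t', k). (if truthy v then Atom 0 else Atom 1, t + t', 0))
      (run (frozen_source 5) no_subroutine A (enc_model M))"
    by (rule Reduce_outcome[OF not_high not_low M_in_ising_minus rational_M enc_model_M])
  let ?T = "poly pt (vsize (enc_model M)) + 5 * poly ps n"
  have large: "real (poly ps n) * exp (- y) \<le> 1 / 10" "exp (- y) \<le> \<epsilon> / 2"
      "2430 * real (poly ps n) \<le> real (poly r N)" "972 / \<epsilon> \<le> real (poly r N)"
    using params unfolding sufficient_parameters_def by blast+
  have "decides Z (real_of_rat Zhat) (real (poly r N)) (t + ?T) (run no_samples sub (Reduce L) input)"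
    unfolding outcome
    by (intro decides_negate tester_lossless[OF tester \<epsilon>_pos large] tester_time[OF tester \<epsilon>_pos large]
        tester_accepts[OF tester \<epsilon>_pos large] tester_rejects[OF tester \<epsilon>_pos large])
  moreover have "t + ?T \<le> time_bound L ps pt input_size"
  proof -
    have N_le: "N \<le> input_size" by (simp add: input_size_def)
    have "?T \<le> poly pt (model_size_bound L input_size) + 5 * poly ps (gadget_order L input_size)"
      by (intro add_le_mono mult_le_mono poly_nat_mono order_refl gadget_order_mono N_le
          order_trans[OF vsize_enc_model_M model_size_bound_mono])
    then show ?thesis
      using overhead prepare_time_le build_cost_mono[OF N_le, of L] unfolding time_bound_def by linarith
  qed
  ultimately show ?thesis by (rule decides_mono)
qed

lemma decides_instance:
  "decides Z (real_of_rat Zhat) (real (poly r N)) (time_bound L ps pt input_size) (run no_samples sub (Reduce L) input)"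
  using decides_high decides_low decides_tuned by blast

end

lemma Reduce_decision_counter:
  assumes "\<epsilon> > 0" and params: "sufficient_parameters \<epsilon> ps L r"
    and tester: "identity_tester (\<lambda>n. ising_minus n n 10 0) \<epsilon> ps pt A"
    and time_poly: "\<And>x. time_bound L ps pt x \<le> poly p x"
  shows "decision_counter (\<lambda>N. ising_minus_hat N 3 (-0.6)) (poly r) p
    (\<lambda>N. subroutine_on
      (enc_model ` {M \<in> ising_minus (gadget_order L N) (gadget_order L N) 10 0. rational_model M}) A) (Reduce L)"
  unfolding decision_counter_def Let_def
proof (intro allI ballI impI)
  fix N G and Zhat :: rat
  assume cubic: "G \<in> ising_minus_hat N 3 (-0.6)" and "Zhat > 0"
  obtain a b :: nat where "a > 0" "b > 0" "enc_rat Zhat = Cell (Cell (Atom 0) (Atom a)) (Atom b)"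
      "real_of_rat Zhat = real a / real b"
    by (rule enc_rat_posE[OF \<open>Zhat > 0\<close>])
  then interpret reduction_instance N G \<epsilon> ps pt r A L a b Zhat
    using \<open>\<epsilon> > 0\<close> params tester cubic by unfold_locales
  have "decides Z (real_of_rat Zhat) (real (poly r N)) (poly p input_size) (run no_samples sub (Reduce L) input)"
    using decides_instance time_poly by (rule decides_mono)
  then show "lossless_spmf (run no_samples sub (Reduce L) input)
      \<and> (\<forall>(v, t, k)\<in>set_spmf (run no_samples sub (Reduce L) input). t \<le> poly p (N + vsize (enc_rat Zhat)))
      \<and> (Z \<le> real_of_rat Zhat / real (poly r N) \<longrightarrow> 5 / 8 \<le> prob_reject (run no_samples sub (Reduce L) input))
      \<and> (real (poly r N) * real_of_rat Zhat \<le> Z \<longrightarrow> 5 / 8 \<le> prob_accept (run no_samples sub (Reduce L) input))"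
    by (simp add: decides_def input_size_def)
qed

lemma ex_block_factor:
  fixes ps :: "nat poly"
  assumes "\<epsilon> > 0"
  obtains L where "L \<ge> 4"
    "\<And>N. real (poly ps (gadget_order L N)) * exp (- pinning L N) \<le> 1 / 10" "\<And>N. exp (- pinning L N) \<le> \<epsilon> / 2"
proof -
  let ?q = "pcompose ps [:0, 0, 5:]"
  have "\<forall>\<^sub>F x in sequentially. real (poly ?q x) * exp (- real x) < 1 / 10 \<and> real (poly 1 x) * exp (- real x) < \<epsilon> / 2"
    using assms by (intro eventually_conj order_tendstoD(2)[OF poly_mult_exp_tendsto_0]) simp_all
  then obtain X where large: "\<And>x. x \<ge> X \<Longrightarrow> real (poly ?q x) * exp (- real x) < 1 / 10 \<and> exp (- real x) < \<epsilon> / 2"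
    by (auto simp: eventually_sequentially)
  define L where "L = max 4 X"
  have L_ge: "L \<ge> 4" "L \<ge> X"
    by (simp_all add: L_def)
  show ?thesis
  proof (rule that[OF L_ge(1)])
    fix N
    define x where "x = L * (N + 1)"
    have x_facts: "x \<ge> X" "pinning L N = real x" "N + 1 \<le> x"
      using L_ge mult_le_mono1[of 1 L "N + 1"] by (simp_all add: x_def pinning_def algebra_simps)
    have "gadget_order L N = 4 * ((N + 1) * x) + N"
      by (simp add: gadget_order_def block_size_def x_def power2_eq_square algebra_simps)
    also have "\<dots> \<le> 4 * (x * x) + x * x"
      using x_facts(3) by (intro add_le_mono mult_le_mono order_refl) (simp_all add: trans_le_add1 le_trans[OF _ le_square])
    finally have "poly ps (gadget_order L N) \<le> poly ?q x"
      unfolding poly_pcompose by (intro poly_nat_mono) simp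
    then have "real (poly ps (gadget_order L N)) * exp (- pinning L N) \<le> real (poly ?q x) * exp (- real x)"
      unfolding x_facts(2) by (intro mult_right_mono) simp_all
    then show "real (poly ps (gadget_order L N)) * exp (- pinning L N) \<le> 1 / 10"
      using large[OF x_facts(1)] by linarith
    show "exp (- pinning L N) \<le> \<epsilon> / 2"
      using large[OF x_facts(1)] unfolding x_facts(2) by linarith
  qed
qed

lemma ex_sufficient_parameters:
  assumes "\<epsilon> > 0"
  obtains L r where "sufficient_parameters \<epsilon> ps L r"
proof -
  obtain L where factor: "L \<ge> 4" "\<And>N. real (poly ps (gadget_order L N)) * exp (- pinning L N) \<le> 1 / 10"
      "\<And>N. exp (- pinning L N) \<le> \<epsilon> / 2"
    by (rule ex_block_factor[OF assms, of ps]) blast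
  define c where "c = nat \<lceil>972 / \<epsilon>\<rceil> + 2"
  have "972 / \<epsilon> \<le> real c"
    unfolding c_def using real_nat_ceiling_ge[of "972 / \<epsilon>"] by simp
  moreover have "poly [:4 * L, 8 * L + 1, 4 * L:] N = gadget_order L N" for N
    by (simp add: gadget_order_def block_size_def power2_eq_square algebra_simps)
  ultimately have "sufficient_parameters \<epsilon> ps L ([:c:] + smult 2430 (pcompose ps [:4 * L, 8 * L + 1, 4 * L:]))"
    unfolding sufficient_parameters_def using factor by (simp add: poly_pcompose c_def)
  then show ?thesis by (rule that)
qed

lemma gadget_order_theta:
  assumes "L \<ge> 1"
  shows "(\<lambda>N. real N) \<in> \<Theta>(\<lambda>N. sqrt (real (gadget_order L N)))"
proof (rule bigthetaI)
  have lower: "N\<^sup>2 \<le> gadget_order L N" for N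
    using mult_le_mono[OF assms, of "N\<^sup>2" "(N + 1)\<^sup>2"] by (simp add: gadget_order_def block_size_def)
  show "(\<lambda>N. real N) \<in> O(\<lambda>N. sqrt (real (gadget_order L N)))"
  proof (rule bigoI[of _ 1], rule always_eventually, rule allI)
    show "norm (real N) \<le> 1 * norm (sqrt (real (gadget_order L N)))" for N
      using lower[of N] by (simp add: real_le_rsqrt flip: of_nat_power)
  qed
  have upper: "gadget_order L N \<le> 17 * L * N\<^sup>2" if "N \<ge> 1" for N
  proof -
    have "L * (N + 1)\<^sup>2 \<le> L * (2 * N)\<^sup>2"
      using that by (intro mult_le_mono2 power_mono) simp_all
    also have "\<dots> = 4 * (L * N\<^sup>2)"
      by (simp add: power_mult_distrib)
    finally have "L * (N + 1)\<^sup>2 \<le> 4 * (L * N\<^sup>2)" .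
    moreover have "1 * N \<le> L * N\<^sup>2"
      using assms by (intro mult_le_mono) (simp_all add: power2_eq_square)
    ultimately have "gadget_order L N \<le> 17 * (L * N\<^sup>2)"
      unfolding gadget_order_def block_size_def by linarith
    then show ?thesis by (simp only: mult.assoc)
  qed
  show "(\<lambda>N. real N) \<in> \<Omega>(\<lambda>N. sqrt (real (gadget_order L N)))"
    unfolding bigomega_iff_bigo
  proof (rule bigoI[of _ "sqrt (real (17 * L))"], rule eventually_sequentiallyI[of 1])
    fix N :: nat assume "N \<ge> 1"
    then have "sqrt (real (gadget_order L N)) \<le> sqrt (real (17 * L * N\<^sup>2))"
      by (intro real_sqrt_le_mono) (simp only: of_nat_le_iff upper)
    then show "norm (sqrt (real (gadget_order L N))) \<le> sqrt (real (17 * L)) * norm (real N)"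
      by (simp add: real_sqrt_mult)
  qed
qed

theorem theorem3p2:
  fixes \<epsilon> :: real
  assumes "0 < \<epsilon>" and "\<epsilon> < 1"
  shows "\<exists>\<beta>\<^sub>0>0. \<forall>ps pt :: nat poly. \<exists>(R :: com) (size_n :: nat \<Rightarrow> nat) (r :: nat poly) (p :: nat poly).
    (\<lambda>N. real N) \<in> \<Theta>(\<lambda>N. sqrt (real (size_n N))) \<and>
    (\<forall>N. poly r N > 1) \<and>
    (\<forall>A. identity_tester (\<lambda>n. ising_minus n n \<beta>\<^sub>0 0) \<epsilon> ps pt A \<longrightarrow>
       decision_counter (\<lambda>N. ising_minus_hat N 3 (-0.6)) (poly r) p
         (\<lambda>N. subroutine_on
                (enc_model ` {M \<in> ising_minus (size_n N) (size_n N) \<beta>\<^sub>0 0. rational_model M}) A) R)"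
proof (intro exI[of _ "10::real"] conjI allI)
  fix ps pt :: "nat poly"
  obtain L r where params: "sufficient_parameters \<epsilon> ps L r"
    using ex_sufficient_parameters[OF assms(1), of ps] .
  obtain p :: "nat poly" where time_poly: "\<And>x. time_bound L ps pt x \<le> poly p x"
    using poly_bounded_time_bound unfolding poly_bounded_def by blast
  show "\<exists>(R :: com) (size_n :: nat \<Rightarrow> nat) (r :: nat poly) (p :: nat poly).
    (\<lambda>N. real N) \<in> \<Theta>(\<lambda>N. sqrt (real (size_n N))) \<and>
    (\<forall>N. poly r N > 1) \<and>
    (\<forall>A. identity_tester (\<lambda>n. ising_minus n n 10 0) \<epsilon> ps pt A \<longrightarrow>
       decision_counter (\<lambda>N. ising_minus_hat N 3 (-0.6)) (poly r) p
         (\<lambda>N. subroutine_on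
                (enc_model ` {M \<in> ising_minus (size_n N) (size_n N) 10 0. rational_model M}) A) R)"
    using gadget_order_theta[of L] params Reduce_decision_counter[OF assms(1) params _ time_poly]
    by (intro exI[of _ "Reduce L"] exI[of _ "gadget_order L"] exI[of _ r] exI[of _ p])
      (auto simp: sufficient_parameters_def)
qed simp

end
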